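(* Let $(M,c,J,D)$ be a locally conformally Kähler (LCK) manifold, connected, of complex dimension $n\ge 2$ and not globally conformally Kähler, where $c$ is the conformal class, $J$ the complex structure and $D$ the minimal Weyl connection. Assume that $(M,c,J,D)$ is not locally conformally hyperkähler and that the restricted holonomy group $\mathrm{Hol}_0(D)$ acts irreducibly on the tangent spaces of $M$. Then any infinitesimal affine transformation of the Weyl connection $D$ is an infinitesimal automorphism, i.e. $\mathfrak{aff}(M,D)=\mathfrak{aut}(M)$.
   Context: LCK manifolds. Let $(M,J)$ be a connected smooth manifold of real dimension $2n$, $n\ge 2$, with an integrable complex structure $J$. A Hermitian metric $g$ with fundamental form $\omega(X,Y)=g(JX,Y)$ is LCK if $d\omega=\theta\wedge\omega$ for a closed one-form $\theta$, called the Lee form of $g$. Every metric $e^fg$ is then also LCK, with Lee form $\theta+df$, so the notion depends only on the conformal class $c=[g]$. The minimal Weyl connection of the LCK structure is $$D=\nabla^g-\tfrac12(\theta\otimes\mathrm{id}+\mathrm{id}\otimes\theta-g\otimes\theta^\sharp),$$ where $\nabla^g$ is the Levi-Civita connection of $g$. It does not depend on the choice of $g\in c$, is torsion-free, satisfies $DJ=0$ and $Dg=\theta\otimes g$ (so $Dc=0$), and is locally the Levi-Civita connection of local Kähler metrics in $c$. Not globally conformally Kähler means that $\theta$ is not exact. Locally conformally hyperkähler (LCHK): $(M,c,J,D)$ is LCHK if $M$ carries a hypercomplex structure, i.e. a triple of integrable complex structures satisfying the quaternion relations, each compatible with (orthogonal for) $c$ and each parallel with respect to $D$. Groups and Lie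 algebras: $\mathrm{Aff}(M,D)$ is the Lie group of diffeomorphisms of $M$ preserving $D$. $\mathrm{Aut}(M)$ is the group of diffeomorphisms of $M$ which are both biholomorphic for $J$ and conformal for $c$. $\mathfrak{aff}(M,D)$ and $\mathfrak{aut}(M)$ are their Lie algebras, viewed as Lie algebras of vector fields on $M$ (those whose flows are one-parameter subgroups of the respective group). Their elements are called infinitesimal affine transformations and infinitesimal automorphisms respectively. *)

theory Defs
  imports "HOL-Analysis.Analysis"
begin

section \<open>Smooth functions between Euclidean spaces\<close>

text \<open>Intended for open \<open>S\<close> only.  The derivatives are taken direction by direction, which in
  finite dimension is the usual notion of a \<open>C\<^sup>k\<close> function.\<close>

primrec Ck_on :: "nat \<Rightarrow> 'a::euclidean_space set \<Rightarrow> ('a \<Rightarrow> 'b::real_normed_vector) \<Rightarrow> bool" where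
  "Ck_on 0 S f \<longleftrightarrow> continuous_on S f"
| "Ck_on (Suc k) S f \<longleftrightarrow>
     f differentiable_on S \<and> (\<forall>v. Ck_on k S (\<lambda>x. frechet_derivative f (at x) v))"

definition smooth_on :: "'a::euclidean_space set \<Rightarrow> ('a \<Rightarrow> 'b::real_normed_vector) \<Rightarrow> bool" where
  "smooth_on S f \<longleftrightarrow> (\<forall>k. Ck_on k S f)"


section \<open>Smooth manifolds\<close>

text \<open>A chart is a pair of an open domain and a coordinate map, whose values outside the domain are
  irrelevant.  A manifold consists of all points of a Hausdorff, second countable type
  \<open>'m\<close>; it is modelled on the Euclidean space \<open>'e\<close>, so its dimension is that of \<open>'e\<close>.\<close>

type_synonym ('m, 'e) chart = "'m set \<times> ('m \<Rightarrow> 'e)"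

definition chart_inv :: "('m, 'e) chart \<Rightarrow> 'e \<Rightarrow> 'm" where
  "chart_inv \<kappa> = inv_into (fst \<kappa>) (snd \<kappa>)"

definition smooth_atlas ::
  "('m::{t2_space,second_countable_topology}, 'e::euclidean_space) chart set \<Rightarrow> bool" where
  "smooth_atlas A \<longleftrightarrow>
     (\<Union>\<kappa>\<in>A. fst \<kappa>) = UNIV \<and>
     (\<forall>\<kappa>\<in>A. open (fst \<kappa>) \<and> open (snd \<kappa> ` fst \<kappa>) \<and>
        homeomorphism (fst \<kappa>) (snd \<kappa> ` fst \<kappa>) (snd \<kappa>) (chart_inv \<kappa>)) \<and>
     (\<forall>\<kappa>\<in>A. \<forall>\<mu>\<in>A. smooth_on (snd \<kappa> ` (fst \<kappa> \<inter> fst \<mu>)) (snd \<mu> \<circ> chart_inv \<kappa>))"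

context
  fixes A :: "('m::{t2_space,second_countable_topology}, 'e::euclidean_space) chart set"
begin

subsection \<open>Tangent vectors\<close>

text \<open>One chart around each point \<open>p\<close> is singled out, and the tangent space at \<open>p\<close> is
  identified with the model space \<open>'e\<close> by the differential of that chart.  Thus an element of
  \<open>'e\<close>, regarded as a tangent vector at \<open>p\<close>, is the vector with these components in the
  chart \<open>pchart p\<close>.  The choice may jump from point to point; smoothness of tensor fields is
  therefore always expressed through components in charts of the atlas.\<close>

definition pchart :: "'m \<Rightarrow> ('m, 'e) chart" where
  "pchart p = (SOME \<kappa>. \<kappa> \<in> A \<and> p \<in> fst \<kappa>)"

text \<open>The differential at \<open>p\<close> of the coordinate map of \<open>\<kappa>\<close>: it sends a tangent vector
  to its components in \<open>\<kappa>\<close>.\<close>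

definition dchart :: "('m, 'e) chart \<Rightarrow> 'm \<Rightarrow> 'e \<Rightarrow> 'e" where
  "dchart \<kappa> p = frechet_derivative (snd \<kappa> \<circ> chart_inv (pchart p)) (at (snd (pchart p) p))"

text \<open>The coordinate vector field on the domain of \<open>\<kappa>\<close> with constant components \<open>u\<close>.\<close>

definition coord_field :: "('m, 'e) chart \<Rightarrow> 'e \<Rightarrow> 'm \<Rightarrow> 'e" where
  "coord_field \<kappa> u p = frechet_derivative (snd (pchart p) \<circ> chart_inv \<kappa>) (at (snd \<kappa> p)) u"

subsection \<open>Functions, vector fields, maps\<close>

definition smooth_fun_on :: "'m set \<Rightarrow> ('m \<Rightarrow> real) \<Rightarrow> bool" where
  "smooth_fun_on W f \<longleftrightarrow> (\<forall>\<kappa>\<in>A. smooth_on (snd \<kappa> ` (fst \<kappa> \<inter> W)) (f \<circ> chart_inv \<kappa>))"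

definition dfun :: "('m \<Rightarrow> real) \<Rightarrow> 'm \<Rightarrow> 'e \<Rightarrow> real" where
  "dfun f p = frechet_derivative (f \<circ> chart_inv (pchart p)) (at (snd (pchart p) p))"

text \<open>The components of a vector field in a chart, as a function of the coordinates.\<close>

definition local_rep :: "('m, 'e) chart \<Rightarrow> ('m \<Rightarrow> 'e) \<Rightarrow> 'e \<Rightarrow> 'e" where
  "local_rep \<kappa> X x = dchart \<kappa> (chart_inv \<kappa> x) (X (chart_inv \<kappa> x))"

definition smooth_field_on :: "'m set \<Rightarrow> ('m \<Rightarrow> 'e) \<Rightarrow> bool" where
  "smooth_field_on W X \<longleftrightarrow> (\<forall>\<kappa>\<in>A. smooth_on (snd \<kappa> ` (fst \<kappa> \<inter> W)) (local_rep \<kappa> X))"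

abbreviation vector_field :: "('m \<Rightarrow> 'e) \<Rightarrow> bool" where
  "vector_field \<equiv> smooth_field_on UNIV"

definition lie_bracket :: "('m \<Rightarrow> 'e) \<Rightarrow> ('m \<Rightarrow> 'e) \<Rightarrow> 'm \<Rightarrow> 'e" where
  "lie_bracket X Y p =
     frechet_derivative (local_rep (pchart p) Y) (at (snd (pchart p) p)) (X p) -
     frechet_derivative (local_rep (pchart p) X) (at (snd (pchart p) p)) (Y p)"

definition smooth_map :: "('m \<Rightarrow> 'm) \<Rightarrow> bool" where
  "smooth_map F \<longleftrightarrow> continuous_on UNIV F \<and>
     (\<forall>\<kappa>\<in>A. \<forall>\<mu>\<in>A. smooth_on (snd \<kappa> ` (fst \<kappa> \<inter> F -` fst \<mu>)) (snd \<mu> \<circ> F \<circ> chart_inv \<kappa>))"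

definition diffeo :: "('m \<Rightarrow> 'm) \<Rightarrow> bool" where
  "diffeo F \<longleftrightarrow> bij F \<and> smooth_map F \<and> smooth_map (inv F)"

definition dmap :: "('m \<Rightarrow> 'm) \<Rightarrow> 'm \<Rightarrow> 'e \<Rightarrow> 'e" where
  "dmap F p = frechet_derivative (snd (pchart (F p)) \<circ> F \<circ> chart_inv (pchart p)) (at (snd (pchart p) p))"

definition pushforward :: "('m \<Rightarrow> 'm) \<Rightarrow> ('m \<Rightarrow> 'e) \<Rightarrow> 'm \<Rightarrow> 'e" where
  "pushforward F Y q = dmap F (inv F q) (Y (inv F q))"

subsection \<open>Tensor fields\<close>

definition one_form :: "('m \<Rightarrow> 'e \<Rightarrow> real) \<Rightarrow> bool" where
  "one_form \<theta> \<longleftrightarrow> (\<forall>p. linear (\<theta> p)) \<and>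
     (\<forall>\<kappa>\<in>A. \<forall>u. smooth_fun_on (fst \<kappa>) (\<lambda>p. \<theta> p (coord_field \<kappa> u p)))"

definition endo_field :: "('m \<Rightarrow> 'e \<Rightarrow> 'e) \<Rightarrow> bool" where
  "endo_field J \<longleftrightarrow> (\<forall>p. linear (J p)) \<and>
     (\<forall>\<kappa>\<in>A. \<forall>u. smooth_field_on (fst \<kappa>) (\<lambda>p. J p (coord_field \<kappa> u p)))"

definition riemannian_metric :: "('m \<Rightarrow> 'e \<Rightarrow> 'e \<Rightarrow> real) \<Rightarrow> bool" where
  "riemannian_metric g \<longleftrightarrow>
     (\<forall>p. bilinear (g p)) \<and> (\<forall>p u v. g p u v = g p v u) \<and> (\<forall>p u. u \<noteq> 0 \<longrightarrow> g p u u > 0) \<and>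
     (\<forall>\<kappa>\<in>A. \<forall>u v. smooth_fun_on (fst \<kappa>) (\<lambda>p. g p (coord_field \<kappa> u p) (coord_field \<kappa> v p)))"

definition closed_form :: "('m \<Rightarrow> 'e \<Rightarrow> real) \<Rightarrow> bool" where
  "closed_form \<theta> \<longleftrightarrow> (\<forall>X Y p. vector_field X \<longrightarrow> vector_field Y \<longrightarrow>
     dfun (\<lambda>q. \<theta> q (Y q)) p (X p) - dfun (\<lambda>q. \<theta> q (X q)) p (Y p) - \<theta> p (lie_bracket X Y p) = 0)"

definition exact_form :: "('m \<Rightarrow> 'e \<Rightarrow> real) \<Rightarrow> bool" where
  "exact_form \<theta> \<longleftrightarrow> (\<exists>f. smooth_fun_on UNIV f \<and> \<theta> = dfun f)"

text \<open>Exterior derivative of a 2-form, and the wedge product of a 1-form and a 2-form, without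
  combinatorial factors.\<close>

definition ext_deriv2 ::
  "('m \<Rightarrow> 'e \<Rightarrow> 'e \<Rightarrow> real) \<Rightarrow> ('m \<Rightarrow> 'e) \<Rightarrow> ('m \<Rightarrow> 'e) \<Rightarrow> ('m \<Rightarrow> 'e) \<Rightarrow> 'm \<Rightarrow> real" where
  "ext_deriv2 \<omega> X Y Z p =
     dfun (\<lambda>q. \<omega> q (Y q) (Z q)) p (X p) - dfun (\<lambda>q. \<omega> q (X q) (Z q)) p (Y p)
       + dfun (\<lambda>q. \<omega> q (X q) (Y q)) p (Z p)
     - \<omega> p (lie_bracket X Y p) (Z p) + \<omega> p (lie_bracket X Z p) (Y p) - \<omega> p (lie_bracket Y Z p) (X p)"

definition wedge12 ::
  "('m \<Rightarrow> 'e \<Rightarrow> real) \<Rightarrow> ('m \<Rightarrow> 'e \<Rightarrow> 'e \<Rightarrow> real) \<Rightarrow> 'm \<Rightarrow> 'e \<Rightarrow> 'e \<Rightarrow> 'e \<Rightarrow> real" where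
  "wedge12 \<theta> \<omega> p u v w = \<theta> p u * \<omega> p v w + \<theta> p v * \<omega> p w u + \<theta> p w * \<omega> p u v"


section \<open>Affine connections\<close>

text \<open>A connection \<open>D\<close> is a covariant derivative on locally defined vector fields: for
  \<open>Y\<close> smooth near \<open>p\<close>, the vector \<open>D Y p v\<close> is the covariant derivative of \<open>Y\<close> in the
  direction of the tangent vector \<open>v\<close> at \<open>p\<close>.  Its value on fields that are not smooth
  near \<open>p\<close> is irrelevant.  Locality (\<open>D Y p\<close> depends only on the germ of \<open>Y\<close> at \<open>p\<close>) follows from the
  Leibniz rule by means of bump functions.\<close>

definition connection :: "(('m \<Rightarrow> 'e) \<Rightarrow> 'm \<Rightarrow> 'e \<Rightarrow> 'e) \<Rightarrow> bool" where
  "connection D \<longleftrightarrow> (\<forall>W X Y Z f. open W \<longrightarrow> smooth_field_on W X \<longrightarrow> smooth_field_on W Y \<longrightarrow>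
       smooth_field_on W Z \<longrightarrow> smooth_fun_on W f \<longrightarrow>
     (\<forall>p\<in>W. linear (D Y p) \<and>
        (\<forall>v. D (\<lambda>q. Y q + Z q) p v = D Y p v + D Z p v) \<and>
        (\<forall>v. D (\<lambda>q. f q *\<^sub>R Y q) p v = dfun f p v *\<^sub>R Y p + f p *\<^sub>R D Y p v)) \<and>
     smooth_field_on W (\<lambda>p. D Y p (X p)))"

definition levi_civita ::
  "('m \<Rightarrow> 'e \<Rightarrow> 'e \<Rightarrow> real) \<Rightarrow> (('m \<Rightarrow> 'e) \<Rightarrow> 'm \<Rightarrow> 'e \<Rightarrow> 'e) \<Rightarrow> bool" where
  "levi_civita g N \<longleftrightarrow> connection N \<and>
     (\<forall>X Y p. vector_field X \<longrightarrow> vector_field Y \<longrightarrow>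
        N Y p (X p) - N X p (Y p) = lie_bracket X Y p) \<and>
     (\<forall>X Y Z p. vector_field X \<longrightarrow> vector_field Y \<longrightarrow> vector_field Z \<longrightarrow>
        dfun (\<lambda>q. g q (Y q) (Z q)) p (X p) = g p (N Y p (X p)) (Z p) + g p (Y p) (N Z p (X p)))"

definition parallel_endo ::
  "(('m \<Rightarrow> 'e) \<Rightarrow> 'm \<Rightarrow> 'e \<Rightarrow> 'e) \<Rightarrow> ('m \<Rightarrow> 'e \<Rightarrow> 'e) \<Rightarrow> bool" where
  "parallel_endo D J \<longleftrightarrow>
     (\<forall>Y p v. vector_field Y \<longrightarrow> D (\<lambda>q. J q (Y q)) p v - J p (D Y p v) = 0)"

subsection \<open>Parallel transport and holonomy\<close>

definition has_velocity :: "(real \<Rightarrow> 'm) \<Rightarrow> 'e \<Rightarrow> real \<Rightarrow> real set \<Rightarrow> bool" where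
  "has_velocity \<gamma> u t I \<longleftrightarrow> continuous (at t within I) \<gamma> \<and>
     ((\<lambda>s. snd (pchart (\<gamma> t)) (\<gamma> s)) has_vector_derivative u) (at t within I)"

text \<open>Smoothness of a curve on a compact interval, with all one-sided derivatives at the end points:
  the curve extends smoothly to a neighbourhood of the interval.\<close>

definition smooth_curve_on :: "real set \<Rightarrow> (real \<Rightarrow> 'm) \<Rightarrow> bool" where
  "smooth_curve_on K \<gamma> \<longleftrightarrow> (\<exists>I \<sigma>. open I \<and> K \<subseteq> I \<and> (\<forall>t\<in>K. \<gamma> t = \<sigma> t) \<and> continuous_on I \<sigma> \<and>
     (\<forall>\<kappa>\<in>A. smooth_on (I \<inter> \<sigma> -` fst \<kappa>) (snd \<kappa> \<circ> \<sigma>)))"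

text \<open>A vector field \<open>V\<close> along \<open>\<gamma>\<close> is parallel at \<open>t\<close> if the equation
  \<open>V' + D\<^bsub>\<gamma>'\<^esub> V = 0\<close> holds in the chart singled out at \<open>\<gamma> t\<close>, where
  the second term is the covariant derivative of the coordinate field with components \<open>V t\<close>
  (the Christoffel term).\<close>

definition parallel_at ::
  "(('m \<Rightarrow> 'e) \<Rightarrow> 'm \<Rightarrow> 'e \<Rightarrow> 'e) \<Rightarrow> (real \<Rightarrow> 'm) \<Rightarrow> (real \<Rightarrow> 'e) \<Rightarrow> real set \<Rightarrow> real \<Rightarrow> bool" where
  "parallel_at D \<gamma> V I t \<longleftrightarrow> (\<exists>u. has_velocity \<gamma> u t I \<and>
     ((\<lambda>s. dchart (pchart (\<gamma> t)) (\<gamma> s) (V s)) has_vector_derivative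
        - D (coord_field (pchart (\<gamma> t)) (V t)) (\<gamma> t) u) (at t within I))"

text \<open>Parallel fields along a piecewise smooth curve on the unit interval.\<close>

definition parallel_along ::
  "(('m \<Rightarrow> 'e) \<Rightarrow> 'm \<Rightarrow> 'e \<Rightarrow> 'e) \<Rightarrow> (real \<Rightarrow> 'm) \<Rightarrow> (real \<Rightarrow> 'e) \<Rightarrow> bool" where
  "parallel_along D \<gamma> V \<longleftrightarrow> (\<exists>k \<tau>. \<tau> 0 = 0 \<and> \<tau> k = 1 \<and>
     (\<forall>i<k. \<tau> i < \<tau> (Suc i) \<and> smooth_curve_on {\<tau> i..\<tau> (Suc i)} \<gamma> \<and>
        (\<forall>t\<in>{\<tau> i..\<tau> (Suc i)}. parallel_at D \<gamma> V {\<tau> i..\<tau> (Suc i)} t)))"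

definition parallel_transport ::
  "(('m \<Rightarrow> 'e) \<Rightarrow> 'm \<Rightarrow> 'e \<Rightarrow> 'e) \<Rightarrow> (real \<Rightarrow> 'm) \<Rightarrow> ('e \<Rightarrow> 'e) \<Rightarrow> bool" where
  "parallel_transport D \<gamma> T \<longleftrightarrow> (\<forall>v. \<exists>V. parallel_along D \<gamma> V \<and> V 0 = v \<and> V 1 = T v)"

definition restricted_holonomy ::
  "(('m \<Rightarrow> 'e) \<Rightarrow> 'm \<Rightarrow> 'e \<Rightarrow> 'e) \<Rightarrow> 'm \<Rightarrow> ('e \<Rightarrow> 'e) set" where
  "restricted_holonomy D p =
     {T. \<exists>\<gamma>. homotopic_paths UNIV \<gamma> (\<lambda>_. p) \<and> parallel_transport D \<gamma> T}"

end

definition acts_irreducibly :: "('e::real_vector \<Rightarrow> 'e) set \<Rightarrow> bool" where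
  "acts_irreducibly H \<longleftrightarrow>
     (\<forall>S. subspace S \<longrightarrow> (\<forall>T\<in>H. T ` S \<subseteq> S) \<longrightarrow> S = {0} \<or> S = UNIV)"


section \<open>Locally conformally Kaehler structures\<close>

context
  fixes A :: "('m::{t2_space,second_countable_topology}, 'e::euclidean_space) chart set"
begin

text \<open>Integrability is the vanishing of the Nijenhuis tensor.\<close>

definition nijenhuis :: "('m \<Rightarrow> 'e \<Rightarrow> 'e) \<Rightarrow> ('m \<Rightarrow> 'e) \<Rightarrow> ('m \<Rightarrow> 'e) \<Rightarrow> 'm \<Rightarrow> 'e" where
  "nijenhuis J X Y p =
     lie_bracket A (\<lambda>q. J q (X q)) (\<lambda>q. J q (Y q)) p - J p (lie_bracket A (\<lambda>q. J q (X q)) Y p)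
     - J p (lie_bracket A X (\<lambda>q. J q (Y q)) p) - lie_bracket A X Y p"

definition complex_structure :: "('m \<Rightarrow> 'e \<Rightarrow> 'e) \<Rightarrow> bool" where
  "complex_structure J \<longleftrightarrow> endo_field A J \<and> (\<forall>p u. J p (J p u) = - u) \<and>
     (\<forall>X Y p. vector_field A X \<longrightarrow> vector_field A Y \<longrightarrow> nijenhuis J X Y p = 0)"

definition hermitian_metric :: "('m \<Rightarrow> 'e \<Rightarrow> 'e) \<Rightarrow> ('m \<Rightarrow> 'e \<Rightarrow> 'e \<Rightarrow> real) \<Rightarrow> bool" where
  "hermitian_metric J g \<longleftrightarrow> riemannian_metric A g \<and> (\<forall>p u v. g p (J p u) (J p v) = g p u v)"

definition fundamental_form ::
  "('m \<Rightarrow> 'e \<Rightarrow> 'e) \<Rightarrow> ('m \<Rightarrow> 'e \<Rightarrow> 'e \<Rightarrow> real) \<Rightarrow> 'm \<Rightarrow> 'e \<Rightarrow> 'e \<Rightarrow> real" where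
  "fundamental_form J g p u v = g p (J p u) v"

definition lee_form ::
  "('m \<Rightarrow> 'e \<Rightarrow> 'e) \<Rightarrow> ('m \<Rightarrow> 'e \<Rightarrow> 'e \<Rightarrow> real) \<Rightarrow> ('m \<Rightarrow> 'e \<Rightarrow> real) \<Rightarrow> bool" where
  "lee_form J g \<theta> \<longleftrightarrow> one_form A \<theta> \<and> closed_form A \<theta> \<and>
     (\<forall>X Y Z p. vector_field A X \<longrightarrow> vector_field A Y \<longrightarrow> vector_field A Z \<longrightarrow>
        ext_deriv2 A (fundamental_form J g) X Y Z p
          = wedge12 \<theta> (fundamental_form J g) p (X p) (Y p) (Z p))"

definition lck_metric :: "('m \<Rightarrow> 'e \<Rightarrow> 'e) \<Rightarrow> ('m \<Rightarrow> 'e \<Rightarrow> 'e \<Rightarrow> real) \<Rightarrow> bool" where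
  "lck_metric J g \<longleftrightarrow> hermitian_metric J g \<and> (\<exists>\<theta>. lee_form J g \<theta>)"

definition conformal_class ::
  "('m \<Rightarrow> 'e \<Rightarrow> 'e \<Rightarrow> real) \<Rightarrow> ('m \<Rightarrow> 'e \<Rightarrow> 'e \<Rightarrow> real) set" where
  "conformal_class g = {(\<lambda>p u v. exp (f p) * g p u v) | f. smooth_fun_on A UNIV f}"

definition sharp :: "('m \<Rightarrow> 'e \<Rightarrow> 'e \<Rightarrow> real) \<Rightarrow> ('m \<Rightarrow> 'e \<Rightarrow> real) \<Rightarrow> 'm \<Rightarrow> 'e" where
  "sharp g \<theta> p = (THE w. \<forall>v. g p w v = \<theta> p v)"

definition minimal_weyl_connection ::
  "('m \<Rightarrow> 'e \<Rightarrow> 'e) \<Rightarrow> ('m \<Rightarrow> 'e \<Rightarrow> 'e \<Rightarrow> real) \<Rightarrow> (('m \<Rightarrow> 'e) \<Rightarrow> 'm \<Rightarrow> 'e \<Rightarrow> 'e) \<Rightarrow> bool" where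
  "minimal_weyl_connection J g D \<longleftrightarrow> (\<exists>\<theta> N. lee_form J g \<theta> \<and> levi_civita A g N \<and>
     (\<forall>Y p v. D Y p v = N Y p v -
        (1/2) *\<^sub>R (\<theta> p v *\<^sub>R Y p + \<theta> p (Y p) *\<^sub>R v - g p v (Y p) *\<^sub>R sharp g \<theta> p)))"

text \<open>The conditions on the metric do not depend on its choice within the conformal class.\<close>

definition lck_manifold ::
  "('m \<Rightarrow> 'e \<Rightarrow> 'e \<Rightarrow> real) set \<Rightarrow> ('m \<Rightarrow> 'e \<Rightarrow> 'e) \<Rightarrow> (('m \<Rightarrow> 'e) \<Rightarrow> 'm \<Rightarrow> 'e \<Rightarrow> 'e) \<Rightarrow> bool" where
  "lck_manifold c J D \<longleftrightarrow> complex_structure J \<and>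
     (\<exists>g. c = conformal_class g \<and> lck_metric J g \<and> minimal_weyl_connection J g D)"

definition globally_conformally_kaehler ::
  "('m \<Rightarrow> 'e \<Rightarrow> 'e \<Rightarrow> real) set \<Rightarrow> ('m \<Rightarrow> 'e \<Rightarrow> 'e) \<Rightarrow> bool" where
  "globally_conformally_kaehler c J \<longleftrightarrow> (\<exists>g\<in>c. \<exists>\<theta>. lee_form J g \<theta> \<and> exact_form A \<theta>)"

definition lchk_manifold ::
  "('m \<Rightarrow> 'e \<Rightarrow> 'e \<Rightarrow> real) set \<Rightarrow> (('m \<Rightarrow> 'e) \<Rightarrow> 'm \<Rightarrow> 'e \<Rightarrow> 'e) \<Rightarrow> bool" where
  "lchk_manifold c D \<longleftrightarrow> (\<exists>I\<^sub>1 I\<^sub>2 I\<^sub>3.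
     (\<forall>p u. I\<^sub>1 p (I\<^sub>2 p u) = I\<^sub>3 p u \<and> I\<^sub>2 p (I\<^sub>1 p u) = - I\<^sub>3 p u) \<and>
     (\<forall>I\<in>{I\<^sub>1, I\<^sub>2, I\<^sub>3}. complex_structure I \<and> (\<forall>g\<in>c. hermitian_metric I g) \<and> parallel_endo A D I))"


section \<open>Transformation groups and their Lie algebras\<close>

definition aff_group :: "(('m \<Rightarrow> 'e) \<Rightarrow> 'm \<Rightarrow> 'e \<Rightarrow> 'e) \<Rightarrow> ('m \<Rightarrow> 'm) set" where
  "aff_group D = {F. diffeo A F \<and> (\<forall>Y p v. vector_field A Y \<longrightarrow>
     dmap A F p (D Y p v) = D (pushforward A F Y) (F p) (dmap A F p v))}"

definition biholomorphic :: "('m \<Rightarrow> 'e \<Rightarrow> 'e) \<Rightarrow> ('m \<Rightarrow> 'm) \<Rightarrow> bool" where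
  "biholomorphic J F \<longleftrightarrow> diffeo A F \<and> (\<forall>p v. dmap A F p (J p v) = J (F p) (dmap A F p v))"

definition conformal_map ::
  "('m \<Rightarrow> 'e \<Rightarrow> 'e \<Rightarrow> real) set \<Rightarrow> ('m \<Rightarrow> 'm) \<Rightarrow> bool" where
  "conformal_map c F \<longleftrightarrow> (\<forall>g\<in>c. (\<lambda>p u v. g (F p) (dmap A F p u) (dmap A F p v)) \<in> c)"

definition aut_group ::
  "('m \<Rightarrow> 'e \<Rightarrow> 'e \<Rightarrow> real) set \<Rightarrow> ('m \<Rightarrow> 'e \<Rightarrow> 'e) \<Rightarrow> ('m \<Rightarrow> 'm) set" where
  "aut_group c J = {F. diffeo A F \<and> biholomorphic J F \<and> conformal_map c F}"

definition is_flow :: "('m \<Rightarrow> 'e) \<Rightarrow> (real \<Rightarrow> 'm \<Rightarrow> 'm) \<Rightarrow> bool" where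
  "is_flow X \<Phi> \<longleftrightarrow> \<Phi> 0 = id \<and> (\<forall>s t. \<Phi> (s + t) = \<Phi> s \<circ> \<Phi> t) \<and>
     (\<forall>t p. has_velocity A (\<lambda>s. \<Phi> s p) (X (\<Phi> t p)) t UNIV)"

text \<open>The Lie algebra of a transformation group, as the set of complete vector fields whose flow is a
  one-parameter subgroup.\<close>

definition lie_algebra :: "('m \<Rightarrow> 'm) set \<Rightarrow> ('m \<Rightarrow> 'e) set" where
  "lie_algebra G = {X. vector_field A X \<and> (\<exists>\<Phi>. is_flow X \<Phi> \<and> (\<forall>t. \<Phi> t \<in> G))}"

definition aff_algebra :: "(('m \<Rightarrow> 'e) \<Rightarrow> 'm \<Rightarrow> 'e \<Rightarrow> 'e) \<Rightarrow> ('m \<Rightarrow> 'e) set" where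
  "aff_algebra D = lie_algebra (aff_group D)"

definition aut_algebra ::
  "('m \<Rightarrow> 'e \<Rightarrow> 'e \<Rightarrow> real) set \<Rightarrow> ('m \<Rightarrow> 'e \<Rightarrow> 'e) \<Rightarrow> ('m \<Rightarrow> 'e) set" where
  "aut_algebra c J = lie_algebra (aut_group c J)"

end

end

theory Submission
  imports Defs
begin

text \<open>
  Let \<open>F\<close> be an affine map. The forms \<open>g\<close>, \<open>F\<^sup>*g\<close> are recurrent for \<open>D\<close>, so parallel transport along a
  loop scales each of them by a factor. As the holonomy acts irreducibly and a maximum or minimum of
  \<open>F\<^sup>*g / g\<close> on unit vectors forces the two factors to agree, \<open>F\<^sup>*g\<close> is a multiple of \<open>g\<close>, and \<open>F\<close> is
  conformal. The pulled back complex structure \<open>I = F\<^sup>*J\<close> is parallel and Hermitian, so by the same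
  argument \<open>IJ + JI\<close> is a constant; either \<open>I = \<plusminus>J\<close>, or \<open>I\<close> and \<open>J\<close> generate a parallel hypercomplex
  structure, which is excluded. The sign disappears for the square of \<open>F\<close>, hence for flows.

  Conversely an automorphism pulls the Lee form of \<open>g\<close> back to that of \<open>F\<^sup>*g = e\<^sup>f g\<close>, namely \<open>\<theta> + df\<close>, since
  \<open>\<and>\<omega>\<close> is injective on one-forms in real dimension at least 4. Then \<open>D\<close> and \<open>F\<^sup>*D\<close>
  are torsion-free with the same derivative of \<open>F\<^sup>*g\<close>, and coincide by Koszul's argument.
\<close>

text \<open>Tangent vectors at all points live in one model space through a choice of charts that
  jumps, so a field along a curve need not even be continuous as a vector-valued function. The
  analysis therefore handles only scalars \<open>b (\<gamma> s) (V s) (W s)\<close> and components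
  in one fixed chart. An element of the holonomy comes with its parallel fields; for recurrent
  \<open>b\<close> their pairing solves f' = \<eta>(\<gamma>') f off finitely many times, and an
  integrating factor built from \<eta> alone yields the scaling. Torsion and compatibility are given
  for global fields, while the parallel equation is written with coordinate fields. A bump function
  with value 1 and zero differential at the point passes from one to the other. The connection is
  defined through the Levi-Civita connection and \<theta>. That \<open>J\<close> is parallel has to
  be extracted from the Lee equation and integrability; only then is \<open>J\<close> comparable
  with its pullback. The two uses of irreducibility differ: \<open>F\<^sup>*g\<close> has its own
  one-form and takes positivity to match the factors, whereas \<open>IJ + JI\<close> may be
  indefinite but shares the one-form \<theta> of \<open>g\<close>.\<close>

section \<open>Calculus of smooth functions on open subsets of Euclidean spaces\<close>

lemma frechet_derivative_cong_open:
  assumes "open S" "x \<in> S" "\<And>y. y \<in> S \<Longrightarrow> f y = g y"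
  shows "frechet_derivative f (at x) = frechet_derivative g (at x)"
proof -
  have "(f has_derivative L) (at x) \<longleftrightarrow> (g has_derivative L) (at x)" for L
    using has_derivative_transform_within_open[OF _ assms(1,2), of f L UNIV g]
      has_derivative_transform_within_open[OF _ assms(1,2), of g L UNIV f] assms(3) by auto
  then show ?thesis
    by (simp add: frechet_derivative_def)
qed

lemma frechet_derivative_eqI:
  "(f has_derivative L) (at x) \<Longrightarrow> frechet_derivative f (at x) = L"
  using frechet_derivative_at by metis

lemma Ck_on_SucI:
  assumes "open S" "\<And>x. x \<in> S \<Longrightarrow> (f has_derivative f' x) (at x)"
    and "\<And>v. Ck_on k S (\<lambda>x. frechet_derivative f (at x) v)"
  shows "Ck_on (Suc k) S f"
proof -
  have "f differentiable_on S"
    unfolding differentiable_on_def using assms(2) differentiableI has_derivative_at_withinI by blast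
  with assms(3) show ?thesis by simp
qed

lemma Ck_on_SucD:
  assumes "Ck_on (Suc k) S f" "open S" "x \<in> S"
  shows "(f has_derivative frechet_derivative f (at x)) (at x)"
proof -
  have "f differentiable (at x within S)"
    using assms by (simp add: differentiable_on_def)
  then show ?thesis
    using at_within_open[OF assms(3,2)] frechet_derivative_works by metis
qed

lemma Ck_on_eq:
  assumes "open S" "\<And>x. x \<in> S \<Longrightarrow> f x = g x" "Ck_on k S f"
  shows "Ck_on k S g"
  using assms(2,3)
proof (induction k arbitrary: f g)
  case 0
  then show ?case by (simp cong: continuous_on_cong)
next
  case (Suc k)
  have "(g has_derivative frechet_derivative f (at x)) (at x)" if "x \<in> S" for x
    using has_derivative_transform_within_open[OF Ck_on_SucD[OF Suc.prems(2) \<open>open S\<close> that] \<open>open S\<close> that]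
      Suc.prems(1) by blast
  moreover have "Ck_on k S (\<lambda>x. frechet_derivative g (at x) v)" for v
    by (rule Suc.IH[of "\<lambda>x. frechet_derivative f (at x) v"])
      (use frechet_derivative_cong_open[OF \<open>open S\<close>, of _ f g] Suc.prems in simp_all)
  ultimately show ?case
    by (rule Ck_on_SucI[OF \<open>open S\<close>])
qed

lemma Ck_on_SucI':
  assumes "open S" "\<And>x. x \<in> S \<Longrightarrow> (f has_derivative f' x) (at x)"
    and "\<And>v. Ck_on k S (\<lambda>x. f' x v)"
  shows "Ck_on (Suc k) S f"
proof (rule Ck_on_SucI[OF assms(1,2)])
  show "Ck_on k S (\<lambda>x. frechet_derivative f (at x) v)" for v
    by (rule Ck_on_eq[OF assms(1) _ assms(3)]) (simp add: frechet_derivative_eqI[OF assms(2)])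
qed

lemma Ck_on_Suc_imp: "open S \<Longrightarrow> Ck_on (Suc k) S f \<Longrightarrow> Ck_on k S f"
proof (induction k arbitrary: f)
  case 0
  then show ?case by (simp add: differentiable_imp_continuous_on)
next
  case (Suc k)
  show ?case
    by (rule Ck_on_SucI[OF Suc.prems(1) Ck_on_SucD[OF Suc.prems(2,1)]])
      (use Suc in auto)
qed

lemma Ck_on_subset: "Ck_on k S f \<Longrightarrow> T \<subseteq> S \<Longrightarrow> Ck_on k T f"
  by (induction k arbitrary: f) (auto intro: continuous_on_subset differentiable_on_subset)

lemma Ck_on_local:
  assumes "open S" "\<And>x. x \<in> S \<Longrightarrow> \<exists>U. open U \<and> x \<in> U \<and> Ck_on k U f"
  shows "Ck_on k S f"
  using assms(2)
proof (induction k arbitrary: f)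
  case 0
  have "isCont f x" if "x \<in> S" for x
    using 0[OF that] by (auto simp: continuous_on_eq_continuous_at)
  then show ?case
    by (simp add: continuous_at_imp_continuous_on)
next
  case (Suc k)
  have "(f has_derivative frechet_derivative f (at x)) (at x)" if "x \<in> S" for x
    using Suc.prems[OF that] Ck_on_SucD by blast
  moreover have "Ck_on k S (\<lambda>x. frechet_derivative f (at x) v)" for v
    by (rule Suc.IH) (use Suc.prems in fastforce)
  ultimately show ?case
    by (rule Ck_on_SucI[OF \<open>open S\<close>])
qed

lemma Ck_on_const: "Ck_on k S (\<lambda>x. c)"
  by (induction k arbitrary: c) auto

lemma Ck_on_linear: "bounded_linear L \<Longrightarrow> open S \<Longrightarrow> Ck_on k S L"
proof (cases k)
  case (Suc j)
  then show "bounded_linear L \<Longrightarrow> open S \<Longrightarrow> ?thesis"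
    using Ck_on_SucI'[of S L "\<lambda>_. L" j] bounded_linear_imp_has_derivative Ck_on_const by blast
qed (simp add: linear_continuous_on)

lemma Ck_on_add:
  assumes "open S" "Ck_on k S f" "Ck_on k S g"
  shows "Ck_on k S (\<lambda>x. f x + g x)"
  using assms(2,3)
proof (induction k arbitrary: f g)
  case 0
  then show ?case by (simp add: continuous_on_add)
next
  case (Suc k)
  have "((\<lambda>x. f x + g x) has_derivative
      (\<lambda>v. frechet_derivative f (at x) v + frechet_derivative g (at x) v)) (at x)" if "x \<in> S" for x
    by (rule has_derivative_add; rule Ck_on_SucD[OF _ \<open>open S\<close> that]) (use Suc.prems in auto)
  moreover have "Ck_on k S (\<lambda>x. frechet_derivative f (at x) v + frechet_derivative g (at x) v)" for v
    by (rule Suc.IH) (use Suc.prems in auto)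
  ultimately show ?case
    by (rule Ck_on_SucI'[OF \<open>open S\<close>])
qed

lemma Ck_on_bilinear:
  assumes B: "bounded_bilinear B" and "open S" "Ck_on k S f" "Ck_on k S g"
  shows "Ck_on k S (\<lambda>x. B (f x) (g x))"
  using assms(3,4)
proof (induction k arbitrary: f g)
  case 0
  then show ?case
    by (simp add: bounded_bilinear.continuous_on[OF B])
next
  case (Suc k)
  let ?D = "\<lambda>h x v. frechet_derivative h (at x) v"
  have "((\<lambda>x. B (f x) (g x)) has_derivative (\<lambda>v. B (f x) (?D g x v) + B (?D f x v) (g x))) (at x)"
    if "x \<in> S" for x
    by (rule bounded_bilinear.FDERIV[OF B]; rule Ck_on_SucD[OF _ \<open>open S\<close> that]) (use Suc.prems in auto)
  moreover have "Ck_on k S (\<lambda>x. B (f x) (?D g x v) + B (?D f x v) (g x))" for v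
    by (rule Ck_on_add[OF \<open>open S\<close>]; rule Suc.IH)
      (use Suc.prems in \<open>auto intro: Ck_on_Suc_imp[OF \<open>open S\<close>] simp del: Ck_on.simps(2)\<close>, auto)
  ultimately show ?case
    by (rule Ck_on_SucI'[OF \<open>open S\<close>])
qed

lemma Ck_on_sum:
  assumes "open S" "\<And>i. i \<in> I \<Longrightarrow> Ck_on k S (f i)"
  shows "Ck_on k S (\<lambda>x. \<Sum>i\<in>I. f i x)"
  using assms by (induction I rule: infinite_finite_induct) (auto intro: Ck_on_const Ck_on_add)

text \<open>\<open>Ck_on\<close> controls derivatives in fixed directions only; this expansion
  reduces a varying direction to finitely many fixed ones with scalar coefficients.\<close>

lemma linear_basis_expansion:
  fixes L :: "'a::euclidean_space \<Rightarrow> 'b::real_vector"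
  assumes "linear L"
  shows "L v = (\<Sum>b\<in>Basis. (v \<bullet> b) *\<^sub>R L b)"
proof -
  have "L v = L (\<Sum>b\<in>Basis. (v \<bullet> b) *\<^sub>R b)" by (simp add: euclidean_representation)
  also have "\<dots> = (\<Sum>b\<in>Basis. (v \<bullet> b) *\<^sub>R L b)"
    by (simp add: linear_sum[OF assms] linear_scale[OF assms])
  finally show ?thesis .
qed

text \<open>By the chain rule \<open>f\<close> is differentiated at \<open>g x\<close> in a
  direction that varies with \<open>x\<close>. Expanded over the basis, each summand is a scalar
  built from \<open>g\<close> times a partial derivative of \<open>f\<close> composed with
  \<open>g\<close>, and the induction hypothesis covers the latter because it quantifies over the
  outer function.\<close>

lemma Ck_on_compose:
  fixes g :: "'a::euclidean_space \<Rightarrow> 'b::euclidean_space" and f :: "'b \<Rightarrow> 'c::real_normed_vector"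
  assumes "open S" "open T" "\<And>x. x \<in> S \<Longrightarrow> g x \<in> T" "Ck_on k T f" "Ck_on k S g"
  shows "Ck_on k S (\<lambda>x. f (g x))"
  using assms(4,5)
proof (induction k arbitrary: f)
  case 0
  then show ?case
    using assms(3) by (auto intro: continuous_on_compose2)
next
  case (Suc k)
  let ?D = "\<lambda>h x. frechet_derivative h (at x)"
  have "((\<lambda>x. f (g x)) has_derivative (\<lambda>v. \<Sum>b\<in>Basis. (?D g x v \<bullet> b) *\<^sub>R ?D f (g x) b)) (at x)"
    if "x \<in> S" for x
  proof -
    note f = Ck_on_SucD[OF Suc.prems(1) assms(2) assms(3)[OF that]]
    have "((\<lambda>x. f (g x)) has_derivative (\<lambda>v. ?D f (g x) (?D g x v))) (at x)"
      by (rule has_derivative_compose[OF Ck_on_SucD[OF Suc.prems(2) assms(1) that] f])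
    also have "(\<lambda>v. ?D f (g x) (?D g x v)) = (\<lambda>v. \<Sum>b\<in>Basis. (?D g x v \<bullet> b) *\<^sub>R ?D f (g x) b)"
      using linear_basis_expansion[OF has_derivative_linear[OF f]] by blast
    finally show ?thesis .
  qed
  moreover have "Ck_on k S (\<lambda>x. \<Sum>b\<in>Basis. (?D g x v \<bullet> b) *\<^sub>R ?D f (g x) b)" for v
  proof (intro Ck_on_sum Ck_on_bilinear[OF bounded_bilinear_scaleR]
      Ck_on_bilinear[OF bounded_bilinear_inner] assms(1) Ck_on_const)
    show "Ck_on k S (\<lambda>x. ?D g x v)" using Suc.prems by simp
    show "Ck_on k S (\<lambda>x. ?D f (g x) b)" for b
      by (rule Suc.IH) (use Suc.prems Ck_on_Suc_imp[OF assms(1)] in \<open>auto simp del: Ck_on.simps(2)\<close>, auto)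
  qed
  ultimately show ?case
    by (rule Ck_on_SucI'[OF \<open>open S\<close>])
qed

lemma smooth_on_eq: "open S \<Longrightarrow> (\<And>x. x \<in> S \<Longrightarrow> f x = g x) \<Longrightarrow> smooth_on S f \<Longrightarrow> smooth_on S g"
  unfolding smooth_on_def using Ck_on_eq by blast

lemma smooth_on_subset: "smooth_on S f \<Longrightarrow> T \<subseteq> S \<Longrightarrow> smooth_on T f"
  unfolding smooth_on_def using Ck_on_subset by blast

lemma smooth_on_local:
  "open S \<Longrightarrow> (\<And>x. x \<in> S \<Longrightarrow> \<exists>U. open U \<and> x \<in> U \<and> smooth_on U f) \<Longrightarrow> smooth_on S f"
  unfolding smooth_on_def using Ck_on_local by metis

lemma smooth_on_const: "smooth_on S (\<lambda>x. c)"
  by (simp add: smooth_on_def Ck_on_const)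

lemma smooth_on_linear: "bounded_linear L \<Longrightarrow> open S \<Longrightarrow> smooth_on S L"
  by (simp add: smooth_on_def Ck_on_linear)

lemma smooth_on_id: "open S \<Longrightarrow> smooth_on S (\<lambda>x. x)"
  by (simp add: smooth_on_linear bounded_linear_ident)

lemma smooth_on_add: "open S \<Longrightarrow> smooth_on S f \<Longrightarrow> smooth_on S g \<Longrightarrow> smooth_on S (\<lambda>x. f x + g x)"
  by (simp add: smooth_on_def Ck_on_add)

lemma smooth_on_bilinear:
  "bounded_bilinear B \<Longrightarrow> open S \<Longrightarrow> smooth_on S f \<Longrightarrow> smooth_on S g \<Longrightarrow> smooth_on S (\<lambda>x. B (f x) (g x))"
  by (simp add: smooth_on_def Ck_on_bilinear)

lemmas smooth_on_scaleR = smooth_on_bilinear[OF bounded_bilinear_scaleR]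
lemmas smooth_on_inner = smooth_on_bilinear[OF bounded_bilinear_inner]
lemmas smooth_on_mult = smooth_on_bilinear[OF bounded_bilinear_mult]

lemma smooth_on_sum:
  "open S \<Longrightarrow> (\<And>i. i \<in> I \<Longrightarrow> smooth_on S (f i)) \<Longrightarrow> smooth_on S (\<lambda>x. \<Sum>i\<in>I. f i x)"
  by (simp add: smooth_on_def Ck_on_sum)

lemma smooth_on_compose:
  fixes g :: "'a::euclidean_space \<Rightarrow> 'b::euclidean_space"
  assumes "open S" "open T" "\<And>x. x \<in> S \<Longrightarrow> g x \<in> T" "smooth_on T f" "smooth_on S g"
  shows "smooth_on S (\<lambda>x. f (g x))"
  using assms by (auto simp: smooth_on_def intro: Ck_on_compose)

lemma smooth_on_has_derivative:
  "smooth_on S f \<Longrightarrow> open S \<Longrightarrow> x \<in> S \<Longrightarrow> (f has_derivative frechet_derivative f (at x)) (at x)"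
  unfolding smooth_on_def using Ck_on_SucD by blast

lemma smooth_on_linear_derivative:
  "smooth_on S f \<Longrightarrow> open S \<Longrightarrow> x \<in> S \<Longrightarrow> linear (frechet_derivative f (at x))"
  by (rule has_derivative_linear[OF smooth_on_has_derivative])

lemma smooth_on_derivative:
  "smooth_on S f \<Longrightarrow> smooth_on S (\<lambda>x. frechet_derivative f (at x) v)"
  unfolding smooth_on_def using Ck_on.simps(2) by blast

lemma smooth_on_derivative_app:
  fixes f :: "'a::euclidean_space \<Rightarrow> 'b::real_normed_vector"
  assumes "open S" "smooth_on S f" "smooth_on S w"
  shows "smooth_on S (\<lambda>x. frechet_derivative f (at x) (w x))"
proof (rule smooth_on_eq[OF assms(1)])
  show "smooth_on S (\<lambda>x. \<Sum>b\<in>Basis. (w x \<bullet> b) *\<^sub>R frechet_derivative f (at x) b)"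
    by (intro smooth_on_sum smooth_on_scaleR smooth_on_inner smooth_on_const smooth_on_derivative assms)
qed (use linear_basis_expansion[OF smooth_on_linear_derivative[OF assms(2,1)]] in metis)

lemma smooth_on_continuous: "smooth_on S f \<Longrightarrow> continuous_on S f"
  unfolding smooth_on_def using Ck_on.simps(1) by blast

text \<open>The derivative is again a product of copies of \<open>inverse\<close>, so the induction
  on the order closes by itself.\<close>

lemma smooth_on_inverse: "smooth_on {x::real. x \<noteq> 0} inverse"
  unfolding smooth_on_def
proof
  have o: "open {x::real. x \<noteq> 0}"
    by (simp add: open_Collect_neq)
  show "Ck_on k {x::real. x \<noteq> 0} inverse" for k
  proof (induction k)
    case 0
    show ?case by (auto intro!: continuous_intros)
  next
    case (Suc k)
    show ?case
    proof (rule Ck_on_SucI'[OF o])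
      show "(inverse has_derivative (\<lambda>v. - (inverse x * v * inverse x))) (at x)" if "x \<in> {x::real. x \<noteq> 0}"
          for x
        using that by (auto intro: has_derivative_inverse')
      have "Ck_on k {x::real. x \<noteq> 0} (\<lambda>x. (-v) *\<^sub>R (inverse x * inverse x))" for v
        by (intro Ck_on_bilinear[OF bounded_bilinear_scaleR] Ck_on_bilinear[OF bounded_bilinear_mult] o
            Suc Ck_on_const)
      then show "Ck_on k {x::real. x \<noteq> 0} (\<lambda>x. - (inverse x * v * inverse x))" for v
        by (simp add: mult.commute mult.left_commute)
    qed
  qed
qed

lemma smooth_on_exp: "smooth_on UNIV (exp :: real \<Rightarrow> real)"
  unfolding smooth_on_def
proof
  show "Ck_on k UNIV (exp :: real \<Rightarrow> real)" for k
  proof (induction k)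
    case 0
    show ?case by (auto intro!: continuous_intros)
  next
    case (Suc k)
    show ?case
    proof (rule Ck_on_SucI'[OF open_UNIV])
      show "(exp has_derivative (\<lambda>v. exp x * v)) (at x)" for x :: real
        using DERIV_exp[of x] by (simp add: has_field_derivative_def)
      show "Ck_on k UNIV (\<lambda>x::real. exp x * v)" for v
        by (intro Ck_on_bilinear[OF bounded_bilinear_mult] open_UNIV Suc Ck_on_const)
    qed
  qed
qed

lemma smooth_on_ln: "smooth_on {0<..} (ln :: real \<Rightarrow> real)"
  unfolding smooth_on_def
proof
  have inv: "Ck_on k {0<..} (inverse :: real \<Rightarrow> real)" for k
    using smooth_on_inverse by (auto simp: smooth_on_def intro: Ck_on_subset)
  show "Ck_on k {0<..} (ln :: real \<Rightarrow> real)" for k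
  proof (cases k)
    case 0
    then show ?thesis by (auto intro!: continuous_intros)
  next
    case (Suc k)
    show ?thesis unfolding Suc
    proof (rule Ck_on_SucI'[OF open_greaterThan])
      show "(ln has_derivative (\<lambda>v. inverse x * v)) (at x)" if "x \<in> {0<..}" for x :: real
        using DERIV_ln[of x] that by (simp add: has_field_derivative_def)
      show "Ck_on k {0<..} (\<lambda>x::real. inverse x * v)" for v
        by (intro Ck_on_bilinear[OF bounded_bilinear_mult] open_greaterThan inv Ck_on_const)
    qed
  qed
qed

section \<open>Bump functions\<close>

text \<open>The classical exp (-1/x) continued by 0. The powers of 1/x are included because the span
  of the whole family is closed under differentiation, so one induction makes every member
  smooth.\<close>

definition flat :: "nat \<Rightarrow> real \<Rightarrow> real" where
  "flat n x = (if x > 0 then exp (- inverse x) * inverse x ^ n else 0)"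

text \<open>At 0 the right difference quotient is \<open>y ^ (n + 1) / exp y\<close> with y = 1/x,
  which tends to 0 because the exponential beats every power; the left one vanishes
  identically.\<close>

lemma flat_deriv: "(flat n has_real_derivative flat (n + 2) x - n * flat (n + 1) x) (at x)"
proof (cases "x = 0")
  case False
  show ?thesis
  proof (cases "x > 0")
    case True
    have "((\<lambda>x. exp (- inverse x) * inverse x ^ n) has_real_derivative flat (n + 2) x - n * flat (n
        + 1) x) (at x)"
      using True by (auto intro!: derivative_eq_intros simp: flat_def power_add power2_eq_square
          algebra_simps)
        (cases n; simp add: algebra_simps)
    then show ?thesis
      by (rule has_field_derivative_transform_within_open[where S = "{0<..}"])
          (use True in \<open>auto simp: flat_def\<close>)
  next
    case False
    have "((\<lambda>x. 0) has_real_derivative flat (n + 2) x - n * flat (n + 1) x) (at x)"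
      using False by (simp add: flat_def)
    then show ?thesis
      by (rule has_field_derivative_transform_within_open[where S = "{..<0}"])
        (use False \<open>x \<noteq> 0\<close> in \<open>auto simp: flat_def\<close>)
  qed
next
  case True
  have "((\<lambda>y. flat n y / y) \<longlongrightarrow> 0) (at_right 0)"
  proof (rule Lim_transform_eventually)
    have "((\<lambda>x. inverse x ^ (n + 1) / exp (inverse x)) \<longlongrightarrow> (0::real)) (at_right 0)"
      by (rule filterlim_compose[OF tendsto_power_div_exp_0 filterlim_inverse_at_top_right])
    then show "((\<lambda>x::real. inverse x ^ (n + 1) / exp (inverse x)) \<longlongrightarrow> 0) (at_right 0)" .
    show "\<forall>\<^sub>F x in at_right 0. inverse x ^ (n + 1) / exp (inverse x) = flat n x / x"
      using eventually_at_right_less by eventually_elim (simp add: flat_def exp_minus field_simps)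
  qed
  moreover have "((\<lambda>y. flat n y / y) \<longlongrightarrow> 0) (at_left 0)"
  proof (rule Lim_transform_eventually[OF tendsto_const])
    show "\<forall>\<^sub>F x in at_left 0. 0 = flat n x / x"
      unfolding eventually_at_filter by (simp add: flat_def)
  qed
  ultimately have "((\<lambda>y. flat n y / y) \<longlongrightarrow> 0) (at 0)"
    by (simp add: filterlim_split_at)
  then show ?thesis
    using True by (simp add: has_field_derivative_iff flat_def)
qed

lemma smooth_on_flat: "smooth_on UNIV (flat n)"
  unfolding smooth_on_def
proof
  show "Ck_on k UNIV (flat n)" for k
  proof (induction k arbitrary: n)
    case 0
    show ?case
      using flat_deriv[of n] by (auto intro!: continuous_at_imp_continuous_on DERIV_isCont)
  next
    case (Suc k)
    show ?case
    proof (rule Ck_on_SucI'[OF open_UNIV])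
      show "(flat n has_derivative (\<lambda>v. flat (n + 2) x * v + (- real n * v) * flat (n + 1) x)) (at x)" for x
        by (rule has_derivative_eq_rhs[OF flat_deriv[of n x, unfolded has_field_derivative_def]])
          (simp add: fun_eq_iff algebra_simps)
      show "Ck_on k UNIV (\<lambda>x. flat (n + 2) x * v + (- real n * v) * flat (n + 1) x)" for v
        by (intro Ck_on_add Ck_on_bilinear[OF bounded_bilinear_mult] open_UNIV Suc Ck_on_const)
    qed
  qed
qed

text \<open>\<open>flat 0\<close> of r^2 - |x - a|^2, normalised at the centre. Monotonicity of
  \<open>flat 0\<close> makes the centre a maximum, which gives the zero differential; this makes
  the cut-off invisible to first derivatives at \<open>a\<close>.\<close>

lemma euclidean_bump:
  fixes a :: "'a::euclidean_space"
  assumes "r > 0"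
  obtains \<psi> :: "'a \<Rightarrow> real" where "smooth_on UNIV \<psi>" "\<psi> a = 1" "(\<psi> has_derivative (\<lambda>v. 0)) (at a)"
    "\<And>x. x \<notin> ball a r \<Longrightarrow> \<psi> x = 0"
proof
  define \<psi> where "\<psi> = (\<lambda>x. inverse (flat 0 (r\<^sup>2)) * flat 0 (r\<^sup>2 + (- 1) * ((x + - a) \<bullet> (x + - a))))"
  have pos: "flat 0 (r\<^sup>2) > 0"
    using assms by (simp add: flat_def)
  show sm: "smooth_on UNIV \<psi>"
    unfolding \<psi>_def
    by (intro smooth_on_mult smooth_on_compose[OF open_UNIV open_UNIV UNIV_I smooth_on_flat] smooth_on_add
        smooth_on_inner smooth_on_const smooth_on_id open_UNIV)
  show "\<psi> a = 1"
    using pos by (simp add: \<psi>_def)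
  have mono: "flat 0 s \<le> flat 0 t" if "s \<le> t" for s t
    using that by (auto simp: flat_def)
  have "\<psi> x \<le> \<psi> a" for x
    unfolding \<psi>_def using pos by (intro mult_left_mono mono) auto
  then have "frechet_derivative \<psi> (at a) = (\<lambda>v. 0)"
    using differential_zero_maxmin[OF UNIV_I open_UNIV smooth_on_has_derivative[OF sm open_UNIV UNIV_I]]
        by blast
  then show "(\<psi> has_derivative (\<lambda>v. 0)) (at a)"
    using smooth_on_has_derivative[OF sm open_UNIV, of a] by simp
  show "\<psi> x = 0" if "x \<notin> ball a r" for x
  proof -
    have "r\<^sup>2 \<le> (norm (x - a))\<^sup>2"
      using that assms by (intro power_mono) (auto simp: dist_norm norm_minus_commute)
    then show ?thesis
      by (simp add: \<psi>_def flat_def power2_norm_eq_inner)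
  qed
qed

section \<open>Symmetry of the second derivative\<close>

text \<open>The mean value theorem is applied twice: in direction \<open>u\<close> to the difference
  of \<open>f\<close> across the step \<open>h *\<^sub>R v\<close>, then in direction
  \<open>v\<close> to the derivative along \<open>u\<close>. The bound on \<open>h\<close> keeps the
  parallelogram inside the ball.\<close>

lemma second_difference_mvt:
  fixes f :: "'a::euclidean_space \<Rightarrow> real"
  assumes sm: "smooth_on (ball x r) f" and h: "h > 0" "h * (norm u + norm v) < r"
  shows "\<exists>y\<in>ball x r. f (x + h *\<^sub>R u + h *\<^sub>R v) - f (x + h *\<^sub>R u) - f (x + h *\<^sub>R v) + f x
    = h * h * frechet_derivative (\<lambda>y. frechet_derivative f (at y) u) (at y) v"
proof -
  let ?D = "\<lambda>f x. frechet_derivative f (at x)"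
  have inball: "x + s *\<^sub>R u + t *\<^sub>R v \<in> ball x r" if "0 \<le> s" "s \<le> h" "0 \<le> t" "t \<le> h" for s t
  proof -
    have "norm (s *\<^sub>R u + t *\<^sub>R v) \<le> s * norm u + t * norm v"
      using that by (intro order.trans[OF norm_triangle_ineq]) simp
    also have "\<dots> \<le> h * norm u + h * norm v"
      using that by (intro add_mono mult_right_mono) auto
    finally have "norm (s *\<^sub>R u + t *\<^sub>R v) < r"
      using h by (simp add: algebra_simps)
    then show ?thesis
      using norm_minus_cancel[of "s *\<^sub>R u + t *\<^sub>R v"] by (simp add: dist_norm)
  qed
  \<comment> \<open>The summand \<open>0 *\<^sub>R v\<close> is kept so that both terms are
    instances of \<open>inball\<close> and \<open>f1\<close>, at t = h and at t = 0.\<close>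
  define \<phi> where "\<phi> s = f (x + s *\<^sub>R u + h *\<^sub>R v) - f (x + s *\<^sub>R u + 0 *\<^sub>R v)" for s
  have f1: "((\<lambda>s. f (x + s *\<^sub>R u + t *\<^sub>R v)) has_real_derivative ?D f (x + s *\<^sub>R u + t *\<^sub>R v) u) (at s)"
    if "0 \<le> s" "s \<le> h" "0 \<le> t" "t \<le> h" for s t
  proof -
    note d = smooth_on_has_derivative[OF sm open_ball inball[OF that]]
    have "((\<lambda>s. f (x + s *\<^sub>R u + t *\<^sub>R v)) has_derivative (\<lambda>k. ?D f (x + s *\<^sub>R u
        + t *\<^sub>R v) (k *\<^sub>R u))) (at s)"
      by (rule has_derivative_compose[where f = "\<lambda>s. x + s *\<^sub>R u + t *\<^sub>R v", OF _ d])
          (auto intro!: derivative_eq_intros)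
    then show ?thesis
      by (simp add: has_field_derivative_def linear_scale[OF has_derivative_linear[OF d]] mult_commute_abs)
  qed
  have "\<exists>z>0. z < h \<and> \<phi> h - \<phi> 0 = (h - 0) *
      (?D f (x + z *\<^sub>R u + h *\<^sub>R v) u - ?D f (x + z *\<^sub>R u + 0 *\<^sub>R v) u)"
    unfolding \<phi>_def by (rule MVT2[OF h(1)]) (auto intro!: DERIV_diff f1 simp del: scaleR_zero_left
        add_0_right)
  then obtain \<xi> where \<xi>: "0 < \<xi>" "\<xi> < h" and e1: "\<phi> h - \<phi> 0 = h *
      (?D f (x + \<xi> *\<^sub>R u + h *\<^sub>R v) u - ?D f (x + \<xi> *\<^sub>R u + 0 *\<^sub>R v) u)" by auto
  let ?g = "\<lambda>y. ?D f y u"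
  have f2: "((\<lambda>t. ?g (x + \<xi> *\<^sub>R u + t *\<^sub>R v)) has_real_derivative ?D ?g (x + \<xi> *\<^sub>R u + t *\<^sub>R v) v) (at t)"
    if "0 \<le> t" "t \<le> h" for t
  proof -
    have inb: "x + \<xi> *\<^sub>R u + t *\<^sub>R v \<in> ball x r" using \<xi> that by (intro inball) auto
    note d = smooth_on_has_derivative[OF smooth_on_derivative[OF sm] open_ball inb]
    have "((\<lambda>t. ?g (x + \<xi> *\<^sub>R u + t *\<^sub>R v)) has_derivative (\<lambda>k. ?D ?g (x + \<xi> *\<^sub>R u
        + t *\<^sub>R v) (k *\<^sub>R v))) (at t)"
      by (rule has_derivative_compose[where f = "\<lambda>t. x + \<xi> *\<^sub>R u + t *\<^sub>R v", OF _ d])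
          (auto intro!: derivative_eq_intros)
    then show ?thesis
      by (simp add: has_field_derivative_def linear_scale[OF has_derivative_linear[OF d]] mult_commute_abs)
  qed
  have "\<exists>z>0. z < h \<and> ?g (x + \<xi> *\<^sub>R u + h *\<^sub>R v) - ?g (x + \<xi> *\<^sub>R u + 0 *\<^sub>R v)
      = (h - 0) * ?D ?g (x + \<xi> *\<^sub>R u + z *\<^sub>R v) v"
    by (rule MVT2[OF h(1)]) (use f2 in blast)
  then obtain \<eta> where \<eta>: "0 < \<eta>" "\<eta> < h" and e2: "?g (x + \<xi> *\<^sub>R u + h *\<^sub>R v) - ?g (x + \<xi> *\<^sub>R u + 0 *\<^sub>R v)
      = h * ?D ?g (x + \<xi> *\<^sub>R u + \<eta> *\<^sub>R v) v" by auto
  have "f (x + h *\<^sub>R u + h *\<^sub>R v) - f (x + h *\<^sub>R u) - f (x + h *\<^sub>R v) + f x = \<phi> h - \<phi> 0"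
    by (simp add: \<phi>_def)
  also have "\<dots> = h * h * ?D ?g (x + \<xi> *\<^sub>R u + \<eta> *\<^sub>R v) v"
    using e1 e2 by simp
  finally show ?thesis
    using inball[of \<xi> \<eta>] \<xi> \<eta> by auto
qed

text \<open>The second difference is symmetric in \<open>u\<close> and \<open>v\<close>, and by
  \<open>second_difference_mvt\<close> it equals h^2 times either mixed derivative at a nearby
  point. Continuity of both derivatives at \<open>x\<close> then leaves no room for a gap.\<close>

lemma second_derivative_symmetric_real:
  fixes f :: "'a::euclidean_space \<Rightarrow> real"
  assumes "open S" "smooth_on S f" "x \<in> S"
  shows "frechet_derivative (\<lambda>y. frechet_derivative f (at y) u) (at x) v
    = frechet_derivative (\<lambda>y. frechet_derivative f (at y) v) (at x) u"
proof -
  define D2 where "D2 u v y = frechet_derivative (\<lambda>y. frechet_derivative f (at y) u) (at y) v" for u v y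
  have cont: "isCont (D2 u v) x" for u v
    unfolding D2_def
        using smooth_on_continuous[OF smooth_on_derivative[OF smooth_on_derivative[OF assms(2)]]]
      assms(1,3) by (simp add: continuous_on_eq_continuous_at)
  have "dist (D2 u v x) (D2 v u x) \<le> 0 + e" if e: "e > 0" for e
  proof -
    obtain d1 where d1: "d1 > 0" "\<And>y. dist y x < d1 \<Longrightarrow> dist (D2 u v y) (D2 u v x) < e / 2"
      using cont[of u v] e unfolding continuous_at_eps_delta by (metis half_gt_zero)
    obtain d2 where d2: "d2 > 0" "\<And>y. dist y x < d2 \<Longrightarrow> dist (D2 v u y) (D2 v u x) < e / 2"
      using cont[of v u] e unfolding continuous_at_eps_delta by (metis half_gt_zero)
    obtain d3 where d3: "d3 > 0" "ball x d3 \<subseteq> S"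
      using assms(1,3) open_contains_ball by blast
    define r where "r = min d1 (min d2 d3)"
    have r: "r > 0" "r \<le> d1" "r \<le> d2" "ball x r \<subseteq> S"
      using d1 d2 d3 by (auto simp: r_def)
    \<comment> \<open>The added 1 keeps the denominator positive when both directions vanish and
      makes \<open>h * (norm u + norm v) < r\<close> strict.\<close>
    define h where "h = r / (norm u + norm v + 1)"
    have n: "norm u + norm v + 1 > 0" by (simp add: add_nonneg_pos)
    have h: "h > 0" "h * (norm u + norm v) < r"
      using r(1) n by (auto simp: h_def field_simps)
    note sm = smooth_on_subset[OF assms(2) r(4)]
    obtain y1 where y1: "y1 \<in> ball x r" "f (x + h *\<^sub>R u + h *\<^sub>R v) - f (x + h *\<^sub>R u) - f (x + h *\<^sub>R v)
        + f x = h * h * D2 u v y1"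
      using second_difference_mvt[OF sm h] unfolding D2_def by blast
    obtain y2 where y2: "y2 \<in> ball x r" "f (x + h *\<^sub>R v + h *\<^sub>R u) - f (x + h *\<^sub>R v) - f (x + h *\<^sub>R u)
        + f x = h * h * D2 v u y2"
      using second_difference_mvt[OF sm h(1), of v u] h(2) unfolding D2_def by (metis add.commute)
    have "h * h * D2 u v y1 = h * h * D2 v u y2"
      using y1(2) y2(2) by (simp only: add.assoc add.commute[of "h *\<^sub>R v"])
    then have "D2 u v y1 = D2 v u y2" using h(1) by simp
    moreover have "dist (D2 u v y1) (D2 u v x) < e / 2" "dist (D2 v u y2) (D2 v u x) < e / 2"
      using y1(1) y2(1) r d1(2)[of y1] d2(2)[of y2] by (auto simp: dist_commute)
    ultimately show ?thesis
      by (metis add_0 dist_commute dist_triangle_half_l less_imp_le)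
  qed
  then have "dist (D2 u v x) (D2 v u x) \<le> 0"
    by (rule field_le_epsilon)
  then show ?thesis by (simp add: D2_def)
qed

lemma second_derivative_symmetric:
  fixes f :: "'a::euclidean_space \<Rightarrow> 'b::euclidean_space"
  assumes "open S" "smooth_on S f" "x \<in> S"
  shows "frechet_derivative (\<lambda>y. frechet_derivative f (at y) u) (at x) v
    = frechet_derivative (\<lambda>y. frechet_derivative f (at y) v) (at x) u"
proof (rule euclidean_eqI)
  fix b :: 'b
  let ?D = "\<lambda>f x. frechet_derivative f (at x)"
  have sm: "smooth_on S (\<lambda>y. f y \<bullet> b)"
    by (intro smooth_on_inner smooth_on_const assms)
  have D1: "?D (\<lambda>y. f y \<bullet> b) y = (\<lambda>w. ?D f y w \<bullet> b)" if "y \<in> S" for y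
    by (rule frechet_derivative_eqI) (intro has_derivative_inner_left
        smooth_on_has_derivative[OF assms(2,1) that])
  have D2: "?D (\<lambda>y. ?D (\<lambda>y. f y \<bullet> b) y u) x v = ?D (\<lambda>y. ?D f y u) x v \<bullet> b" for u v
  proof -
    have "?D (\<lambda>y. ?D (\<lambda>y. f y \<bullet> b) y u) x = ?D (\<lambda>y. ?D f y u \<bullet> b) x"
      by (rule frechet_derivative_cong_open[OF assms(1,3)]) (simp add: D1)
    also have "\<dots> = (\<lambda>w. ?D (\<lambda>y. ?D f y u) x w \<bullet> b)"
      by (rule frechet_derivative_eqI)
        (intro has_derivative_inner_left smooth_on_has_derivative[OF smooth_on_derivative[OF assms(2)]
            assms(1,3)])
    finally show ?thesis by simp
  qed
  show "?D (\<lambda>y. ?D f y u) x v \<bullet> b = ?D (\<lambda>y. ?D f y v) x u \<bullet> b"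
    using second_derivative_symmetric_real[OF assms(1) sm assms(3), of u v] by (simp add: D2)
qed

locale smooth_manifold =
  fixes A :: "('m::{t2_space,second_countable_topology}, 'e::euclidean_space) chart set"
  assumes atlas: "smooth_atlas A"
begin

section \<open>Charts\<close>

lemma chart_open: "k \<in> A \<Longrightarrow> open (fst k)"
  using atlas by (simp add: smooth_atlas_def)

lemma chart_homeomorphism:
  "k \<in> A \<Longrightarrow> homeomorphism (fst k) (snd k ` fst k) (snd k) (chart_inv k)"
  using atlas by (simp add: smooth_atlas_def)

lemma chart_inv_left: "k \<in> A \<Longrightarrow> p \<in> fst k \<Longrightarrow> chart_inv k (snd k p) = p"
  using chart_homeomorphism[of k] by (auto simp: homeomorphism_def)

lemma chart_inv_right: "k \<in> A \<Longrightarrow> x \<in> snd k ` fst k \<Longrightarrow> snd k (chart_inv k x) = x"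
  using chart_homeomorphism[of k] by (auto simp: homeomorphism_def)

lemma chart_inv_in: "k \<in> A \<Longrightarrow> x \<in> snd k ` fst k \<Longrightarrow> chart_inv k x \<in> fst k"
  using chart_inv_left[of k] by auto

lemma chart_continuous: "k \<in> A \<Longrightarrow> continuous_on (fst k) (snd k)"
  using chart_homeomorphism by (auto simp: homeomorphism_def)

lemma chart_inv_continuous: "k \<in> A \<Longrightarrow> continuous_on (snd k ` fst k) (chart_inv k)"
  using chart_homeomorphism by (auto simp: homeomorphism_def)

lemma chart_image_open:
  assumes "k \<in> A" "open U" "U \<subseteq> fst k"
  shows "open (snd k ` U)"
proof -
  have "snd k ` U = snd k ` fst k \<inter> chart_inv k -` U"
    using assms(3) chart_inv_left[OF assms(1)] by force
  moreover have "open (snd k ` fst k)"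
    using atlas assms(1) by (simp add: smooth_atlas_def)
  ultimately show ?thesis
    using continuous_open_preimage[OF chart_inv_continuous[OF assms(1)] _ assms(2)] by simp
qed

lemma pchart: "pchart A p \<in> A" "p \<in> fst (pchart A p)"
proof -
  have "p \<in> (\<Union>k\<in>A. fst k)"
    using atlas by (simp add: smooth_atlas_def)
  then have "\<exists>k. k \<in> A \<and> p \<in> fst k" by blast
  from someI_ex[OF this] show "pchart A p \<in> A" "p \<in> fst (pchart A p)"
    unfolding pchart_def by auto
qed

lemma transition_smooth:
  "k \<in> A \<Longrightarrow> m \<in> A \<Longrightarrow> smooth_on (snd k ` (fst k \<inter> fst m)) (snd m \<circ> chart_inv k)"
  using atlas by (simp add: smooth_atlas_def)

lemma overlap_open: "k \<in> A \<Longrightarrow> m \<in> A \<Longrightarrow> open (snd k ` (fst k \<inter> fst m))"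
  by (simp add: chart_image_open chart_open open_Int)

text \<open>The Jacobian of the coordinate change from \<open>k\<close> to \<open>m\<close>. Both
  \<open>dchart\<close> and \<open>coord_field\<close> are the cases in which one of the two charts
  is \<open>pchart\<close>, so their rules all come from the chain rule for
  \<open>trd\<close>.\<close>

definition trd :: "('m, 'e) chart \<Rightarrow> ('m, 'e) chart \<Rightarrow> 'm \<Rightarrow> 'e \<Rightarrow> 'e" where
  "trd k m p = frechet_derivative (snd m \<circ> chart_inv k) (at (snd k p))"

lemma trd_has_derivative:
  assumes "k \<in> A" "m \<in> A" "p \<in> fst k" "p \<in> fst m"
  shows "((snd m \<circ> chart_inv k) has_derivative trd k m p) (at (snd k p))"
  unfolding trd_def
  by (rule smooth_on_has_derivative[OF transition_smooth overlap_open]) (use assms in auto)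

lemma trd_linear: "k \<in> A \<Longrightarrow> m \<in> A \<Longrightarrow> p \<in> fst k \<Longrightarrow> p \<in> fst m \<Longrightarrow> linear (trd k m p)"
  by (rule has_derivative_linear[OF trd_has_derivative])

lemma trd_self:
  assumes "k \<in> A" "p \<in> fst k"
  shows "trd k k p v = v"
proof -
  have "((\<lambda>x. x) has_derivative (\<lambda>v. v)) (at (snd k p))" by simp
  then have "((snd k \<circ> chart_inv k) has_derivative (\<lambda>v. v)) (at (snd k p))"
    by (rule has_derivative_transform_within_open[where s = "snd k ` fst k"])
      (use assms chart_image_open[OF assms(1) chart_open] chart_inv_right in auto)
  then show ?thesis
    unfolding trd_def by (simp add: frechet_derivative_eqI)
qed

lemma trd_comp:
  assumes "k \<in> A" "m \<in> A" "n \<in> A" "p \<in> fst k" "p \<in> fst m" "p \<in> fst n"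
  shows "trd m n p (trd k m p v) = trd k n p v"
proof -
  have "((snd n \<circ> chart_inv m) \<circ> (snd m \<circ> chart_inv k) has_derivative trd m n p \<circ> trd k m p) (at (snd k p))"
    by (rule diff_chain_at[OF trd_has_derivative])
      (use assms trd_has_derivative[of m n p] in \<open>simp_all add: chart_inv_left\<close>)
  then have "((snd n \<circ> chart_inv k) has_derivative trd m n p \<circ> trd k m p) (at (snd k p))"
    by (rule has_derivative_transform_within_open[where s = "snd k ` (fst k \<inter> fst m)"])
      (use assms overlap_open chart_inv_left[of k] chart_inv_left[of m] in auto)
  then show ?thesis
    unfolding trd_def by (simp add: frechet_derivative_eqI o_def fun_eq_iff)
qed

lemma dchart_trd: "dchart A k p = trd (pchart A p) k p"
  by (simp add: dchart_def trd_def)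

lemma coord_field_trd: "coord_field A k u p = trd k (pchart A p) p u"
  by (simp add: coord_field_def trd_def)

lemma linear_dchart: "k \<in> A \<Longrightarrow> p \<in> fst k \<Longrightarrow> linear (dchart A k p)"
  by (simp add: dchart_trd trd_linear pchart)

lemma linear_coord_field: "k \<in> A \<Longrightarrow> p \<in> fst k \<Longrightarrow> linear (\<lambda>u. coord_field A k u p)"
  unfolding coord_field_trd by (rule trd_linear) (simp_all add: pchart)

lemma dchart_coord_field: "k \<in> A \<Longrightarrow> p \<in> fst k \<Longrightarrow> dchart A k p (coord_field A k u p) = u"
  by (simp add: dchart_trd coord_field_trd trd_comp pchart trd_self)

lemma coord_field_dchart: "k \<in> A \<Longrightarrow> p \<in> fst k \<Longrightarrow> coord_field A k (dchart A k p u) p = u"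
  by (simp add: dchart_trd coord_field_trd trd_comp pchart trd_self)

lemma trd_dchart:
  "k \<in> A \<Longrightarrow> m \<in> A \<Longrightarrow> p \<in> fst k \<Longrightarrow> p \<in> fst m \<Longrightarrow> trd k m p (dchart A k p u) = dchart A m p u"
  by (simp add: dchart_trd trd_comp pchart)

lemma dchart_pchart [simp]: "dchart A (pchart A p) p u = u"
  by (simp add: dchart_trd trd_self pchart)

lemma coord_field_pchart [simp]: "coord_field A (pchart A p) u p = u"
  by (simp add: coord_field_trd trd_self pchart)

section \<open>Smooth functions and vector fields\<close>

lemma smooth_fun_onD:
  "smooth_fun_on A W f \<Longrightarrow> k \<in> A \<Longrightarrow> U \<subseteq> W \<Longrightarrow> U \<subseteq> fst k \<Longrightarrow> smooth_on (snd k ` U) (f \<circ> chart_inv k)"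
  unfolding smooth_fun_on_def by (rule smooth_on_subset) auto

text \<open>Common pattern behind \<open>smooth_fun_onI\<close> and \<open>smooth_field_onI\<close>:
  \<open>R k\<close> stands for the coordinate expression in \<open>k\<close> of a function or a
  field, and only the transformation law \<open>change\<close> distinguishes the two cases.\<close>

lemma smooth_on_chart_change:
  assumes W: "open W" and m: "m \<in> A"
    and loc: "\<And>p. p \<in> W \<Longrightarrow> \<exists>k\<in>A. \<exists>U. open U \<and> p \<in> U \<and> U \<subseteq> fst k \<and> smooth_on (snd k ` U) (R k)"
    and change: "\<And>k U. k \<in> A \<Longrightarrow> open U \<Longrightarrow> U \<subseteq> fst k \<Longrightarrow> U \<subseteq> fst m \<Longrightarrow>
      smooth_on (snd k ` U) (R k) \<Longrightarrow> smooth_on (snd m ` U) (R m)"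
  shows "smooth_on (snd m ` (fst m \<inter> W)) (R m)"
proof (rule smooth_on_local)
  show "open (snd m ` (fst m \<inter> W))"
    using m W by (simp add: chart_image_open chart_open open_Int)
  fix y assume "y \<in> snd m ` (fst m \<inter> W)"
  then obtain p where p: "p \<in> fst m" "p \<in> W" "y = snd m p" by auto
  obtain k U where k: "k \<in> A" "open U" "p \<in> U" "U \<subseteq> fst k" "smooth_on (snd k ` U) (R k)"
    using loc[OF p(2)] by blast
  have V: "open (fst m \<inter> U)"
    using m k(2) by (simp add: chart_open open_Int)
  have "smooth_on (snd k ` (fst m \<inter> U)) (R k)"
    by (rule smooth_on_subset[OF k(5)]) auto
  then have "smooth_on (snd m ` (fst m \<inter> U)) (R m)"
    by (rule change[OF k(1) V, rotated 2]) (use k(4) in auto)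
  moreover have "open (snd m ` (fst m \<inter> U))"
    by (rule chart_image_open[OF m V]) auto
  ultimately show "\<exists>V. open V \<and> y \<in> V \<and> smooth_on V (R m)"
    using p k(3) by blast
qed

lemma transition_smooth_on:
  assumes "k \<in> A" "m \<in> A" "U \<subseteq> fst k" "U \<subseteq> fst m"
  shows "smooth_on (snd m ` U) (snd k \<circ> chart_inv m)"
    "\<And>y. y \<in> snd m ` U \<Longrightarrow> (snd k \<circ> chart_inv m) y \<in> snd k ` U"
  using assms smooth_on_subset[OF transition_smooth[OF assms(2,1)], of "snd m ` U"]
      chart_inv_left[OF assms(2)]
  by force+

lemma smooth_fun_onI:
  assumes "open W" and "\<And>p. p \<in> W \<Longrightarrow> \<exists>k\<in>A. \<exists>U. open U \<and> p \<in> U \<and> U \<subseteq> fst k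
      \<and> smooth_on (snd k ` U) (f \<circ> chart_inv k)"
  shows "smooth_fun_on A W f"
  unfolding smooth_fun_on_def
proof
  fix m assume m: "m \<in> A"
  show "smooth_on (snd m ` (fst m \<inter> W)) (f \<circ> chart_inv m)"
  proof (rule smooth_on_chart_change[where R = "\<lambda>k. f \<circ> chart_inv k", OF assms(1) m assms(2)])
    fix k U assume k: "k \<in> A" and U: "open U" "U \<subseteq> fst k" "U \<subseteq> fst m"
      and sm: "smooth_on (snd k ` U) (f \<circ> chart_inv k)"
    have oU: "open (snd m ` U)" by (rule chart_image_open[OF m U(1,3)])
    have "smooth_on (snd m ` U) (\<lambda>y. (f \<circ> chart_inv k) ((snd k \<circ> chart_inv m) y))"
      using smooth_on_compose[where g = "snd k \<circ> chart_inv m", OF oU chart_image_open[OF k U(1,2)]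
        transition_smooth_on(2)[OF k m U(2,3)] sm transition_smooth_on(1)[OF k m U(2,3)]] .
    then show "smooth_on (snd m ` U) (f \<circ> chart_inv m)"
      by (rule smooth_on_eq[OF oU, rotated]) (use chart_inv_left[OF m] chart_inv_left[OF k] U(2,3)
          in \<open>auto simp: subset_iff\<close>)
  qed
qed

lemma smooth_field_onD:
  "smooth_field_on A W X \<Longrightarrow> k \<in> A \<Longrightarrow> U \<subseteq> W \<Longrightarrow> U \<subseteq> fst k \<Longrightarrow> smooth_on (snd k ` U) (local_rep A k X)"
  unfolding smooth_field_on_def by (rule smooth_on_subset) auto

lemma smooth_field_onI:
  assumes "open W" and "\<And>p. p \<in> W \<Longrightarrow> \<exists>k\<in>A. \<exists>U. open U \<and> p \<in> U \<and> U \<subseteq> fst k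
      \<and> smooth_on (snd k ` U) (local_rep A k X)"
  shows "smooth_field_on A W X"
  unfolding smooth_field_on_def
proof
  fix m assume m: "m \<in> A"
  show "smooth_on (snd m ` (fst m \<inter> W)) (local_rep A m X)"
  proof (rule smooth_on_chart_change[where R = "\<lambda>k. local_rep A k X", OF assms(1) m assms(2)])
    fix k U assume k: "k \<in> A" and U: "open U" "U \<subseteq> fst k" "U \<subseteq> fst m"
      and sm: "smooth_on (snd k ` U) (local_rep A k X)"
    have oU: "open (snd m ` U)" and oU': "open (snd k ` U)"
      by (rule chart_image_open[OF m U(1,3)], rule chart_image_open[OF k U(1,2)])
    \<comment> \<open>The components in \<open>m\<close>, still as a function of the coordinates of
      \<open>k\<close>: the Jacobian applied to the components in \<open>k\<close>.\<close>
    let ?h = "\<lambda>z. frechet_derivative (snd m \<circ> chart_inv k) (at z) (local_rep A k X z)"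
    have h: "smooth_on (snd k ` U) ?h"
      by (rule smooth_on_derivative_app[OF oU' transition_smooth_on(1)[OF m k U(3,2)] sm])
    have "smooth_on (snd m ` U) (\<lambda>y. ?h ((snd k \<circ> chart_inv m) y))"
      using smooth_on_compose[where f = ?h and g = "snd k \<circ> chart_inv m", OF oU oU'
        transition_smooth_on(2)[OF k m U(2,3)] h transition_smooth_on(1)[OF k m U(2,3)]] .
    moreover have "?h ((snd k \<circ> chart_inv m) y) = local_rep A m X y" if y: "y \<in> snd m ` U" for y
    proof -
      obtain q where q: "q \<in> U" "q \<in> fst k" "q \<in> fst m" "y = snd m q" using y U by blast
      have "(snd k \<circ> chart_inv m) y = snd k q" "local_rep A k X (snd k q) = dchart A k q (X q)"
        "local_rep A m X y = dchart A m q (X q)"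
        using m k q by (simp_all add: chart_inv_left local_rep_def)
      then show ?thesis
        using trd_dchart[OF k m q(2,3), of "X q"] unfolding trd_def by simp
    qed
    ultimately show "smooth_on (snd m ` U) (local_rep A m X)"
      by (rule smooth_on_eq[OF oU, rotated])
  qed
qed

lemma smooth_fun_on_subset: "smooth_fun_on A W f \<Longrightarrow> V \<subseteq> W \<Longrightarrow> smooth_fun_on A V f"
  unfolding smooth_fun_on_def by (intro ballI; rule smooth_on_subset[of "snd k ` (fst k \<inter> W)" for k]) auto

lemma smooth_field_on_subset: "smooth_field_on A W f \<Longrightarrow> V \<subseteq> W \<Longrightarrow> smooth_field_on A V f"
  unfolding smooth_field_on_def by (intro ballI; rule smooth_on_subset[of "snd k ` (fst k \<inter> W)" for k]) auto

lemma smooth_fun_on_local: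
  assumes "open W" "\<And>p. p \<in> W \<Longrightarrow> \<exists>U. open U \<and> p \<in> U \<and> smooth_fun_on A U f"
  shows "smooth_fun_on A W f"
proof (rule smooth_fun_onI[OF assms(1)])
  fix p assume "p \<in> W"
  then obtain U where U: "open U" "p \<in> U" "smooth_fun_on A U f" using assms(2) by blast
  then show "\<exists>k\<in>A. \<exists>U. open U \<and> p \<in> U \<and> U \<subseteq> fst k \<and> smooth_on (snd k ` U) (f \<circ> chart_inv k)"
    by (intro bexI[of _ "pchart A p"] exI[of _ "fst (pchart A p) \<inter> U"] conjI smooth_fun_onD[OF U(3)])
      (auto simp: pchart chart_open)
qed

lemma smooth_field_on_local:
  assumes "open W" "\<And>p. p \<in> W \<Longrightarrow> \<exists>U. open U \<and> p \<in> U \<and> smooth_field_on A U f"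
  shows "smooth_field_on A W f"
proof (rule smooth_field_onI[OF assms(1)])
  fix p assume "p \<in> W"
  then obtain U where U: "open U" "p \<in> U" "smooth_field_on A U f" using assms(2) by blast
  then show "\<exists>k\<in>A. \<exists>U. open U \<and> p \<in> U \<and> U \<subseteq> fst k \<and> smooth_on (snd k ` U) (local_rep A k f)"
    by (intro bexI[of _ "pchart A p"] exI[of _ "fst (pchart A p) \<inter> U"] conjI smooth_field_onD[OF U(3)])
      (auto simp: pchart chart_open)
qed

lemma chart_image_Int_open: "k \<in> A \<Longrightarrow> open W \<Longrightarrow> open (snd k ` (fst k \<inter> W))"
  by (simp add: chart_image_open chart_open open_Int)

lemma smooth_fun_on_eq:
  assumes "open W" "\<And>p. p \<in> W \<Longrightarrow> f p = g p" "smooth_fun_on A W f"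
  shows "smooth_fun_on A W g"
  unfolding smooth_fun_on_def
proof
  fix k assume k: "k \<in> A"
  show "smooth_on (snd k ` (fst k \<inter> W)) (g \<circ> chart_inv k)"
    by (rule smooth_on_eq[of _ "f \<circ> chart_inv k"])
      (use assms k chart_inv_left[OF k] chart_image_Int_open in \<open>auto simp: smooth_fun_on_def\<close>)
qed

lemma smooth_field_on_eq:
  assumes "open W" "\<And>p. p \<in> W \<Longrightarrow> f p = g p" "smooth_field_on A W f"
  shows "smooth_field_on A W g"
  unfolding smooth_field_on_def
proof
  fix k assume k: "k \<in> A"
  show "smooth_on (snd k ` (fst k \<inter> W)) (local_rep A k g)"
    by (rule smooth_on_eq[of _ "local_rep A k f"])
      (use assms k chart_inv_left[OF k] chart_image_Int_open in \<open>auto simp: smooth_field_on_def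
          local_rep_def\<close>)
qed

lemma smooth_fun_const: "smooth_fun_on A W (\<lambda>p. c)"
  by (simp add: smooth_fun_on_def o_def smooth_on_const)

lemma smooth_fun_add:
  "open W \<Longrightarrow> smooth_fun_on A W f \<Longrightarrow> smooth_fun_on A W g \<Longrightarrow> smooth_fun_on A W (\<lambda>p. f p + g p)"
  unfolding smooth_fun_on_def o_def by (intro ballI smooth_on_add chart_image_Int_open) simp_all

lemma smooth_fun_mult:
  "open W \<Longrightarrow> smooth_fun_on A W f \<Longrightarrow> smooth_fun_on A W g \<Longrightarrow> smooth_fun_on A W (\<lambda>p. f p * g p)"
  unfolding smooth_fun_on_def o_def by (intro ballI smooth_on_mult chart_image_Int_open) simp_all

lemma smooth_fun_sum:
  "open W \<Longrightarrow> (\<And>i. i \<in> I \<Longrightarrow> smooth_fun_on A W (f i)) \<Longrightarrow> smooth_fun_on A W (\<lambda>p. \<Sum>i\<in>I. f i p)"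
  unfolding smooth_fun_on_def o_def by (intro ballI smooth_on_sum chart_image_Int_open) simp_all

lemma smooth_fun_compose:
  fixes h :: "real \<Rightarrow> real"
  assumes "open W" "open T" "smooth_on T h" "smooth_fun_on A W f" "\<And>p. p \<in> W \<Longrightarrow> f p \<in> T"
  shows "smooth_fun_on A W (\<lambda>p. h (f p))"
  unfolding smooth_fun_on_def
proof
  fix k assume k: "k \<in> A"
  show "smooth_on (snd k ` (fst k \<inter> W)) ((\<lambda>p. h (f p)) \<circ> chart_inv k)"
    using smooth_on_compose[OF chart_image_Int_open[OF k assms(1)] assms(2) _ assms(3),
        of "f \<circ> chart_inv k"]
      assms(4,5) k chart_inv_left[OF k] unfolding smooth_fun_on_def o_def by fastforce
qed

lemma local_rep_linear:
  assumes "k \<in> A" "x \<in> snd k ` fst k"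
  shows "local_rep A k (\<lambda>p. X p + Y p) x = local_rep A k X x + local_rep A k Y x"
    "local_rep A k (\<lambda>p. f p *\<^sub>R Y p) x = (f \<circ> chart_inv k) x *\<^sub>R local_rep A k Y x"
    "local_rep A k (\<lambda>p. 0) x = 0"
  using linear_dchart[OF assms(1) chart_inv_in[OF assms]]
  by (simp_all add: local_rep_def linear_add linear_scale linear_0)

lemma smooth_field_add:
  assumes "open W" "smooth_field_on A W X" "smooth_field_on A W Y"
  shows "smooth_field_on A W (\<lambda>p. X p + Y p)"
  unfolding smooth_field_on_def
proof
  fix k assume k: "k \<in> A"
  show "smooth_on (snd k ` (fst k \<inter> W)) (local_rep A k (\<lambda>p. X p + Y p))"
    by (rule smooth_on_eq[where f = "\<lambda>x. local_rep A k X x + local_rep A k Y x"])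
      (use assms k local_rep_linear(1)[OF k] chart_image_Int_open in \<open>auto simp: smooth_field_on_def
          intro!: smooth_on_add\<close>)
qed

lemma smooth_field_scaleR:
  assumes "open W" "smooth_fun_on A W f" "smooth_field_on A W Y"
  shows "smooth_field_on A W (\<lambda>p. f p *\<^sub>R Y p)"
  unfolding smooth_field_on_def
proof
  fix k assume k: "k \<in> A"
  show "smooth_on (snd k ` (fst k \<inter> W)) (local_rep A k (\<lambda>p. f p *\<^sub>R Y p))"
    by (rule smooth_on_eq[where f = "\<lambda>x. (f \<circ> chart_inv k) x *\<^sub>R local_rep A k Y x"])
      (use assms k local_rep_linear(2)[OF k] chart_image_Int_open in \<open>auto simp: smooth_fun_on_def
          smooth_field_on_def simp del: o_apply intro!: smooth_on_scaleR\<close>)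
qed

lemma smooth_field_zero:
  assumes "open W" shows "smooth_field_on A W (\<lambda>p. 0)"
  unfolding smooth_field_on_def
proof
  fix k assume k: "k \<in> A"
  show "smooth_on (snd k ` (fst k \<inter> W)) (local_rep A k (\<lambda>p. 0))"
    by (rule smooth_on_eq[where f = "\<lambda>x. 0"])
      (use assms k local_rep_linear(3)[OF k] chart_image_Int_open in \<open>auto simp: smooth_on_const\<close>)
qed

lemma smooth_field_sum:
  "open W \<Longrightarrow> (\<And>i. i \<in> I \<Longrightarrow> smooth_field_on A W (X i)) \<Longrightarrow> smooth_field_on A W (\<lambda>p. \<Sum>i\<in>I. X i p)"
  by (induction I rule: infinite_finite_induct) (auto intro: smooth_field_zero smooth_field_add)

lemma smooth_coord_field:
  assumes "k \<in> A"
  shows "smooth_field_on A (fst k) (coord_field A k u)"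
proof (rule smooth_field_onI[OF chart_open[OF assms]])
  have "smooth_on (snd k ` fst k) (local_rep A k (coord_field A k u))"
    by (rule smooth_on_eq[where f = "\<lambda>x. u"])
      (use assms chart_image_open chart_open dchart_coord_field chart_inv_in in \<open>auto
          simp: smooth_on_const local_rep_def\<close>)
  then show "\<exists>k'\<in>A. \<exists>U. open U \<and> p \<in> U \<and> U \<subseteq> fst k'
      \<and> smooth_on (snd k' ` U) (local_rep A k' (coord_field A k u))"
    if "p \<in> fst k" for p
    using that assms chart_open by blast
qed

lemma coord_field_expansion:
  assumes "k \<in> A" "p \<in> fst k"
  shows "v = (\<Sum>b\<in>Basis. (dchart A k p v \<bullet> b) *\<^sub>R coord_field A k b p)"
  using linear_basis_expansion[OF linear_coord_field[OF assms], of "dchart A k p v"]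
  by (simp add: coord_field_dchart[OF assms])

lemma smooth_component:
  assumes "k \<in> A" "open W" "smooth_field_on A W X"
  shows "smooth_fun_on A (W \<inter> fst k) (\<lambda>p. dchart A k p (X p) \<bullet> b)"
proof (rule smooth_fun_onI)
  show o: "open (W \<inter> fst k)" using assms chart_open[of k] by auto
  have "smooth_on (snd k ` (W \<inter> fst k)) (\<lambda>x. local_rep A k X x \<bullet> b)"
    by (intro smooth_on_inner smooth_field_onD[OF assms(3,1)] smooth_on_const
        chart_image_open[OF assms(1)] o) auto
  then have "smooth_on (snd k ` (W \<inter> fst k)) ((\<lambda>p. dchart A k p (X p) \<bullet> b) \<circ> chart_inv k)"
    by (simp add: local_rep_def o_def)
  then show "\<exists>k'\<in>A. \<exists>U. open U \<and> p \<in> U \<and> U \<subseteq> fst k' \<and>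
      smooth_on (snd k' ` U) ((\<lambda>p. dchart A k p (X p) \<bullet> b) \<circ> chart_inv k')" if "p \<in> W \<inter> fst k" for p
    using that assms(1) o by blast
qed

lemma smooth_fun_on_charts:
  assumes "open W" "\<And>k. k \<in> A \<Longrightarrow> smooth_fun_on A (W \<inter> fst k) f"
  shows "smooth_fun_on A W f"
proof (rule smooth_fun_on_local[OF assms(1)])
  fix p assume "p \<in> W"
  then show "\<exists>U. open U \<and> p \<in> U \<and> smooth_fun_on A U f"
    by (intro exI[of _ "W \<inter> fst (pchart A p)"] conjI open_Int IntI assms chart_open pchart)
qed

lemma smooth_field_on_charts:
  assumes "open W" "\<And>k. k \<in> A \<Longrightarrow> smooth_field_on A (W \<inter> fst k) f"
  shows "smooth_field_on A W f"
proof (rule smooth_field_on_local[OF assms(1)])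
  fix p assume "p \<in> W"
  then show "\<exists>U. open U \<and> p \<in> U \<and> smooth_field_on A U f"
    by (intro exI[of _ "W \<inter> fst (pchart A p)"] conjI open_Int IntI assms chart_open pchart)
qed

text \<open>Smoothness of a tensor field is defined by testing on coordinate fields; expanding
  \<open>X\<close> in the coordinate frame of each chart reaches all smooth fields on open
  sets.\<close>

lemma smooth_one_form:
  assumes "one_form A \<theta>" "open W" "smooth_field_on A W X"
  shows "smooth_fun_on A W (\<lambda>p. \<theta> p (X p))"
proof (rule smooth_fun_on_charts[OF assms(2)])
  fix k assume k: "k \<in> A"
  have o: "open (W \<inter> fst k)" using assms(2) chart_open[OF k] by auto
  have lin: "linear (\<theta> p)" for p using assms(1) by (simp add: one_form_def)
  show "smooth_fun_on A (W \<inter> fst k) (\<lambda>p. \<theta> p (X p))"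
  proof (rule smooth_fun_on_eq[OF o])
    show "smooth_fun_on A (W \<inter> fst k) (\<lambda>p. \<Sum>b\<in>Basis. (dchart A k p (X p) \<bullet> b) * \<theta> p (coord_field A k b p))"
      using assms(1) k by (intro smooth_fun_sum smooth_fun_mult o smooth_component assms)
        (auto simp: one_form_def intro: smooth_fun_on_subset)
    fix p assume "p \<in> W \<inter> fst k"
    then show "(\<Sum>b\<in>Basis. (dchart A k p (X p) \<bullet> b) * \<theta> p (coord_field A k b p)) = \<theta> p (X p)"
      using coord_field_expansion[OF k, of p "X p"]
        linear_sum[OF lin[of p], of "\<lambda>b. (dchart A k p (X p) \<bullet> b) *\<^sub>R coord_field A k b p" Basis]
      by (simp add: linear_scale[OF lin])
  qed
qed

lemma smooth_endo_field:
  assumes "endo_field A J" "open W" "smooth_field_on A W X"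
  shows "smooth_field_on A W (\<lambda>p. J p (X p))"
proof (rule smooth_field_on_charts[OF assms(2)])
  fix k assume k: "k \<in> A"
  have o: "open (W \<inter> fst k)" using assms(2) chart_open[OF k] by auto
  have lin: "linear (J p)" for p using assms(1) by (simp add: endo_field_def)
  show "smooth_field_on A (W \<inter> fst k) (\<lambda>p. J p (X p))"
  proof (rule smooth_field_on_eq[OF o])
    show "smooth_field_on A (W \<inter> fst k) (\<lambda>p. \<Sum>b\<in>Basis. (dchart A k p (X p) \<bullet> b) *\<^sub>R J p (coord_field A k b p))"
      using assms(1) k by (intro smooth_field_sum smooth_field_scaleR o smooth_component assms)
        (auto simp: endo_field_def intro: smooth_field_on_subset)
    fix p assume "p \<in> W \<inter> fst k"
    then show "(\<Sum>b\<in>Basis. (dchart A k p (X p) \<bullet> b) *\<^sub>R J p (coord_field A k b p)) = J p (X p)"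
      using coord_field_expansion[OF k, of p "X p"]
        linear_sum[OF lin[of p], of "\<lambda>b. (dchart A k p (X p) \<bullet> b) *\<^sub>R coord_field A k b p" Basis]
      by (simp add: linear_scale[OF lin])
  qed
qed

text \<open>What remains of \<open>riemannian_metric\<close> without symmetry and positivity, so
  that metrics, fundamental forms, pullbacks and forms built from endomorphisms are treated
  alike.\<close>

definition bilinear_field :: "('m \<Rightarrow> 'e \<Rightarrow> 'e \<Rightarrow> real) \<Rightarrow> bool" where
  "bilinear_field b \<longleftrightarrow> (\<forall>p. bilinear (b p)) \<and>
     (\<forall>k\<in>A. \<forall>u v. smooth_fun_on A (fst k) (\<lambda>p. b p (coord_field A k u p) (coord_field A k v p)))"

lemma smooth_bilinear_field:
  assumes "bilinear_field g" "open W" "smooth_field_on A W X" "smooth_field_on A W Y"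
  shows "smooth_fun_on A W (\<lambda>p. g p (X p) (Y p))"
proof (rule smooth_fun_on_charts[OF assms(2)])
  fix k assume k: "k \<in> A"
  have o: "open (W \<inter> fst k)" using assms(2) chart_open[OF k] by auto
  have bil: "bilinear (g p)" for p using assms(1) by (simp add: bilinear_field_def)
  show "smooth_fun_on A (W \<inter> fst k) (\<lambda>p. g p (X p) (Y p))"
  proof (rule smooth_fun_on_eq[OF o])
    show "smooth_fun_on A (W \<inter> fst k) (\<lambda>p. \<Sum>(b, c)\<in>Basis \<times> Basis. (dchart A k p (Y p) \<bullet> c) *
        ((dchart A k p (X p) \<bullet> b) * g p (coord_field A k b p) (coord_field A k c p)))"
      unfolding case_prod_unfold
      using assms(1) k by (intro smooth_fun_sum smooth_fun_mult o smooth_component assms)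
        (auto simp: bilinear_field_def intro!: smooth_fun_on_subset[where W = "fst k" and V = "W \<inter> fst k"])
    fix p assume p: "p \<in> W \<inter> fst k"
    let ?x = "\<lambda>b. (dchart A k p (X p) \<bullet> b) *\<^sub>R coord_field A k b p"
    let ?y = "\<lambda>b. (dchart A k p (Y p) \<bullet> b) *\<^sub>R coord_field A k b p"
    have "g p (X p) (Y p) = g p (\<Sum>b\<in>Basis. ?x b) (\<Sum>c\<in>Basis. ?y c)"
      using coord_field_expansion[OF k, of p "X p"] coord_field_expansion[OF k, of p "Y p"] p by simp
    also have "\<dots> = (\<Sum>(b, c)\<in>Basis \<times> Basis. (dchart A k p (Y p) \<bullet> c) *
        ((dchart A k p (X p) \<bullet> b) * g p (coord_field A k b p) (coord_field A k c p)))"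
      by (simp add: bilinear_sum[OF bil] bilinear_lmul[OF bil] bilinear_rmul[OF bil])
    finally show "(\<Sum>(b, c)\<in>Basis \<times> Basis. (dchart A k p (Y p) \<bullet> c) *
        ((dchart A k p (X p) \<bullet> b) * g p (coord_field A k b p) (coord_field A k c p))) = g p (X p) (Y p)" ..
  qed
qed

lemma bilinear_fieldI:
  assumes "\<And>p. bilinear (b p)"
    and "\<And>W X Y. open W \<Longrightarrow> smooth_field_on A W X \<Longrightarrow> smooth_field_on A W Y
        \<Longrightarrow> smooth_fun_on A W (\<lambda>p. b p (X p) (Y p))"
  shows "bilinear_field b"
  using assms smooth_coord_field chart_open by (auto simp: bilinear_field_def)

lemma endo_fieldI:
  assumes "\<And>p. linear (J p)"
    and "\<And>W X. open W \<Longrightarrow> smooth_field_on A W X \<Longrightarrow> smooth_field_on A W (\<lambda>p. J p (X p))"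
  shows "endo_field A J"
  using assms smooth_coord_field chart_open by (auto simp: endo_field_def)

lemma one_formI:
  assumes "\<And>p. linear (\<theta> p)"
    and "\<And>W X. open W \<Longrightarrow> smooth_field_on A W X \<Longrightarrow> smooth_fun_on A W (\<lambda>p. \<theta> p (X p))"
  shows "one_form A \<theta>"
  using assms smooth_coord_field chart_open by (auto simp: one_form_def)

section \<open>Differentials of functions\<close>

lemma dfun_has_derivative:
  assumes "open W" "smooth_fun_on A W f" "p \<in> W"
  shows "((f \<circ> chart_inv (pchart A p)) has_derivative dfun A f p) (at (snd (pchart A p) p))"
  unfolding dfun_def
  by (rule smooth_on_has_derivative[where S = "snd (pchart A p) ` (fst (pchart A p) \<inter> W)"])
    (use assms pchart in \<open>auto simp: smooth_fun_on_def chart_image_Int_open\<close>)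

lemma dfun_eqI:
  "((f \<circ> chart_inv (pchart A p)) has_derivative L) (at (snd (pchart A p) p)) \<Longrightarrow> dfun A f p = L"
  unfolding dfun_def by (rule frechet_derivative_eqI)

lemma dfun_const: "dfun A (\<lambda>q. c) p = (\<lambda>v. 0)"
  by (rule dfun_eqI) (simp add: o_def)

lemma dfun_mult:
  assumes "open W" "smooth_fun_on A W f" "smooth_fun_on A W g" "p \<in> W"
  shows "dfun A (\<lambda>q. f q * g q) p = (\<lambda>v. f p * dfun A g p v + dfun A f p v * g p)"
  by (rule dfun_eqI)
    (use has_derivative_mult[OF dfun_has_derivative[OF assms(1,2,4)] dfun_has_derivative[OF assms(1,3,4)]]
      in \<open>simp add: o_def chart_inv_left pchart\<close>)

lemma dfun_exp:
  assumes "open W" "smooth_fun_on A W f" "p \<in> W"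
  shows "dfun A (\<lambda>q. exp (f q)) p = (\<lambda>v. exp (f p) * dfun A f p v)"
  by (rule dfun_eqI)
    (use has_derivative_exp[OF dfun_has_derivative[OF assms]] in \<open>simp add: o_def chart_inv_left pchart
        mult.commute\<close>)

lemma dfun_chart:
  assumes "open W" "smooth_fun_on A W f" "p \<in> W" "k \<in> A" "p \<in> fst k"
  shows "((f \<circ> chart_inv k) has_derivative (\<lambda>u. dfun A f p (coord_field A k u p))) (at (snd k p))"
proof -
  have "((f \<circ> chart_inv (pchart A p)) \<circ> (snd (pchart A p) \<circ> chart_inv k) has_derivative
      dfun A f p \<circ> trd k (pchart A p) p) (at (snd k p))"
    by (rule diff_chain_at[OF trd_has_derivative])
      (use assms dfun_has_derivative[OF assms(1-3)] in \<open>simp_all add: pchart chart_inv_left\<close>)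
  then have "((f \<circ> chart_inv k) has_derivative dfun A f p \<circ> trd k (pchart A p) p) (at (snd k p))"
    by (rule has_derivative_transform_within_open[where s = "snd k ` (fst k \<inter> fst (pchart A p))"])
      (use assms pchart overlap_open chart_inv_left[of k] chart_inv_left[of "pchart A p"] in auto)
  then show ?thesis
    by (simp add: coord_field_trd o_def)
qed

lemma local_rep_has_derivative:
  assumes "open W" "smooth_field_on A W X" "p \<in> W"
  shows "(local_rep A (pchart A p) X has_derivative
    frechet_derivative (local_rep A (pchart A p) X) (at (snd (pchart A p) p))) (at (snd (pchart A p) p))"
  by (rule smooth_on_has_derivative[where S = "snd (pchart A p) ` (fst (pchart A p) \<inter> W)"])
    (use assms pchart in \<open>auto simp: smooth_field_on_def chart_image_Int_open\<close>)

text \<open>The chart preimage \<open>C\<close> of a closed ball is compact, hence closed in a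
  Hausdorff space. The chart domain and the complement of \<open>C\<close> are therefore an open
  cover, and the extension by zero is smooth on each.\<close>

lemma manifold_bump:
  assumes "open W" "p \<in> W"
  obtains \<eta> C where "smooth_fun_on A UNIV \<eta>" "\<eta> p = 1" "dfun A \<eta> p = (\<lambda>v. 0)" "closed C" "C \<subseteq> W"
    "\<And>q. q \<notin> C \<Longrightarrow> \<eta> q = 0"
proof -
  define k where "k = pchart A p"
  have k: "k \<in> A" "p \<in> fst k" by (simp_all add: k_def pchart)
  have "open (snd k ` (fst k \<inter> W))" "snd k p \<in> snd k ` (fst k \<inter> W)"
    using k assms by (auto simp: chart_image_Int_open)
  then obtain r where r: "r > 0" "cball (snd k p) r \<subseteq> snd k ` (fst k \<inter> W)"
    using open_contains_cball by blast
  obtain \<psi> :: "'e \<Rightarrow> real" where \<psi>: "smooth_on UNIV \<psi>" "\<psi> (snd k p) = 1"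
    "(\<psi> has_derivative (\<lambda>v. 0)) (at (snd k p))" "\<And>x. x \<notin> ball (snd k p) r \<Longrightarrow> \<psi> x = 0"
    using euclidean_bump[OF r(1)] by metis
  define \<eta> where "\<eta> q = (if q \<in> fst k then \<psi> (snd k q) else 0)" for q
  define C where "C = chart_inv k ` cball (snd k p) r"
  have sub: "cball (snd k p) r \<subseteq> snd k ` fst k" using r(2) by blast
  have C: "closed C"
    unfolding C_def
    by (intro compact_imp_closed compact_continuous_image
        continuous_on_subset[OF chart_inv_continuous[OF k(1)] sub] compact_cball)
  have CW: "C \<subseteq> W"
    unfolding C_def using r(2) chart_inv_left[OF k(1)] by fastforce
  have zero: "\<eta> q = 0" if "q \<notin> C" for q
  proof (cases "q \<in> fst k")
    case True
    have "snd k q \<notin> ball (snd k p) r"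
    proof
      assume "snd k q \<in> ball (snd k p) r"
      then have "chart_inv k (snd k q) \<in> C" unfolding C_def by (intro imageI) auto
      then show False using that chart_inv_left[OF k(1) True] by simp
    qed
    then show ?thesis using True \<psi>(4) by (simp add: \<eta>_def)
  qed (simp add: \<eta>_def)
  have eq: "\<psi> x = (\<eta> \<circ> chart_inv k) x" if "x \<in> snd k ` fst k" for x
    using that chart_inv_left[OF k(1)] by (auto simp: \<eta>_def)
  have o: "open (snd k ` fst k)" using k(1) chart_image_open chart_open by blast
  have "smooth_fun_on A (fst k) \<eta>"
  proof (rule smooth_fun_onI[OF chart_open[OF k(1)]])
    have "smooth_on (snd k ` fst k) (\<eta> \<circ> chart_inv k)"
      by (rule smooth_on_eq[OF o eq smooth_on_subset[OF \<psi>(1)]]) auto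
    then show "\<exists>k\<in>A. \<exists>U. open U \<and> q \<in> U \<and> U \<subseteq> fst k \<and> smooth_on (snd k ` U) (\<eta> \<circ> chart_inv k)"
      if "q \<in> fst k" for q
      using that k(1) chart_open by blast
  qed
  moreover have "smooth_fun_on A (- C) \<eta>"
    by (rule smooth_fun_on_eq[where f = "\<lambda>q. 0"]) (use C zero in \<open>auto simp: smooth_fun_const\<close>)
  moreover have "q \<in> fst k \<or> q \<in> - C" for q
    using chart_inv_in[OF k(1)] sub by (auto simp: C_def)
  ultimately have sm: "smooth_fun_on A UNIV \<eta>"
    using chart_open[OF k(1)] C by (intro smooth_fun_on_local[OF open_UNIV]) (meson open_Compl)
  have "dfun A \<eta> p = (\<lambda>v. 0)"
    by (rule dfun_eqI) (use has_derivative_transform_within_open[OF \<psi>(3) o _ eq] k in \<open>simp add: k_def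
        o_def\<close>)
  then show ?thesis
    using that[OF sm _ _ C CW zero] \<psi>(2) k(2) unfolding \<eta>_def by simp
qed

text \<open>One cut-off serves all fields. Since its value at \<open>p\<close> is 1 and its
  differential there is 0, the Leibniz rule gives the cut-off field the same covariant derivative at
  \<open>p\<close> as the original.\<close>

lemma field_extension:
  assumes "open W" "p \<in> W"
  obtains \<eta> where "smooth_fun_on A UNIV \<eta>" "\<eta> p = 1" "dfun A \<eta> p = (\<lambda>v. 0)"
    "\<And>Y. smooth_field_on A W Y \<Longrightarrow> vector_field A (\<lambda>q. \<eta> q *\<^sub>R Y q)"
proof -
  obtain \<eta> C where \<eta>: "smooth_fun_on A UNIV \<eta>" "\<eta> p = 1" "dfun A \<eta> p = (\<lambda>v. 0)" "closed C" "C \<subseteq> W"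
    "\<And>q. q \<notin> C \<Longrightarrow> \<eta> q = 0"
    using manifold_bump[OF assms(1,2)] by metis
  have "vector_field A (\<lambda>q. \<eta> q *\<^sub>R Y q)" if Y: "smooth_field_on A W Y" for Y
  proof -
    have "smooth_field_on A W (\<lambda>q. \<eta> q *\<^sub>R Y q)"
      by (intro smooth_field_scaleR assms Y smooth_fun_on_subset[OF \<eta>(1)]) auto
    moreover have "smooth_field_on A (- C) (\<lambda>q. \<eta> q *\<^sub>R Y q)"
      by (rule smooth_field_on_eq[where f = "\<lambda>q. 0"]) (use \<eta> in \<open>auto intro: smooth_field_zero\<close>)
    moreover have "q \<in> W \<or> q \<in> - C" for q
      using \<eta>(5) by auto
    ultimately show ?thesis
      using assms(1) \<eta>(4) by (intro smooth_field_on_local[OF open_UNIV]) (meson open_Compl)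
  qed
  then show ?thesis using that \<eta> by blast
qed

lemma field_through:
  obtains X where "vector_field A X" "X p = v"
proof -
  obtain \<eta> where "\<eta> p = 1" "vector_field A (\<lambda>q. \<eta> q *\<^sub>R coord_field A (pchart A p) v q)"
    using field_extension[OF chart_open[OF pchart(1)] pchart(2)] smooth_coord_field[OF pchart(1)] by metis
  then show ?thesis using that by auto
qed

end

lemma derivative_app_has_derivative:
  fixes \<phi> :: "'a::euclidean_space \<Rightarrow> 'b::real_normed_vector"
  assumes "open S" "smooth_on S \<phi>" "x \<in> S" and w: "(w has_derivative w') (at x)"
  shows "((\<lambda>y. frechet_derivative \<phi> (at y) (w y)) has_derivative
    (\<lambda>v. frechet_derivative (\<lambda>y. frechet_derivative \<phi> (at y) (w x)) (at x) v + frechet_derivative \<phi> (at x)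
        (w' v))) (at x)"
proof -
  let ?D = "\<lambda>y. frechet_derivative \<phi> (at y)"
  let ?D2 = "\<lambda>b. frechet_derivative (\<lambda>y. ?D y b) (at x)"
  have lin: "linear (?D y)" if "y \<in> S" for y
    using smooth_on_linear_derivative[OF assms(2,1) that] .
  have D2: "((\<lambda>y. ?D y b) has_derivative ?D2 b) (at x)" for b
    by (rule smooth_on_has_derivative[OF smooth_on_derivative[OF assms(2)] assms(1,3)])
  \<comment> \<open>With coefficients frozen at \<open>w x\<close>, this shows that
    \<open>?D2 (w x)\<close> is the corresponding combination of the \<open>?D2 b\<close>. The
    computation below with varying coefficients is compared with it.\<close>
  have "((\<lambda>y. \<Sum>b\<in>Basis. (w x \<bullet> b) *\<^sub>R ?D y b) has_derivative (\<lambda>v. \<Sum>b\<in>Basis. (w x \<bullet> b) *\<^sub>R ?D2 b v)) (at x)"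
    by (intro has_derivative_sum has_derivative_scaleR_right D2)
  then have "((\<lambda>y. ?D y (w x)) has_derivative (\<lambda>v. \<Sum>b\<in>Basis. (w x \<bullet> b) *\<^sub>R ?D2 b v)) (at x)"
    by (rule has_derivative_transform_within_open[OF _ assms(1,3)])
        (use linear_basis_expansion[OF lin] in metis)
  then have e1: "?D2 (w x) = (\<lambda>v. \<Sum>b\<in>Basis. (w x \<bullet> b) *\<^sub>R ?D2 b v)"
    by (rule frechet_derivative_eqI)
  have "((\<lambda>y. \<Sum>b\<in>Basis. (w y \<bullet> b) *\<^sub>R ?D y b) has_derivative
      (\<lambda>v. \<Sum>b\<in>Basis. (w x \<bullet> b) *\<^sub>R ?D2 b v + (w' v \<bullet> b) *\<^sub>R ?D x b)) (at x)"
    by (intro has_derivative_sum has_derivative_scaleR D2 has_derivative_inner_left w)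
  then have "((\<lambda>y. ?D y (w y)) has_derivative
      (\<lambda>v. \<Sum>b\<in>Basis. (w x \<bullet> b) *\<^sub>R ?D2 b v + (w' v \<bullet> b) *\<^sub>R ?D x b)) (at x)"
    by (rule has_derivative_transform_within_open[OF _ assms(1,3)])
        (use linear_basis_expansion[OF lin] in metis)
  moreover have "(\<lambda>v. \<Sum>b\<in>Basis. (w x \<bullet> b) *\<^sub>R ?D2 b v + (w' v \<bullet> b) *\<^sub>R ?D x b) = (\<lambda>v. ?D2 (w x) v
      + ?D x (w' v))"
    unfolding e1 sum.distrib by (rule ext) (simp add: linear_basis_expansion[OF lin[OF assms(3)],
        symmetric])
  ultimately show ?thesis by simp
qed

context smooth_manifold
begin

section \<open>Differentials of maps\<close>

definition mapd :: "('m \<Rightarrow> 'm) \<Rightarrow> ('m, 'e) chart \<Rightarrow> ('m, 'e) chart \<Rightarrow> 'm \<Rightarrow> 'e \<Rightarrow> 'e" where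
  "mapd F k m p = frechet_derivative (snd m \<circ> F \<circ> chart_inv k) (at (snd k p))"

lemma dmap_mapd: "dmap A F p = mapd F (pchart A p) (pchart A (F p)) p"
  by (simp add: dmap_def mapd_def)

lemma smooth_map_vimage_open: "smooth_map A F \<Longrightarrow> open W \<Longrightarrow> open (F -` W)"
  by (simp add: smooth_map_def open_vimage)

lemma smooth_map_local:
  "smooth_map A F \<Longrightarrow> k \<in> A \<Longrightarrow> m \<in> A \<Longrightarrow> smooth_on (snd k ` (fst k \<inter> F -` fst m)) (snd m \<circ> F \<circ> chart_inv k)"
  by (simp add: smooth_map_def)

lemma smooth_map_domain_open:
  "smooth_map A F \<Longrightarrow> k \<in> A \<Longrightarrow> m \<in> A \<Longrightarrow> open (snd k ` (fst k \<inter> F -` fst m))"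
  by (intro chart_image_Int_open smooth_map_vimage_open chart_open)

lemma mapd_has_derivative:
  assumes "smooth_map A F" "k \<in> A" "m \<in> A" "p \<in> fst k" "F p \<in> fst m"
  shows "((snd m \<circ> F \<circ> chart_inv k) has_derivative mapd F k m p) (at (snd k p))"
  unfolding mapd_def
  by (rule smooth_on_has_derivative[OF smooth_map_local smooth_map_domain_open]) (use assms in auto)

lemma mapd_comp:
  assumes "smooth_map A F" "smooth_map A G" "k \<in> A" "m \<in> A" "n \<in> A" "p \<in> fst k" "G p \<in> fst m"
      "F (G p) \<in> fst n"
  shows "mapd (F \<circ> G) k n p v = mapd F m n (G p) (mapd G k m p v)"
proof -
  have "((snd n \<circ> F \<circ> chart_inv m) \<circ> (snd m \<circ> G \<circ> chart_inv k) has_derivative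
      mapd F m n (G p) \<circ> mapd G k m p) (at (snd k p))"
    by (rule diff_chain_at[OF mapd_has_derivative])
      (use assms mapd_has_derivative[of F m n "G p"] in \<open>simp_all add: chart_inv_left\<close>)
  then have "((snd n \<circ> (F \<circ> G) \<circ> chart_inv k)
      has_derivative mapd F m n (G p) \<circ> mapd G k m p) (at (snd k p))"
    by (rule has_derivative_transform_within_open[where s = "snd k ` (fst k \<inter> G -` fst m)"])
      (use assms smooth_map_domain_open chart_inv_left[of k] chart_inv_left[of m] in auto)
  then show ?thesis
    unfolding mapd_def by (simp add: frechet_derivative_eqI o_def fun_eq_iff)
qed

lemma mapd_id: "mapd id k m p = trd k m p"
  by (simp add: mapd_def trd_def)

lemma smooth_map_id: "smooth_map A id"
  using transition_smooth by (auto simp: smooth_map_def vimage_def)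

text \<open>Coordinate changes are the local expressions of the identity, so this is the chain rule
  for the two factorisations \<open>id \<circ> F\<close> and \<open>F \<circ> id\<close> of
  \<open>F\<close>.\<close>

lemma dchart_dmap:
  assumes "smooth_map A F" "k \<in> A" "m \<in> A" "p \<in> fst k" "F p \<in> fst m"
  shows "dchart A m (F p) (dmap A F p v) = mapd F k m p (dchart A k p v)"
proof -
  have "dchart A m (F p) (dmap A F p v) = mapd (id \<circ> F) (pchart A p) m p v"
    using assms pchart by (subst mapd_comp[where m = "pchart A (F p)"])
      (auto simp: dchart_trd mapd_id dmap_mapd smooth_map_id)
  also have "\<dots> = mapd (F \<circ> id) (pchart A p) m p v" by simp
  also have "\<dots> = mapd F k m p (dchart A k p v)"
    using assms pchart by (subst mapd_comp[where m = k]) (auto simp: dchart_trd mapd_id smooth_map_id)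
  finally show ?thesis .
qed

lemma linear_dmap: "smooth_map A F \<Longrightarrow> linear (dmap A F p)"
  unfolding dmap_mapd by (rule has_derivative_linear[OF mapd_has_derivative]) (auto simp: pchart)

lemma dmap_comp: "smooth_map A F \<Longrightarrow> smooth_map A G \<Longrightarrow> dmap A (F \<circ> G) p v = dmap A F (G p) (dmap A G p v)"
  unfolding dmap_mapd o_apply[of F G p] by (rule mapd_comp) (auto simp: pchart)

lemma dmap_id: "dmap A id p v = v"
  by (simp add: dmap_mapd mapd_id trd_self pchart)

lemma diffeo_inv: "diffeo A F \<Longrightarrow> diffeo A (inv F)"
  by (simp add: diffeo_def bij_imp_bij_inv inv_inv_eq)

lemma diffeo_inv_simps:
  assumes "diffeo A F"
  shows "inv F (F p) = p" "F (inv F q) = q" "inv (inv F) = F"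
  using assms by (simp_all add: diffeo_def bij_is_inj bij_is_surj surj_f_inv_f inv_inv_eq)

lemma dmap_inv_left:
  assumes "diffeo A F"
  shows "dmap A (inv F) (F p) (dmap A F p v) = v"
proof -
  have "inv F \<circ> F = id" using diffeo_inv_simps[OF assms] by auto
  then show ?thesis
    using dmap_comp[of "inv F" F p v] assms by (simp add: diffeo_def dmap_id)
qed

lemma dmap_inv_right:
  assumes "diffeo A F"
  shows "dmap A F p (dmap A (inv F) (F p) v) = v"
  using dmap_inv_left[OF diffeo_inv[OF assms], of "F p"] diffeo_inv_simps[OF assms] by simp

lemma pushforward_app: "diffeo A F \<Longrightarrow> pushforward A F X (F p) = dmap A F p (X p)"
  by (simp add: pushforward_def diffeo_inv_simps)

lemma smooth_fun_comp_map:
  assumes F: "smooth_map A F" and W: "open W" "smooth_fun_on A W h"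
  shows "smooth_fun_on A (F -` W) (\<lambda>q. h (F q))"
proof (rule smooth_fun_onI[OF smooth_map_vimage_open[OF F W(1)]])
  fix p assume p: "p \<in> F -` W"
  define k m where "k = pchart A p" and "m = pchart A (F p)"
  have c: "k \<in> A" "m \<in> A" "p \<in> fst k" "F p \<in> fst m" by (simp_all add: k_def m_def pchart)
  define U where "U = fst k \<inter> F -` (fst m \<inter> W)"
  have U: "open U" "p \<in> U" "U \<subseteq> fst k" "U \<subseteq> fst k \<inter> F -` fst m"
    using p c W(1) F chart_open unfolding U_def by
        (auto intro!: open_Int chart_open smooth_map_vimage_open[OF F])
  have "smooth_on (snd k ` U) (\<lambda>x. (h \<circ> chart_inv m) ((snd m \<circ> F \<circ> chart_inv k) x))"
  proof (rule smooth_on_compose[where T = "snd m ` (fst m \<inter> W)"])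
    show "smooth_on (snd k ` U) (snd m \<circ> F \<circ> chart_inv k)"
      by (rule smooth_on_subset[OF smooth_map_local[OF F c(1,2)]]) (use U in auto)
    show "smooth_on (snd m ` (fst m \<inter> W)) (h \<circ> chart_inv m)"
      using W(2) c(2) by (simp add: smooth_fun_on_def)
  qed (use U c W chart_inv_left[OF c(1)] in \<open>auto simp: U_def chart_image_Int_open
      intro!: chart_image_open\<close>)
  then have "smooth_on (snd k ` U) ((\<lambda>q. h (F q)) \<circ> chart_inv k)"
    by (rule smooth_on_eq[OF chart_image_open[OF c(1) U(1,3)], rotated])
      (use chart_inv_left[OF c(1)] chart_inv_left[OF c(2)] in \<open>auto simp: U_def\<close>)
  then show "\<exists>k\<in>A. \<exists>U. open U \<and> p \<in> U \<and> U \<subseteq> fst k \<and> smooth_on (snd k ` U) ((\<lambda>q. h (F q)) \<circ> chart_inv k)"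
    using c U by blast
qed

lemma dfun_comp_map:
  assumes F: "smooth_map A F" and W: "open W" "smooth_fun_on A W h" "F p \<in> W"
  shows "dfun A (\<lambda>q. h (F q)) p v = dfun A h (F p) (dmap A F p v)"
proof -
  define k m where "k = pchart A p" and "m = pchart A (F p)"
  have c: "k \<in> A" "m \<in> A" "p \<in> fst k" "F p \<in> fst m" by (simp_all add: k_def m_def pchart)
  have "((h \<circ> chart_inv m) \<circ> (snd m \<circ> F \<circ> chart_inv k)
      has_derivative dfun A h (F p) \<circ> dmap A F p) (at (snd k p))"
    by (rule diff_chain_at)
      (use mapd_has_derivative[OF F c] dfun_has_derivative[OF W] in
        \<open>simp_all add: dmap_mapd k_def m_def pchart chart_inv_left\<close>)
  then have "(((\<lambda>q. h (F q)) \<circ> chart_inv k) has_derivative dfun A h (F p) \<circ> dmap A F p) (at (snd k p))"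
    by (rule has_derivative_transform_within_open[where s = "snd k ` (fst k \<inter> F -` fst m)"])
      (use F c smooth_map_domain_open chart_inv_left[of k] chart_inv_left[of m] in auto)
  then show ?thesis
    unfolding k_def by (simp add: dfun_eqI)
qed

lemma local_rep_pushforward:
  assumes F: "diffeo A F" and c: "k \<in> A" "m \<in> A" "p \<in> fst k" "F p \<in> fst m"
  shows "local_rep A m (pushforward A F X) (snd m (F p)) =
    frechet_derivative (snd m \<circ> F \<circ> chart_inv k) (at (snd k p)) (local_rep A k X (snd k p))"
  using dchart_dmap[of F k m p "X p"] F c
  by (simp add: local_rep_def chart_inv_left pushforward_app mapd_def diffeo_def)

text \<open>In charts the pushforward is the derivative of \<open>F\<close> applied to the
  components of \<open>Y\<close>, precomposed with the inverse of \<open>F\<close>; smoothness of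
  the inverse enters through this last factor.\<close>

lemma smooth_pushforward:
  assumes F: "diffeo A F" and W: "open W" and Y: "smooth_field_on A W Y"
  shows "smooth_field_on A (F ` W) (pushforward A F Y)"
proof (rule smooth_field_onI)
  have sF: "smooth_map A F" and sG: "smooth_map A (inv F)"
    using F by (simp_all add: diffeo_def)
  have im: "F ` S = inv F -` S" for S
    using F by (simp add: diffeo_def bij_vimage_eq_inv_image bij_imp_bij_inv inv_inv_eq)
  show "open (F ` W)"
    unfolding im using smooth_map_vimage_open[OF sG W] .
  fix p assume "p \<in> F ` W"
  then obtain q where q: "q \<in> W" "p = F q" by blast
  define k m where "k = pchart A q" and "m = pchart A p"
  have c: "k \<in> A" "m \<in> A" "q \<in> fst k" "p \<in> fst m" by (simp_all add: k_def m_def pchart)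
  define V where "V = fst k \<inter> W \<inter> F -` fst m"
  have V: "open V" "V \<subseteq> fst k" "q \<in> V"
    unfolding V_def using c q W sF by (auto intro!: open_Int chart_open smooth_map_vimage_open)
  have U: "open (F ` V)" "F ` V \<subseteq> fst m"
    unfolding im[of V] using smooth_map_vimage_open[OF sG V(1)] by (auto simp: V_def diffeo_inv_simps[OF F])
  have oV: "open (snd k ` V)" using chart_image_open[OF c(1) V(1,2)] .
  have oU: "open (snd m ` F ` V)" using chart_image_open[OF c(2) U] .
  let ?h = "\<lambda>x. frechet_derivative (snd m \<circ> F \<circ> chart_inv k) (at x) (local_rep A k Y x)"
  have sm: "smooth_on (snd m ` F ` V) (\<lambda>y. ?h ((snd k \<circ> inv F \<circ> chart_inv m) y))"
  proof (rule smooth_on_compose[where f = ?h and g = "snd k \<circ> inv F \<circ> chart_inv m", OF oU oV])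
    show "smooth_on (snd k ` V) ?h"
      by (rule smooth_on_derivative_app[OF oV smooth_on_subset[OF smooth_map_local[OF sF c(1,2)]]
          smooth_field_onD[OF Y c(1)]])
        (auto simp: V_def)
    show "smooth_on (snd m ` F ` V) (snd k \<circ> inv F \<circ> chart_inv m)"
      by (rule smooth_on_subset[OF smooth_map_local[OF sG c(2,1)]])
          (auto simp: V_def diffeo_inv_simps[OF F])
    fix y assume "y \<in> snd m ` F ` V"
    then show "(snd k \<circ> inv F \<circ> chart_inv m) y \<in> snd k ` V"
      using chart_inv_left[OF c(2)] U(2) by (auto simp: diffeo_inv_simps[OF F])
  qed
  have eq: "?h ((snd k \<circ> inv F \<circ> chart_inv m) y) = local_rep A m (pushforward A F Y) y"
      if y: "y \<in> snd m ` F ` V" for y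
  proof -
    obtain r where r: "r \<in> V" "y = snd m (F r)" using y by blast
    then have "r \<in> fst k" "F r \<in> fst m" using V_def by auto
    then show ?thesis
      using local_rep_pushforward[OF F c(1,2), of r Y] r(2) by
          (simp add: chart_inv_left c diffeo_inv_simps[OF F])
  qed
  have "smooth_on (snd m ` F ` V) (local_rep A m (pushforward A F Y))"
    by (rule smooth_on_eq[OF oU eq sm])
  then show "\<exists>k\<in>A. \<exists>U. open U \<and> p \<in> U \<and> U \<subseteq> fst k
      \<and> smooth_on (snd k ` U) (local_rep A k (pushforward A F Y))"
    using c(2) U V(3) q(2) by blast
qed

lemma vector_field_pushforward:
  assumes "diffeo A F" "vector_field A Y"
  shows "vector_field A (pushforward A F Y)"
proof -
  have "range F = UNIV" using assms(1) by (simp add: diffeo_def bij_is_surj)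
  then show ?thesis
    using smooth_pushforward[OF assms(1) open_UNIV assms(2)] by simp
qed

text \<open>The difference of the two second-order terms vanishes by the symmetry of second derivatives.\<close>

lemma lie_bracket_pushforward:
  assumes F: "diffeo A F" and X: "vector_field A X" and Y: "vector_field A Y"
  shows "lie_bracket A (pushforward A F X) (pushforward A F Y) (F p) = dmap A F p (lie_bracket A X Y p)"
proof -
  have sF: "smooth_map A F" using F by (simp add: diffeo_def)
  define k m where "k = pchart A p" and "m = pchart A (F p)"
  have c: "k \<in> A" "m \<in> A" "p \<in> fst k" "F p \<in> fst m" by (simp_all add: k_def m_def pchart)
  define \<phi> where "\<phi> = snd m \<circ> F \<circ> chart_inv k"
  define S where "S = snd k ` (fst k \<inter> F -` fst m)"
  have S: "open S" "smooth_on S \<phi>" "snd k p \<in> S"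
    using smooth_map_domain_open[OF sF c(1,2)] smooth_map_local[OF sF c(1,2)] c by (auto simp: S_def \<phi>_def)
  have \<phi>p: "\<phi> (snd k p) = snd m (F p)"
    by (simp add: \<phi>_def chart_inv_left c)
  let ?D = "\<lambda>f x. frechet_derivative f (at x)"
  define D\<phi> where "D\<phi> = ?D \<phi> (snd k p)"
  define D2 where "D2 u v = ?D (\<lambda>y. ?D \<phi> y u) (snd k p) v" for u v
  have dm: "dmap A F p = D\<phi>"
    by (simp add: dmap_mapd mapd_def D\<phi>_def \<phi>_def k_def m_def)
  \<comment> \<open>Obtained by differentiating, along \<open>v\<close>, the relation between the
    coordinate expressions of \<open>pushforward A F Z\<close> and \<open>Z\<close>. The term
    \<open>D2 (Z p) v\<close> is what keeps the two halves of the bracket from being natural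
    separately.\<close>
  have main: "?D (local_rep A m (pushforward A F Z)) (snd m (F p)) (D\<phi> v)
      = D2 (Z p) v + D\<phi> (?D (local_rep A k Z) (snd k p) v)" if Z: "vector_field A Z" for Z v
  proof -
    have "local_rep A k Z (snd k p) = Z p"
      unfolding local_rep_def chart_inv_left[OF c(1,3)] unfolding k_def by simp
    then have "((\<lambda>y. ?D \<phi> y (local_rep A k Z y)) has_derivative
        (\<lambda>v. D2 (Z p) v + D\<phi> (?D (local_rep A k Z) (snd k p) v))) (at (snd k p))"
      using derivative_app_has_derivative[OF S local_rep_has_derivative[OF open_UNIV Z UNIV_I, of p,
          folded k_def]]
      by (simp add: D2_def D\<phi>_def)
    then have m1: "((local_rep A m (pushforward A F Z) \<circ> \<phi>) has_derivative
        (\<lambda>v. D2 (Z p) v + D\<phi> (?D (local_rep A k Z) (snd k p) v))) (at (snd k p))"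
      by (rule has_derivative_transform_within_open[OF _ S(1,3)])
        (use local_rep_pushforward[OF F c(1,2), of _ Z] chart_inv_left[OF c(1)] in \<open>auto simp: S_def \<phi>_def\<close>)
    have a: "(\<phi> has_derivative D\<phi>) (at (snd k p))"
      unfolding D\<phi>_def by (rule smooth_on_has_derivative[OF S(2,1,3)])
    have b: "(local_rep A m (pushforward A F Z) has_derivative
        ?D (local_rep A m (pushforward A F Z)) (snd m (F p))) (at (\<phi> (snd k p)))"
      unfolding \<phi>p unfolding m_def by (rule local_rep_has_derivative[OF open_UNIV
          vector_field_pushforward[OF F Z] UNIV_I])
    show ?thesis
      using has_derivative_unique[OF diff_chain_at[OF a b] m1] by (simp add: fun_eq_iff)
  qed
  have lin: "linear D\<phi>"
    using linear_dmap[OF sF, of p] by (simp add: dm)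
  have "D2 (X p) (Y p) = D2 (Y p) (X p)"
    unfolding D2_def by (rule second_derivative_symmetric[OF S])
  then show ?thesis
    unfolding lie_bracket_def pushforward_app[OF F] m_def[symmetric] k_def[symmetric] dm
    by (simp add: main[OF X] main[OF Y] linear_diff[OF lin])
qed

end

section \<open>Algebra of trilinear expressions with symmetries\<close>

text \<open>Koszul's argument: three uses of each symmetry, in alternation, return to the start with
  the sign (-1)^3. The carrier \<open>V\<close> allows the arguments to be vector fields, for which
  the symmetries hold only if they are smooth.\<close>

lemma symmetric_skew_zero:
  fixes s :: "'f \<Rightarrow> 'f \<Rightarrow> 'f \<Rightarrow> real"
  assumes sym: "\<And>x y z. x \<in> V \<Longrightarrow> y \<in> V \<Longrightarrow> z \<in> V \<Longrightarrow> s x y z = s y x z"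
    and skew: "\<And>x y z. x \<in> V \<Longrightarrow> y \<in> V \<Longrightarrow> z \<in> V \<Longrightarrow> s x y z = - s x z y"
    and V: "x \<in> V" "y \<in> V" "z \<in> V"
  shows "s x y z = 0"
proof -
  have "s x y z = - s x z y" using skew[of x y z] V by simp
  also have "\<dots> = - s z x y" using sym[of x z y] V by simp
  also have "\<dots> = s z y x" using skew[of z x y] V by simp
  also have "\<dots> = s y z x" using sym[of z y x] V by simp
  also have "\<dots> = - s y x z" using skew[of y z x] V by simp
  also have "\<dots> = - s x y z" using sym[of y x z] V by simp
  finally show ?thesis by simp
qed

text \<open>The algebra behind \<open>DJ = 0\<close>, for \<open>a x y z = g ((D\<^sub>x J) y) z\<close>: the sum
  \<open>a (j x) y z + a x y (j z)\<close> is symmetric in \<open>x\<close>, \<open>y\<close> because the Nijenhuis tensor vanishes,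
  and skew in \<open>y\<close>, \<open>z\<close>.\<close>

lemma nearly_kaehler_zero:
  fixes a :: "'f \<Rightarrow> 'f \<Rightarrow> 'f \<Rightarrow> real"
  assumes j: "\<And>x. x \<in> V \<Longrightarrow> j x \<in> V"
    and skew: "\<And>x y z. x \<in> V \<Longrightarrow> y \<in> V \<Longrightarrow> z \<in> V \<Longrightarrow> a x y z = - a x z y"
    and cyc: "\<And>x y z. x \<in> V \<Longrightarrow> y \<in> V \<Longrightarrow> z \<in> V \<Longrightarrow> a x y z + a y z x + a z x y = 0"
    and shift: "\<And>x y z. x \<in> V \<Longrightarrow> y \<in> V \<Longrightarrow> z \<in> V \<Longrightarrow> a x (j y) z = a x y (j z)"
    and jj: "\<And>x y z. x \<in> V \<Longrightarrow> y \<in> V \<Longrightarrow> z \<in> V \<Longrightarrow> a x y (j (j z)) = - a x y z"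
    and nij: "\<And>x y z. x \<in> V \<Longrightarrow> y \<in> V \<Longrightarrow> z \<in> V \<Longrightarrow>
      a (j x) y z - a (j y) x z + a x y (j z) - a y x (j z) = 0"
    and V: "x \<in> V" "y \<in> V" "z \<in> V"
  shows "a x y z = 0"
proof -
  have move: "a (j x) y z = - a x y (j z)" if xyz: "x \<in> V" "y \<in> V" "z \<in> V" for x y z
  proof -
    have "a (j x) y z + a x y (j z) = 0"
    proof (rule symmetric_skew_zero[where s = "\<lambda>x y z. a (j x) y z + a x y (j z)", OF _ _ xyz])
      show "a (j x) y z + a x y (j z) = a (j y) x z + a y x (j z)" if "x \<in> V" "y \<in> V" "z \<in> V" for x y z
        using nij[OF that] by simp
      show "a (j x) y z + a x y (j z) = - (a (j x) z y + a x z (j y))" if v: "x \<in> V" "y \<in> V" "z \<in> V"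
          for x y z
        using skew[of "j x" y z] skew[of x "j y" z] shift[of x y z] j v by simp
    qed
    then show ?thesis by simp
  qed
  have "a (j z) (j x) y + a (j x) y (j z) + a y (j z) (j x) = 0"
    using cyc j V by blast
  moreover have "a (j z) (j x) y = a z x y"
    using move[of z "j x" y] shift[of z x "j y"] jj[of z x y] j V by simp
  moreover have "a (j x) y (j z) = a x y z"
    using move[of x y "j z"] jj[of x y z] j V by simp
  moreover have "a y (j z) (j x) = - a y z x"
    using shift[of y z "j x"] jj[of y z x] j V by simp
  ultimately have "a y z x = 0" if "a z x y + a x y z + a y z x = 0"
    using that by simp
  then have rot: "a y z x = 0"
    using cyc[OF V] by simp
  \<comment> \<open>Moving \<open>j\<close> out of the cyclic identity at \<open>j y\<close>,
    \<open>j z\<close>, \<open>x\<close> restores the first two terms and changes the sign of the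
    third; the difference from the identity at \<open>x\<close>, \<open>y\<close>, \<open>z\<close>
    is \<open>2 * a x y z\<close>.\<close>
  have "a (j y) (j z) x + a (j z) x (j y) + a x (j y) (j z) = 0"
    using cyc j V by blast
  moreover have "a (j y) (j z) x = a y z x"
    using move[of y "j z" x] shift[of y z "j x"] jj[of y z x] j V by simp
  moreover have "a (j z) x (j y) = a z x y"
    using move[of z x "j y"] jj[of z x y] j V by simp
  moreover have "a x (j y) (j z) = - a x y z"
    using shift[of x y "j z"] jj[of x y z] j V by simp
  ultimately show ?thesis
    using cyc[OF V] by simp
qed

lemma (in smooth_manifold) riemannian_bilinear_field: "riemannian_metric A g \<Longrightarrow> bilinear_field g"
  by (simp add: riemannian_metric_def bilinear_field_def)

text \<open>The description in \<open>sharp\<close> has a unique solution: \<open>L w\<close>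
  represents \<open>g p w\<close> by the Euclidean inner product, positivity makes \<open>L\<close>
  injective, and equality of dimensions makes it surjective.\<close>

lemma (in smooth_manifold) sharp_eq:
  assumes "riemannian_metric A g" "linear (\<theta> p)"
  shows "g p (sharp g \<theta> p) v = \<theta> p v"
proof -
  have bil: "bilinear (g p)" and pos: "\<And>u. u \<noteq> 0 \<Longrightarrow> g p u u > 0"
    using assms(1) by (auto simp: riemannian_metric_def)
  have lin2: "linear (g p w)" for w using bil by (simp add: bilinear_def)
  have lin1: "linear (\<lambda>w. g p w v)" for v using bil by (simp add: bilinear_def)
  define L where "L w = (\<Sum>b\<in>Basis. g p w b *\<^sub>R b)" for w
  have L: "L w \<bullet> v = g p w v" for w v
    unfolding L_def inner_sum_left
    using linear_basis_expansion[OF lin2, of w v] by (simp add: mult.commute inner_commute)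
  have linL: "linear L"
    by (rule linearI) (simp_all add: L_def linear_add[OF lin1] linear_scale[OF lin1] scaleR_add_left
        sum.distrib scaleR_sum_right)
  have "inj L"
  proof (subst linear_injective_0[OF linL], intro allI impI)
    fix w assume "L w = 0"
    then have "g p w w = 0" using L[of w w] by simp
    then show "w = 0" using pos[of w] by force
  qed
  then have "surj L" using linear_injective_imp_surjective[OF linL] by simp
  then obtain w where w: "L w = (\<Sum>b\<in>Basis. \<theta> p b *\<^sub>R b)" by (metis surjD)
  have ex: "\<forall>v. g p w v = \<theta> p v"
  proof
    fix v
    show "g p w v = \<theta> p v"
      unfolding L[symmetric] w inner_sum_left
      using linear_basis_expansion[OF assms(2), of v] by (simp add: mult.commute inner_commute)
  qed
  moreover have "w' = w" if "\<forall>v. g p w' v = \<theta> p v" for w'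
  proof -
    have "g p (w' - w) (w' - w) = 0"
      using that ex linear_diff[OF lin1[of "w' - w"], of w' w] by simp
    then show ?thesis using pos[of "w' - w"] by force
  qed
  ultimately have "\<forall>v. g p (sharp g \<theta> p) v = \<theta> p v"
    unfolding sharp_def by (rule theI)
  then show ?thesis by blast
qed

section \<open>Weyl connections\<close>

text \<open>The part of the structure that does not mention \<open>J\<close>; the conformality of
  affine maps rests on it. The connection rules range over open sets so as to cover coordinate
  fields, whereas torsion and compatibility are tested on global fields, as in
  \<open>levi_civita\<close>.\<close>

locale weyl_structure = smooth_manifold A
  for A :: "('m::{t2_space,second_countable_topology}, 'e::euclidean_space) chart set" +
  fixes g :: "'m \<Rightarrow> 'e \<Rightarrow> 'e \<Rightarrow> real" and \<theta> :: "'m \<Rightarrow> 'e \<Rightarrow> real"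
    and D :: "('m \<Rightarrow> 'e) \<Rightarrow> 'm \<Rightarrow> 'e \<Rightarrow> 'e"
  assumes metric: "riemannian_metric A g"
    and lee: "one_form A \<theta>"
    and D_linear: "open W \<Longrightarrow> smooth_field_on A W Y \<Longrightarrow> p \<in> W \<Longrightarrow> linear (D Y p)"
    and D_add: "open W \<Longrightarrow> smooth_field_on A W Y \<Longrightarrow> smooth_field_on A W Z \<Longrightarrow> p \<in> W \<Longrightarrow>
      D (\<lambda>q. Y q + Z q) p v = D Y p v + D Z p v"
    and D_leibniz: "open W \<Longrightarrow> smooth_fun_on A W f \<Longrightarrow> smooth_field_on A W Y \<Longrightarrow> p \<in> W \<Longrightarrow>
      D (\<lambda>q. f q *\<^sub>R Y q) p v = dfun A f p v *\<^sub>R Y p + f p *\<^sub>R D Y p v"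
    and torsion_free: "vector_field A X \<Longrightarrow> vector_field A Y \<Longrightarrow>
      D Y p (X p) - D X p (Y p) = lie_bracket A X Y p"
    and compatible: "vector_field A Y \<Longrightarrow> vector_field A Z \<Longrightarrow>
      dfun A (\<lambda>q. g q (Y q) (Z q)) p v = g p (D Y p v) (Z p) + g p (Y p) (D Z p v) + \<theta> p v * g p (Y p) (Z
          p)"
begin

lemma bilinear_g: "bilinear (g p)"
  using metric by (simp add: riemannian_metric_def)

lemma g_sym: "g p u v = g p v u"
  using metric unfolding riemannian_metric_def by blast

lemma g_pos: "u \<noteq> 0 \<Longrightarrow> g p u u > 0"
  using metric unfolding riemannian_metric_def by blast

lemma g_zero: "g p u u = 0 \<Longrightarrow> u = 0"
  using g_pos[of u p] by force

lemmas g_simps = bilinear_ladd[OF bilinear_g] bilinear_radd[OF bilinear_g] bilinear_lsub[OF bilinear_g]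
  bilinear_rsub[OF bilinear_g] bilinear_lmul[OF bilinear_g] bilinear_rmul[OF bilinear_g]
  bilinear_lneg[OF bilinear_g] bilinear_rneg[OF bilinear_g] bilinear_lzero[OF bilinear_g]
      bilinear_rzero[OF bilinear_g]

lemma g_field: "bilinear_field g"
  by (rule riemannian_bilinear_field[OF metric])

lemma D_cmult: "vector_field A Y \<Longrightarrow> D (\<lambda>q. c *\<^sub>R Y q) p v = c *\<^sub>R D Y p v"
  using D_leibniz[of UNIV "\<lambda>q. c" Y p v] by (simp add: smooth_fun_const dfun_const)

lemma D_minus: "vector_field A Y \<Longrightarrow> D (\<lambda>q. - Y q) p v = - D Y p v"
  using D_cmult[of Y "- 1"] by simp

text \<open>A bilinear form field \<open>b\<close> with \<open>Db = \<eta> \<otimes> b\<close>, tested on global fields.\<close>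

definition recurrent :: "('m \<Rightarrow> 'e \<Rightarrow> 'e \<Rightarrow> real) \<Rightarrow> ('m \<Rightarrow> 'e \<Rightarrow> real) \<Rightarrow> bool" where
  "recurrent b \<eta> \<longleftrightarrow> bilinear_field b \<and> one_form A \<eta> \<and> (\<forall>Y Z p v. vector_field A Y \<longrightarrow> vector_field A Z \<longrightarrow>
    dfun A (\<lambda>q. b q (Y q) (Z q)) p v = b p (D Y p v) (Z p) + b p (Y p) (D Z p v) + \<eta> p v * b p (Y p) (Z p))"

lemma recurrent_metric: "recurrent g \<theta>"
  by (simp add: recurrent_def g_field lee compatible)

text \<open>Multiplying both fields by the function \<open>f\<close> of
  \<open>field_extension\<close> makes them global and changes neither side at
  \<open>p\<close>.\<close>

lemma recurrent_local:
  assumes b: "recurrent b \<eta>" and W: "open W" "p \<in> W" and Y: "smooth_field_on A W Y"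
      and Z: "smooth_field_on A W Z"
  shows "dfun A (\<lambda>q. b q (Y q) (Z q)) p v = b p (D Y p v) (Z p) + b p (Y p) (D Z p v)
      + \<eta> p v * b p (Y p) (Z p)"
proof -
  obtain f where f: "smooth_fun_on A UNIV f" "f p = 1" "dfun A f p = (\<lambda>v. 0)"
    "\<And>Y. smooth_field_on A W Y \<Longrightarrow> vector_field A (\<lambda>q. f q *\<^sub>R Y q)"
    using field_extension[OF W] by metis
  have bb: "bilinear_field b" using b by (simp add: recurrent_def)
  then have bil: "bilinear (b q)" for q by (simp add: bilinear_field_def)
  have fW: "smooth_fun_on A W f" by (rule smooth_fun_on_subset[OF f(1)]) simp
  have bW: "smooth_fun_on A W (\<lambda>q. b q (Y q) (Z q))"
    by (rule smooth_bilinear_field[OF bb W(1) Y Z])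
  have Dcut: "D (\<lambda>q. f q *\<^sub>R X q) p v = D X p v" if "smooth_field_on A W X" for X
    using D_leibniz[OF W(1) fW that W(2)] f by simp
  have "dfun A (\<lambda>q. b q (f q *\<^sub>R Y q) (f q *\<^sub>R Z q)) p v = dfun A (\<lambda>q. f q * (f q * b q (Y q) (Z q))) p v"
    by (simp add: bilinear_lmul[OF bil] bilinear_rmul[OF bil])
  also have "\<dots> = dfun A (\<lambda>q. b q (Y q) (Z q)) p v"
    using dfun_mult[OF W(1) fW smooth_fun_mult[OF W(1) fW bW] W(2)] dfun_mult[OF W(1) fW bW W(2)] f by simp
  finally show ?thesis
    using b f(4)[OF Y] f(4)[OF Z] f(2) by (simp add: recurrent_def Dcut[OF Y] Dcut[OF Z])
qed

end

section \<open>The minimal Weyl connection\<close>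

locale lck_structure = weyl_structure A g \<theta> D
  for A :: "('m::{t2_space,second_countable_topology}, 'e::euclidean_space) chart set" and g \<theta> D +
  fixes J :: "'m \<Rightarrow> 'e \<Rightarrow> 'e"
  assumes complex: "complex_structure A J"
    and hermitian: "g p (J p u) (J p v) = g p u v"
    and lee_eq: "vector_field A X \<Longrightarrow> vector_field A Y \<Longrightarrow> vector_field A Z \<Longrightarrow>
      ext_deriv2 A (fundamental_form J g) X Y Z p = wedge12 \<theta> (fundamental_form J g) p (X p) (Y p) (Z p)"
begin

lemma JJ: "J p (J p u) = - u"
  using complex by (simp add: complex_structure_def)

lemma J_field: "endo_field A J"
  using complex by (simp add: complex_structure_def)

lemma linear_J: "linear (J p)"
  using J_field by (simp add: endo_field_def)

lemmas J_simps = linear_add[OF linear_J] linear_diff[OF linear_J] linear_scale[OF linear_J]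
    linear_neg[OF linear_J] linear_0[OF linear_J]

lemma g_J: "g p (J p u) v = - g p u (J p v)"
  using hermitian[of p "J p u" v] by (simp add: JJ g_simps)

lemma g_J_skew: "g p (J p u) v = - g p (J p v) u"
  using g_J[of p u v] g_sym[of p u "J p v"] by simp

lemma vector_field_J: "vector_field A X \<Longrightarrow> vector_field A (\<lambda>q. J q (X q))"
  using smooth_endo_field[OF J_field open_UNIV] .

lemma dfun_minus:
  assumes "smooth_fun_on A UNIV f"
  shows "dfun A (\<lambda>q. - f q) p v = - dfun A f p v"
  using dfun_mult[OF open_UNIV smooth_fun_const[of UNIV "-1"] assms UNIV_I, of p] by (simp add: dfun_const)

text \<open>The one-form \<theta> enters both d\<omega> = \<theta> \<and> \<omega> and Dg = \<theta>
  \<otimes> g, and the two contributions cancel. What is left is the situation of a Kaehler metric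
  and its Levi-Civita connection: a vanishing cyclic sum of g((DJ) , ) together with a vanishing
  Nijenhuis tensor.\<close>

lemma parallel_J: "parallel_endo A D J"
proof -
  define j :: "('m \<Rightarrow> 'e) \<Rightarrow> 'm \<Rightarrow> 'e" where "j X q = J q (X q)" for X q
  have jV: "vector_field A (j X)" if "vector_field A X" for X
    using vector_field_J[OF that] unfolding j_def .
  have Djj: "D (j (j X)) p v = - D X p v" if "vector_field A X" for X p v
    using D_minus[OF that] unfolding j_def JJ .
  \<comment> \<open>The tensor is evaluated on global fields rather than on vectors, because the Lee
    equation, the Nijenhuis tensor and the torsion are available for such fields;
    \<open>field_through\<close> returns to vectors at the end.\<close>
  have zero: "g p (D (j Y) p (X p) - J p (D Y p (X p))) (Z p) = 0"
    if XYZ: "vector_field A X" "vector_field A Y" "vector_field A Z" for X Y Z p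
  proof -
    define a where "a X Y Z = g p (D (j Y) p (X p) - J p (D Y p (X p))) (Z p)" for X Y Z
    let ?V = "Collect (vector_field A)"
    have comp: "dfun A (\<lambda>q. g q (j Y q) (Z q)) p v = g p (D (j Y) p v) (Z p) + g p (j Y p) (D Z p v)
        + \<theta> p v * g p (j Y p) (Z p)"
      if "vector_field A Y" "vector_field A Z" for Y Z v
      using compatible[OF jV] that by blast
    have DY: "linear (D Y p)" if "vector_field A Y" for Y
      using D_linear[OF open_UNIV that] by simp
    have gj: "g q (j Y q) (Z q) = - g q (j Z q) (Y q)" for Y Z q
      unfolding j_def by (rule g_J_skew)
    have skew: "g p (D (j Y) p v - J p (D Y p v)) (Z p) = - g p (D (j Z) p v - J p (D Z p v)) (Y p)"
      if Y: "vector_field A Y" and Z: "vector_field A Z" for Y Z v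
    proof -
      have "dfun A (\<lambda>q. g q (j Y q) (Z q)) p v = dfun A (\<lambda>q. - g q (j Z q) (Y q)) p v"
        by (simp only: gj[of _ Y Z])
      also have "\<dots> = - dfun A (\<lambda>q. g q (j Z q) (Y q)) p v"
        by (rule dfun_minus[OF smooth_bilinear_field[OF g_field open_UNIV jV[OF Z] Y]])
      finally show ?thesis
        using comp[OF Y Z, of v] comp[OF Z Y, of v] gj[where q = p and Y = Y and Z = Z]
          g_J[of p "D Y p v" "Z p"] g_J[of p "D Z p v" "Y p"]
          g_sym[of p "D Y p v" "j Z p"] g_sym[of p "D Z p v" "j Y p"]
        by (simp add: g_simps j_def)
    qed
    have "a X Y Z = 0"
    proof (rule nearly_kaehler_zero[where V = ?V and j = j])
      fix X Y Z assume "X \<in> ?V" "Y \<in> ?V" "Z \<in> ?V"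
      then have v: "vector_field A X" "vector_field A Y" "vector_field A Z" by auto
      note vj = jV[OF v(1)] jV[OF v(2)] jV[OF v(3)]
      show "a X Y Z = - a X Z Y"
        unfolding a_def by (rule skew[OF v(2,3)])
      show "a X (j Y) Z = a X Y (j Z)"
        using g_J[of p "D (j Y) p (X p)" "Z p"] by
            (simp add: a_def j_def[of Z] Djj[OF v(2)] g_simps hermitian)
      show "a X Y (j (j Z)) = - a X Y Z"
        by (simp add: a_def j_def[of "j Z"] j_def[of Z] JJ g_simps)
    next
      fix X Y Z assume "X \<in> ?V" "Y \<in> ?V" "Z \<in> ?V"
      then have v: "vector_field A X" "vector_field A Y" "vector_field A Z" by auto
      note vj = jV[OF v(1)] jV[OF v(2)] jV[OF v(3)]
      have br: "lie_bracket A X' Y' p = D Y' p (X' p) - D X' p (Y' p)"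
          if "vector_field A X'" "vector_field A Y'" for X' Y'
        using torsion_free[OF that] by simp
      have nij: "nijenhuis A J X Y p = lie_bracket A (j X) (j Y) p - J p (lie_bracket A (j X) Y p)
          - J p (lie_bracket A X (j Y) p) - lie_bracket A X Y p"
        unfolding nijenhuis_def j_def[abs_def] ..
      have "nijenhuis A J X Y p = 0"
        using complex v by (simp add: complex_structure_def)
      then have "D (j Y) p (j X p) - D (j X) p (j Y p) - J p (D Y p (j X p) - D (j X) p (Y p))
          - J p (D (j Y) p (X p) - D X p (j Y p)) - (D Y p (X p) - D X p (Y p)) = 0"
        unfolding nij by (simp only: br v vj)
      then have "g p (D (j Y) p (j X p) - D (j X) p (j Y p) - J p (D Y p (j X p) - D (j X) p (Y p))
          - J p (D (j Y) p (X p) - D X p (j Y p)) - (D Y p (X p) - D X p (Y p))) (Z p) = 0"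
        by (simp add: g_simps)
      then show "a (j X) Y Z - a (j Y) X Z + a X Y (j Z) - a Y X (j Z) = 0"
        using hermitian[of p "D Y p (X p)" "Z p"] hermitian[of p "D X p (Y p)" "Z p"]
          g_J[of p "D (j Y) p (X p)" "Z p"] g_J[of p "D (j X) p (Y p)" "Z p"]
        by (simp add: a_def g_simps J_simps j_def[of Z])
      have ext: "ext_deriv2 A (fundamental_form J g) X Y Z p =
         dfun A (\<lambda>q. g q (j Y q) (Z q)) p (X p) - dfun A (\<lambda>q. g q (j X q) (Z q)) p (Y p)
           + dfun A (\<lambda>q. g q (j X q) (Y q)) p (Z p)
         - g p (J p (lie_bracket A X Y p)) (Z p) + g p (J p (lie_bracket A X Z p)) (Y p) - g p (J p
             (lie_bracket A Y Z p)) (X p)"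
        unfolding ext_deriv2_def fundamental_form_def j_def ..
      have "ext_deriv2 A (fundamental_form J g) X Y Z p
          = wedge12 \<theta> (fundamental_form J g) p (X p) (Y p) (Z p)"
        by (rule lee_eq[OF v])
      \<comment> \<open>The brackets have been replaced through the torsion and the derivatives
        through \<open>comp\<close>, so each \<theta> term occurs on both sides; \<open>k2\<close>
        below matches those with \<open>\<theta> p (Y p)\<close>, whose arguments come in opposite
        order.\<close>
      then have e: "g p (D (j Y) p (X p)) (Z p) + g p (j Y p) (D Z p (X p))
         - g p (D (j X) p (Y p)) (Z p) - g p (j X p) (D Z p (Y p)) + g p (D (j X) p (Z p)) (Y p) + g p (j
             X p) (D Y p (Z p))
         + \<theta> p (X p) * g p (j Y p) (Z p) - \<theta> p (Y p) * g p (j X p) (Z p) + \<theta> p (Z p) * g p (j X p) (Y p)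
         - g p (J p (D Y p (X p) - D X p (Y p))) (Z p) + g p (J p (D Z p (X p) - D X p (Z p))) (Y p)
         - g p (J p (D Z p (Y p) - D Y p (Z p))) (X p)
        = \<theta> p (X p) * g p (j Y p) (Z p) + \<theta> p (Y p) * g p (j Z p) (X p) + \<theta> p (Z p) * g p (j X p) (Y p)"
        unfolding ext wedge12_def fundamental_form_def j_def[of X p, symmetric] j_def[of Y p, symmetric]
            j_def[of Z p, symmetric]
        by (simp add: comp v br)
      have k1: "g p (j Y p) u = - g p (J p u) (Y p)" "g p (j X p) u = - g p (J p u) (X p)"
          "g p (j Z p) u = - g p (J p u) (Z p)" for u
        unfolding j_def by (rule g_J_skew)+
      have k2: "g p (J p (X p)) (Z p) = - g p (J p (Z p)) (X p)"
        by (rule g_J_skew)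
      have sk: "a Y X Z = - a Y Z X"
        unfolding a_def by (rule skew[OF v(1,3)])
      show "a X Y Z + a Y Z X + a Z X Y = 0"
        using e sk k1(1)[of "D Z p (X p)"] k1(2)[of "D Z p (Y p)"] k1(2)[of "D Y p (Z p)"] k2
        by (simp add: a_def g_simps J_simps j_def algebra_simps)
    qed (use XYZ jV in auto)
    then show ?thesis by (simp add: a_def)
  qed
  show ?thesis
    unfolding parallel_endo_def
  proof (intro allI impI)
    fix Y p v assume Y: "vector_field A Y"
    obtain X where X: "vector_field A X" "X p = v" using field_through by blast
    obtain Z where Z: "vector_field A Z" "Z p = D (j Y) p v - J p (D Y p v)" using field_through by blast
    have "D (j Y) p v - J p (D Y p v) = 0"
      using zero[OF X(1) Y Z(1), of p] unfolding X(2) Z(2) by (rule g_zero)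
    then show "D (\<lambda>q. J q (Y q)) p v - J p (D Y p v) = 0"
      unfolding j_def[symmetric, abs_def] .
  qed
qed

lemma D_J: "vector_field A Y \<Longrightarrow> D (\<lambda>q. J q (Y q)) p v = J p (D Y p v)"
  using parallel_J unfolding parallel_endo_def by (metis eq_iff_diff_eq_0)

end

text \<open>The correction to the Levi-Civita connection is tensorial and symmetric in its two
  vectors, so the Leibniz rule and the torsion are inherited. In the derivative of \<open>g\<close>
  its last two terms cancel between the two arguments, and the first, occurring twice with factor
  1/2, leaves \<theta>.\<close>

lemma lck_manifold_structure:
  assumes "smooth_atlas A" "lck_manifold A c J D"
  obtains g \<theta> where "c = conformal_class A g" "lck_structure A g \<theta> D J"
proof -
  interpret smooth_manifold A by standard fact
  obtain g where cx: "complex_structure A J" and g: "c = conformal_class A g" "lck_metric A J g"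
      "minimal_weyl_connection A J g D"
    using assms(2) unfolding lck_manifold_def by blast
  obtain \<theta> N where \<theta>: "lee_form A J g \<theta>" and N: "levi_civita A g N" and DN: "\<And>Y p v. D Y p v = N Y p v -
        (1/2) *\<^sub>R (\<theta> p v *\<^sub>R Y p + \<theta> p (Y p) *\<^sub>R v - g p v (Y p) *\<^sub>R sharp g \<theta> p)"
    using g(3) unfolding minimal_weyl_connection_def by blast
  have herm: "riemannian_metric A g" "\<And>p u v. g p (J p u) (J p v) = g p u v"
    using g(2) by (auto simp: lck_metric_def hermitian_metric_def)
  have bil: "bilinear (g p)" and sym: "g p u v = g p v u" for p u v
    using herm(1) unfolding riemannian_metric_def by auto
  have of: "one_form A \<theta>" and lee: "\<And>X Y Z p. vector_field A X \<Longrightarrow> vector_field A Y \<Longrightarrow> vector_field A Z \<Longrightarrow>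
        ext_deriv2 A (fundamental_form J g) X Y Z p = wedge12 \<theta> (fundamental_form J g) p (X p) (Y p) (Z p)"
    using \<theta> by (auto simp: lee_form_def)
  have lin: "linear (\<theta> p)" for p using of by (simp add: one_form_def)
  have conn: "linear (N Y p)" "N (\<lambda>q. Y q + Z q) p v = N Y p v + N Z p v"
    "N (\<lambda>q. f q *\<^sub>R Y q) p v = dfun A f p v *\<^sub>R Y p + f p *\<^sub>R N Y p v"
    if "open W" "smooth_field_on A W Y" "smooth_field_on A W Z" "smooth_fun_on A W f" "p \<in> W"
        for W Y Z f p v
    using N that unfolding levi_civita_def connection_def by blast+
  note g_simps = bilinear_ladd[OF bil] bilinear_radd[OF bil] bilinear_lsub[OF bil] bilinear_rsub[OF bil]
    bilinear_lmul[OF bil] bilinear_rmul[OF bil]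
  have "lck_structure A g \<theta> D J"
  proof (intro lck_structure.intro weyl_structure.intro weyl_structure_axioms.intro
      lck_structure_axioms.intro)
    show "linear (D Y p)" if Y: "open W" "smooth_field_on A W Y" "p \<in> W" for W Y p
      using conn(1)[OF Y(1,2,2) smooth_fun_const Y(3)]
      by (intro linearI) (simp_all add: DN linear_add linear_scale lin g_simps algebra_simps)
    show "D (\<lambda>q. Y q + Z q) p v = D Y p v + D Z p v"
      if Y: "open W" "smooth_field_on A W Y" "smooth_field_on A W Z" "p \<in> W" for W Y Z p v
      using conn(2)[OF Y(1,2,3) smooth_fun_const Y(4)]
      by (simp add: DN linear_add lin g_simps algebra_simps)
    show "D (\<lambda>q. f q *\<^sub>R Y q) p v = dfun A f p v *\<^sub>R Y p + f p *\<^sub>R D Y p v"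
      if Y: "open W" "smooth_fun_on A W f" "smooth_field_on A W Y" "p \<in> W" for W Y f p v
      using conn(3)[OF Y(1,3,3,2,4)]
      by (simp add: DN linear_scale lin g_simps algebra_simps)
    show "D Y p (X p) - D X p (Y p) = lie_bracket A X Y p" if "vector_field A X" "vector_field A Y"
        for X Y p
    proof -
      have "N Y p (X p) - N X p (Y p) = lie_bracket A X Y p"
        using N that unfolding levi_civita_def by blast
      then show ?thesis using sym[of p "X p" "Y p"] by (simp add: DN algebra_simps)
    qed
    show "dfun A (\<lambda>q. g q (Y q) (Z q)) p v = g p (D Y p v) (Z p) + g p (Y p) (D Z p v)
        + \<theta> p v * g p (Y p) (Z p)"
      if "vector_field A Y" "vector_field A Z" for Y Z p v
    proof -
      obtain X where X: "vector_field A X" "X p = v" using field_through by blast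
      have "dfun A (\<lambda>q. g q (Y q) (Z q)) p (X p) = g p (N Y p (X p)) (Z p) + g p (Y p) (N Z p (X p))"
        using N that X(1) unfolding levi_civita_def by blast
      moreover have "g p (sharp g \<theta> p) u = \<theta> p u" "g p u (sharp g \<theta> p) = \<theta> p u" for u
        using sharp_eq[OF herm(1) lin] sym by simp_all
      ultimately show ?thesis
        using X(2) sym[of p "Y p" v] by (simp add: DN g_simps algebra_simps)
    qed
  qed (fact smooth_manifold_axioms herm of cx lee)+
  then show ?thesis using that g(1) by blast
qed

section \<open>Irreducible groups of similarities\<close>

abbreviation double_sum :: "'a::euclidean_space \<Rightarrow> 'a \<Rightarrow> ('a \<Rightarrow> 'a \<Rightarrow> real) \<Rightarrow> real" where
  "double_sum v w b \<equiv> \<Sum>i\<in>Basis. \<Sum>j\<in>Basis. (v \<bullet> i) * (w \<bullet> j) * b i j"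

lemma bilinear_expansion:
  fixes b :: "'a::euclidean_space \<Rightarrow> 'a \<Rightarrow> real"
  assumes "bilinear b"
  shows "b v w = double_sum v w b"
proof -
  have "linear (\<lambda>v. b v w)" "linear (b i)" for i w
    using assms by (auto simp: bilinear_def)
  then have "b v w = (\<Sum>i\<in>Basis. (v \<bullet> i) *\<^sub>R b i w)" "\<And>i. b i w = (\<Sum>j\<in>Basis. (w \<bullet> j) *\<^sub>R b i j)"
    using linear_basis_expansion[of "\<lambda>v. b v w" v] linear_basis_expansion[of _ w] by blast+
  then show ?thesis
    by (simp only: sum_distrib_left real_scaleR_def mult.assoc)
qed

text \<open>Compactness of the Euclidean unit sphere gives a maximum there, and the quotient is
  homogeneous of degree 0.\<close>

lemma rayleigh_quotient_max:
  fixes g b :: "'a::euclidean_space \<Rightarrow> 'a \<Rightarrow> real"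
  assumes g: "bilinear g" "\<And>u. u \<noteq> 0 \<Longrightarrow> g u u > 0" and b: "bilinear b"
  obtains \<mu> v where "v \<noteq> 0" "b v v = \<mu> * g v v" "\<And>u. b u u \<le> \<mu> * g u u"
proof -
  have cont: "continuous_on S (\<lambda>u. h u u)" if "bilinear h" for h :: "'a \<Rightarrow> 'a \<Rightarrow> real" and S
    using bounded_bilinear.continuous_on[OF bilinear_conv_bounded_bilinear[THEN iffD1, OF that]
        continuous_on_id continuous_on_id] .
  have "continuous_on (sphere 0 1) (\<lambda>u. b u u / g u u)"
  proof (rule continuous_on_divide[OF cont[OF b] cont[OF g(1)]])
    have "u \<noteq> 0" if "u \<in> sphere 0 1" for u :: 'a using that by auto
    then show "\<forall>u\<in>sphere 0 1. g u u \<noteq> 0" using g(2) by force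
  qed
  moreover obtain i :: 'a where "i \<in> Basis" using nonempty_Basis by blast
  then have "i \<in> sphere 0 1" by simp
  ultimately obtain v where v: "v \<in> sphere 0 1" "\<And>u. u \<in> sphere 0 1 \<Longrightarrow> b u u / g u u \<le> b v v / g v v"
    using continuous_attains_sup[of "sphere 0 1" "\<lambda>u. b u u / g u u"] compact_sphere by blast
  define \<mu> where "\<mu> = b v v / g v v"
  have v0: "v \<noteq> 0" using v(1) by auto
  have "b u u \<le> \<mu> * g u u" for u
  proof (cases "u = 0")
    case True
    then show ?thesis by (simp add: bilinear_lzero[OF g(1)] bilinear_lzero[OF b])
  next
    case False
    define c where "c = inverse (norm u)"
    have c: "c > 0" using False by (simp add: c_def)
    have "b (c *\<^sub>R u) (c *\<^sub>R u) / g (c *\<^sub>R u) (c *\<^sub>R u) \<le> \<mu>"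
      unfolding \<mu>_def by (rule v(2)) (use False in \<open>simp add: c_def\<close>)
    moreover have "b (c *\<^sub>R u) (c *\<^sub>R u) / g (c *\<^sub>R u) (c *\<^sub>R u) = b u u / g u u"
      using c by (simp add: bilinear_lmul[OF g(1)] bilinear_rmul[OF g(1)] bilinear_lmul[OF b]
          bilinear_rmul[OF b])
    ultimately show ?thesis
      using g(2)[OF False] by (simp add: divide_le_eq)
  qed
  moreover have "b v v = \<mu> * g v v"
    using g(2)[OF v0] by (simp add: \<mu>_def)
  ultimately show ?thesis using that v0 by blast
qed

text \<open>\<open>T\<close> multiplies the quotient b / g by m / l. At a vector where the quotient
  is maximal it cannot grow, so m / l is at most 1; exchanging the two forms gives equality.\<close>

lemma similarity_factor_le:
  fixes g b :: "'a::euclidean_space \<Rightarrow> 'a \<Rightarrow> real"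
  assumes g: "bilinear g" "\<And>u. u \<noteq> 0 \<Longrightarrow> g u u > 0" and b: "bilinear b" "\<And>u. u \<noteq> 0 \<Longrightarrow> b u u > 0"
    and T: "\<And>v w. g (T v) (T w) = l * g v w" "\<And>v w. b (T v) (T w) = m * b v w" and l: "l > 0"
  shows "m \<le> l"
proof -
  obtain \<mu> v where v: "v \<noteq> 0" "b v v = \<mu> * g v v" "\<And>u. b u u \<le> \<mu> * g u u"
    using rayleigh_quotient_max[OF g b(1)] by metis
  have "m * b v v \<le> \<mu> * (l * g v v)"
    using v(3)[of "T v"] T by simp
  also have "\<dots> = l * b v v" using v(2) by simp
  finally show ?thesis using b(2)[OF v(1)] by simp
qed

text \<open>Schur's lemma in the form used here: \<open>S\<close> is the eigenspace of
  \<open>b\<close> relative to \<open>g\<close> for the largest eigenvalue. It is nonzero, and maps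
  scaling both forms by the same factor preserve it.\<close>

lemma irreducible_similarities_scalar:
  fixes g b :: "'a::euclidean_space \<Rightarrow> 'a \<Rightarrow> real"
  assumes g: "bilinear g" "\<And>u v. g u v = g v u" "\<And>u. u \<noteq> 0 \<Longrightarrow> g u u > 0"
    and b: "bilinear b" "\<And>u v. b u v = b v u"
    and irr: "acts_irreducibly H"
    and H: "\<And>T. T \<in> H \<Longrightarrow> \<exists>l. \<forall>v w. g (T v) (T w) = l * g v w \<and> b (T v) (T w) = l * b v w"
  obtains \<mu> where "\<And>v w. b v w = \<mu> * g v w"
proof -
  obtain \<mu> v where v: "v \<noteq> 0" "b v v = \<mu> * g v v" "\<And>u. b u u \<le> \<mu> * g u u"
    using rayleigh_quotient_max[OF g(1,3) b(1)] by metis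
  define S where "S = {v. \<forall>w. b v w = \<mu> * g v w}"
  note bsimps = bilinear_ladd[OF g(1)] bilinear_ladd[OF b(1)] bilinear_lmul[OF g(1)] bilinear_lmul[OF b(1)]
    bilinear_lzero[OF g(1)] bilinear_lzero[OF b(1)]
    bilinear_radd[OF g(1)] bilinear_radd[OF b(1)] bilinear_rmul[OF g(1)] bilinear_rmul[OF b(1)]
  \<comment> \<open>The form \<mu> g - b is positive semidefinite, so a vector on which its
    quadratic form vanishes lies in its kernel. This diagonal criterion makes the invariance of
    \<open>S\<close> immediate, since \<open>T u\<close> is then only paired with itself.\<close>
  have S: "u \<in> S" if u: "b u u = \<mu> * g u u" for u
  proof -
    have "b u w = \<mu> * g u w" for w
    proof (rule ccontr)
      assume ne: "b u w \<noteq> \<mu> * g u w"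
      define c d where "c = \<mu> * g u w - b u w" and "d = \<mu> * g w w - b w w"
      have c0: "c \<noteq> 0" using ne by (simp add: c_def)
      have d0: "d \<ge> 0" using v(3)[of w] by (simp add: d_def)
      have ineq: "2 * t * c + t * t * d \<ge> 0" for t
        using v(3)[of "u + t *\<^sub>R w"] u g(2)[of w u] b(2)[of w u]
        by (simp add: bsimps c_def d_def algebra_simps)
      \<comment> \<open>The denominator is d + 1 because d may be 0. With this t the quadratic 2tc +
        t^2 d becomes -t^2 (d + 2), which is negative.\<close>
      define t where "t = - c / (d + 1)"
      have t: "c = - (t * (d + 1))" "t \<noteq> 0"
        using c0 d0 by (auto simp: t_def)
      have "0 < t * t"
        using t(2) not_real_square_gt_zero by blast
      then have "0 < t * t * (d + 2)"
        using d0 by simp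
      moreover have "2 * t * c + t * t * d = - (t * t * (d + 2))"
        unfolding t(1) by (simp add: algebra_simps)
      ultimately show False using ineq[of t] by linarith
    qed
    then show ?thesis by (simp add: S_def)
  qed
  have "subspace S"
    by (auto simp: subspace_def S_def bsimps algebra_simps)
  moreover have "\<forall>T\<in>H. T ` S \<subseteq> S"
  proof clarify
    fix T u assume T: "T \<in> H" and u: "u \<in> S"
    obtain l where l: "\<And>v w. g (T v) (T w) = l * g v w" "\<And>v w. b (T v) (T w) = l * b v w"
      using H[OF T] by blast
    show "T u \<in> S"
      by (rule S) (use u in \<open>simp add: l S_def\<close>)
  qed
  ultimately have "S = {0} \<or> S = UNIV"
    using irr by (simp add: acts_irreducibly_def)
  moreover have "v \<in> S" using S v(2) by blast
  ultimately have "S = UNIV" using v(1) by auto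
  then have "b v w = \<mu> * g v w" for v w
    unfolding S_def by blast
  then show ?thesis using that by blast
qed

section \<open>Partitions of an interval, limits and antiderivatives across breakpoints\<close>

lemma partition_mono:
  fixes \<tau> :: "nat \<Rightarrow> real"
  assumes "\<And>i. i < k \<Longrightarrow> \<tau> i < \<tau> (Suc i)" "i \<le> j" "j \<le> k"
  shows "\<tau> i \<le> \<tau> j"
  using assms(2,3)
proof (induction j)
  case (Suc j)
  then show ?case using assms(1)[of j] by (cases "i = Suc j") (auto intro: order.trans less_imp_le)
qed simp

text \<open>The pieces are added one at a time. A piece that misses \<open>t\<close> contributes the
  trivial filter, so only limits on pieces that contain \<open>t\<close> have to be known.\<close>

lemma tendsto_within_partition:
  fixes \<tau> :: "nat \<Rightarrow> real"
  assumes \<tau>: "\<And>i. i < k \<Longrightarrow> \<tau> i < \<tau> (Suc i)"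
    and f: "\<And>i. i < k \<Longrightarrow> t \<in> {\<tau> i..\<tau> (Suc i)} \<Longrightarrow> (f \<longlongrightarrow> l) (at t within {\<tau> i..\<tau> (Suc i)})"
  shows "(f \<longlongrightarrow> l) (at t within {\<tau> 0..\<tau> k})"
proof -
  have "(f \<longlongrightarrow> l) (at t within {\<tau> 0..\<tau> j})" if "j \<le> k" for j
    using that
  proof (induction j)
    case 0
    have "at t within {\<tau> 0..\<tau> 0} = bot"
      using islimpt_finite[of "{\<tau> 0}" t] by (simp add: trivial_limit_within)
    then show ?case by simp
  next
    case (Suc j)
    have "(f \<longlongrightarrow> l) (at t within {\<tau> j..\<tau> (Suc j)})"
    proof (cases "t \<in> {\<tau> j..\<tau> (Suc j)}")
      case False
      then have "at t within {\<tau> j..\<tau> (Suc j)} = bot"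
        by (intro not_in_closure_trivial_limitI) simp
      then show ?thesis by simp
    qed (use f Suc.prems in simp)
    moreover have "{\<tau> 0..\<tau> (Suc j)} = {\<tau> 0..\<tau> j} \<union> {\<tau> j..\<tau> (Suc j)}"
      using partition_mono[where \<tau> = \<tau>, OF \<tau>, of k 0 j] \<tau>[of j] Suc.prems by auto
    ultimately show ?case
      using Suc by (simp add: Lim_Un)
  qed
  then show ?thesis by simp
qed

text \<open>The antiderivatives of the pieces are shifted by constants so that they meet at the
  breakpoints. Differentiability is asked for in the interiors only, as \<open>\<phi>\<close> may
  jump at a corner of the curve.\<close>

lemma piecewise_antiderivative:
  fixes \<tau> :: "nat \<Rightarrow> real" and \<phi> :: "real \<Rightarrow> real"
  assumes \<tau>: "\<And>i. i < k \<Longrightarrow> \<tau> i < \<tau> (Suc i)"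
    and Q: "\<And>i. i < k \<Longrightarrow> \<exists>Q. continuous_on {\<tau> i..\<tau> (Suc i)} Q \<and>
      (\<forall>t\<in>{\<tau> i<..<\<tau> (Suc i)}. (Q has_real_derivative \<phi> t) (at t))"
  shows "\<exists>P. continuous_on {\<tau> 0..\<tau> k} P \<and>
    (\<forall>i<k. \<forall>t\<in>{\<tau> i<..<\<tau> (Suc i)}. (P has_real_derivative \<phi> t) (at t))"
proof -
  have "\<exists>P. continuous_on {\<tau> 0..\<tau> j} P \<and>
    (\<forall>i<j. \<forall>t\<in>{\<tau> i<..<\<tau> (Suc i)}. (P has_real_derivative \<phi> t) (at t))" if "j \<le> k" for j
    using that
  proof (induction j)
    case 0
    have "continuous_on {\<tau> 0..\<tau> 0} (\<lambda>t. 0 :: real)" by simp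
    then show ?case by blast
  next
    case (Suc j)
    then obtain P where P: "continuous_on {\<tau> 0..\<tau> j} P"
      "\<And>i t. i < j \<Longrightarrow> t \<in> {\<tau> i<..<\<tau> (Suc i)} \<Longrightarrow> (P has_real_derivative \<phi> t) (at t)" by auto
    obtain Q where Q: "continuous_on {\<tau> j..\<tau> (Suc j)} Q"
      "\<And>t. t \<in> {\<tau> j<..<\<tau> (Suc j)} \<Longrightarrow> (Q has_real_derivative \<phi> t) (at t)"
      using assms(2)[of j] Suc.prems by auto
    define R where "R t = (if t \<le> \<tau> j then P t else P (\<tau> j) - Q (\<tau> j) + Q t)" for t
    have un: "{\<tau> 0..\<tau> (Suc j)} = {\<tau> 0..\<tau> j} \<union> {\<tau> j..\<tau> (Suc j)}"
      using partition_mono[where \<tau> = \<tau>, OF \<tau>, of k 0 j] \<tau>[of j] Suc.prems by auto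
    have "continuous_on {\<tau> 0..\<tau> (Suc j)} R"
      unfolding un R_def
      by (rule continuous_on_cases) (auto intro!: continuous_intros P(1) Q(1))
    moreover have "(R has_real_derivative \<phi> t) (at t)" if i: "i < Suc j" and t: "t \<in> {\<tau> i<..<\<tau> (Suc i)}"
        for i t
    proof (cases "i = j")
      case True
      have "((\<lambda>t. P (\<tau> j) - Q (\<tau> j) + Q t) has_real_derivative \<phi> t) (at t)"
        using DERIV_add[OF DERIV_const[of "P (\<tau> j) - Q (\<tau> j)"] Q(2)[of t]] t True by simp
      then show ?thesis
        by (rule has_field_derivative_transform_within_open[where S = "{\<tau> j<..<\<tau> (Suc j)}"])
          (use t True in \<open>auto simp: R_def\<close>)
    next
      case False
      then have ij: "i < j" using i by simp
      have "\<tau> (Suc i) \<le> \<tau> j" using partition_mono[where \<tau> = \<tau>, OF \<tau>, of k "Suc i" j] ij Suc.prems by simp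
      then show ?thesis
        by (intro has_field_derivative_transform_within_open[OF P(2)[OF ij t], where S
            = "{\<tau> i<..<\<tau> (Suc i)}"])
          (use t in \<open>auto simp: R_def\<close>)
    qed
    ultimately show ?case by blast
  qed
  then show ?thesis by blast
qed

lemma continuous_antiderivative:
  fixes \<phi> :: "real \<Rightarrow> real"
  assumes "a < b" "continuous_on {a..b} \<phi>"
  shows "\<exists>Q. continuous_on {a..b} Q \<and> (\<forall>t\<in>{a<..<b}. (Q has_real_derivative \<phi> t) (at t))"
proof -
  have d: "((\<lambda>u. integral {a..u} \<phi>) has_real_derivative \<phi> t) (at t within {a..b})" if "t \<in> {a..b}" for t
    by (rule integral_has_real_derivative[OF assms(2) that])
  have "continuous_on {a..b} (\<lambda>u. integral {a..u} \<phi>)"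
    using DERIV_continuous_on[OF d] .
  moreover have "((\<lambda>u. integral {a..u} \<phi>) has_real_derivative \<phi> t) (at t)" if "t \<in> {a<..<b}" for t
    using d[of t] that at_within_Icc_at[of a t b] by simp
  ultimately show ?thesis by blast
qed

lemma has_vector_derivative_compose:
  assumes "(\<beta> has_derivative \<beta>') (at (x t))" "(x has_vector_derivative x') (at t within I)"
  shows "((\<lambda>s. \<beta> (x s)) has_vector_derivative \<beta>' x') (at t within I)"
proof -
  have "((\<lambda>s. \<beta> (x s)) has_derivative (\<lambda>h. \<beta>' (h *\<^sub>R x'))) (at t within I)"
    using has_derivative_compose[OF assms(2)[unfolded has_vector_derivative_def] assms(1)] .
  then show ?thesis
    by (simp add: has_vector_derivative_def linear_scale[OF has_derivative_linear[OF assms(1)]])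
qed

text \<open>The product rule for a bilinear form whose coefficients vary along \<open>x\<close>. The
  derivatives of the two vectors and of the coefficients stay in separate sums, ready for the
  cancellation of the connection terms.\<close>

lemma has_real_derivative_trilinear:
  fixes a b :: "real \<Rightarrow> 'e::euclidean_space" and \<beta> :: "'e \<Rightarrow> 'e \<Rightarrow> 'f::real_normed_vector \<Rightarrow> real"
  assumes \<beta>: "\<And>i j. (\<beta> i j has_derivative \<beta>' i j) (at (x t))"
    and x: "(x has_vector_derivative x') (at t within I)"
    and a: "(a has_vector_derivative a') (at t within I)"
        and b: "(b has_vector_derivative b') (at t within I)"
  shows "((\<lambda>s. double_sum (a s) (b s) (\<lambda>i j. \<beta> i j (x s))) has_real_derivative
     double_sum a' (b t) (\<lambda>i j. \<beta> i j (x t)) + double_sum (a t) b' (\<lambda>i j. \<beta> i j (x t))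
      + double_sum (a t) (b t) (\<lambda>i j. \<beta>' i j x')) (at t within I)"
proof -
  have c: "((\<lambda>s. w s \<bullet> i) has_real_derivative w' \<bullet> i) (at t within I)"
    if "(w has_vector_derivative w') (at t within I)" for w w' and i :: 'e
    using has_derivative_inner_left[OF that[unfolded has_vector_derivative_def], of i]
    by (simp add: has_field_derivative_def mult_commute_abs)
  have d: "((\<lambda>s. \<beta> i j (x s)) has_real_derivative \<beta>' i j x') (at t within I)" for i j
    using has_vector_derivative_compose[where \<beta> = "\<beta> i j" and x = x, OF \<beta> x] by
        (simp add: has_real_derivative_iff_has_vector_derivative)
  have "((\<lambda>s. double_sum (a s) (b s) (\<lambda>i j. \<beta> i j (x s))) has_real_derivative
     (\<Sum>i\<in>Basis. \<Sum>j\<in>Basis. ((a' \<bullet> i) * (b t \<bullet> j) + (b' \<bullet> j) * (a t \<bullet> i)) * \<beta> i j (x t) + \<beta>' i j x' * ((a t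
         \<bullet> i) * (b t \<bullet> j)))) (at t within I)"
    by (intro DERIV_sum DERIV_mult c[OF a] c[OF b] d)
  then show ?thesis
    by (simp add: sum.distrib algebra_simps)
qed

lemma partition_interior:
  fixes \<tau> :: "nat \<Rightarrow> real"
  assumes "t \<in> {\<tau> 0..\<tau> k}" "t \<notin> \<tau> ` {..k}"
  shows "\<exists>i<k. t \<in> {\<tau> i<..<\<tau> (Suc i)}"
proof -
  have "t \<le> \<tau> j \<Longrightarrow> j \<le> k \<Longrightarrow> \<exists>i<k. t \<in> {\<tau> i<..<\<tau> (Suc i)}" for j
  proof (induction j)
    case 0
    then show ?case using assms by force
  next
    case (Suc j)
    then have "t \<noteq> \<tau> j" "t \<noteq> \<tau> (Suc j)" using assms by auto
    then show ?case using Suc by (cases "t \<le> \<tau> j") (auto intro!: exI[of _ j])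
  qed
  from this[of k] show ?thesis using assms by simp
qed

lemma (in smooth_manifold) bilinear_coord_expansion:
  assumes bil: "bilinear (b q)" and k: "k \<in> A" "q \<in> fst k"
  shows "b q (coord_field A k v q) (coord_field A k w q)
      = double_sum v w (\<lambda>i j. b q (coord_field A k i q) (coord_field A k j q))"
proof -
  have "linear (\<lambda>w. b q u (coord_field A k w q))" "linear (\<lambda>w. b q (coord_field A k w q) u)" for u
    using linear_compose[OF linear_coord_field[OF k], of "b q u"]
        linear_compose[OF linear_coord_field[OF k], of "\<lambda>v. b q v u"] bil
    by (simp_all add: bilinear_def o_def)
  then have "bilinear (\<lambda>v w. b q (coord_field A k v q) (coord_field A k w q))"
    by (simp add: bilinear_def)
  from bilinear_expansion[OF this] show ?thesis .
qed

lemma (in smooth_manifold) smooth_fun_continuous: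
  assumes "open W" "smooth_fun_on A W f"
  shows "continuous_on W f"
proof -
  have "isCont f p" if p: "p \<in> W" for p
  proof -
    define k where "k = pchart A p"
    have k: "k \<in> A" "p \<in> fst k" by (simp_all add: k_def pchart)
    have "isCont (f \<circ> chart_inv k) (snd k p)"
      unfolding k_def by (rule has_derivative_continuous[OF dfun_has_derivative[OF assms p]])
    moreover have "isCont (snd k) p"
      using chart_continuous[OF k(1)] chart_open[OF k(1)] k(2) by (simp add: continuous_on_eq_continuous_at)
    ultimately have c: "isCont (\<lambda>q. (f \<circ> chart_inv k) (snd k q)) p"
      by (rule isCont_o2[rotated])
    have ev: "\<forall>\<^sub>F q in nhds p. (f \<circ> chart_inv k) (snd k q) = f q"
      using k chart_open[OF k(1)] chart_inv_left[OF k(1)] by (auto simp: eventually_nhds)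
    show ?thesis
      by (rule isCont_cong[THEN iffD1, OF ev c])
  qed
  then show ?thesis by (simp add: continuous_at_imp_continuous_on)
qed

text \<open>Only the components of \<open>V\<close> and \<open>W\<close> in the chart at
  \<open>\<gamma> t\<close> converge, since the fields themselves jump with the identification of
  tangent spaces. In that chart the pairing is a finite sum of products of convergent
  factors.\<close>

lemma (in smooth_manifold) tendsto_bilinear_field:
  fixes t :: real
  assumes bb: "bilinear_field b" and \<gamma>: "continuous (at t within I) \<gamma>"
    and V: "((\<lambda>s. dchart A (pchart A (\<gamma> t)) (\<gamma> s) (V s)) \<longlongrightarrow> V t) (at t within I)"
    and W: "((\<lambda>s. dchart A (pchart A (\<gamma> t)) (\<gamma> s) (W s)) \<longlongrightarrow> W t) (at t within I)"
  shows "((\<lambda>s. b (\<gamma> s) (V s) (W s)) \<longlongrightarrow> b (\<gamma> t) (V t) (W t)) (at t within I)"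
proof -
  define k where "k = pchart A (\<gamma> t)"
  have k: "k \<in> A" "\<gamma> t \<in> fst k" by (simp_all add: k_def pchart)
  have bil: "bilinear (b q)" for q using bb by (simp add: bilinear_field_def)
  let ?c = "coord_field A k"
  have ev: "\<forall>\<^sub>F s in at t within I. \<gamma> s \<in> fst k"
    using \<gamma> topological_tendstoD[OF _ chart_open[OF k(1)]] k(2) by (auto simp: continuous_within)
  have sym: "((\<lambda>s. b (\<gamma> s) (?c i (\<gamma> s)) (?c j (\<gamma> s))) \<longlongrightarrow> b (\<gamma> t) (?c i (\<gamma> t)) (?c j (\<gamma> t))) (at t within I)" for i j
  proof -
    have "smooth_fun_on A (fst k) (\<lambda>q. b q (?c i q) (?c j q))"
      using bb k(1) by (simp add: bilinear_field_def)
    then have c: "isCont (\<lambda>q. b q (?c i q) (?c j q)) (\<gamma> t)"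
      using smooth_fun_continuous[OF chart_open[OF k(1)]] chart_open[OF k(1)] k(2)
      by (simp add: continuous_on_eq_continuous_at)
    show ?thesis
      by (rule isCont_tendsto_compose[OF c \<gamma>[unfolded continuous_within]])
  qed
  let ?S = "\<lambda>s. double_sum (dchart A k (\<gamma> s) (V s)) (dchart A k (\<gamma> s) (W s)) (\<lambda>i j. b (\<gamma> s) (?c i (\<gamma> s)) (?c j (\<gamma> s)))"
  have S: "?S s = b (\<gamma> s) (V s) (W s)" if "\<gamma> s \<in> fst k" for s
    using bilinear_coord_expansion[where b = b and q = "\<gamma> s" and v = "dchart A k (\<gamma> s) (V s)" and w
        = "dchart A k (\<gamma> s) (W s)", OF bil k(1) that]
    by (simp add: coord_field_dchart[OF k(1) that])
  have "(?S \<longlongrightarrow> (double_sum (V t) (W t) (\<lambda>i j. b (\<gamma> t) (?c i (\<gamma> t)) (?c j (\<gamma> t))))) (at t within I)"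
    by (intro tendsto_intros sym V[folded k_def] W[folded k_def])
  also have "double_sum (V t) (W t) (\<lambda>i j. b (\<gamma> t) (?c i (\<gamma> t)) (?c j (\<gamma> t))) = ?S t"
    by (simp add: k_def)
  also have "?S t = b (\<gamma> t) (V t) (W t)" by (rule S[OF k(2)])
  finally show ?thesis
    by (rule Lim_transform_eventually) (use ev in \<open>eventually_elim, simp only: S\<close>)
qed

text \<open>At a breakpoint the derivatives from the two sides may differ, so the parallel equation
  is kept off a finite set; continuity holds everywhere. This suffices for an argument by zero
  derivative with finitely many exceptions.\<close>

lemma (in smooth_manifold) parallel_along_pieces:
  assumes "parallel_along A D \<gamma> V"
  obtains K where "finite K"
    "\<And>t. t \<in> {0..1} - K \<Longrightarrow> at t within {0..1} = at t"
    "\<And>t. t \<in> {0..1} - K \<Longrightarrow> parallel_at A D \<gamma> V {0..1} t"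
    "\<And>t. t \<in> {0..1} \<Longrightarrow> continuous (at t within {0..1}) \<gamma>"
    "\<And>t. t \<in> {0..1} \<Longrightarrow> ((\<lambda>s. dchart A (pchart A (\<gamma> t)) (\<gamma> s) (V s)) \<longlongrightarrow> V t) (at t within {0..1})"
proof -
  obtain k \<tau> where \<tau>: "\<tau> 0 = 0" "\<tau> k = 1" and less: "\<And>i. i < k \<Longrightarrow> \<tau> i < \<tau> (Suc i)"
    and par: "\<And>i t. i < k \<Longrightarrow> t \<in> {\<tau> i..\<tau> (Suc i)} \<Longrightarrow> parallel_at A D \<gamma> V {\<tau> i..\<tau> (Suc i)} t"
    using assms unfolding parallel_along_def by blast
  have le: "0 \<le> \<tau> i" "\<tau> i \<le> 1" if "i \<le> k" for i
    using partition_mono[where \<tau> = \<tau>, OF less, of k 0 i] partition_mono[where \<tau> = \<tau>, OF less, of k i k]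
        that \<tau> by auto
  define K where "K = \<tau> ` {..k}"
  have interior: "at t within {0..1} = at t" "\<exists>i<k. t \<in> {\<tau> i<..<\<tau> (Suc i)}" if t: "t \<in> {0..1} - K" for t
  proof -
    have "t \<noteq> 0" "t \<noteq> 1" using t \<tau> by (auto simp: K_def image_iff)
    then show "at t within {0..1} = at t"
      using t by (intro at_within_Icc_at) auto
    show "\<exists>i<k. t \<in> {\<tau> i<..<\<tau> (Suc i)}"
      by (rule partition_interior) (use t \<tau> in \<open>auto simp: K_def\<close>)
  qed
  have "parallel_at A D \<gamma> V {0..1} t" if t: "t \<in> {0..1} - K" for t
  proof -
    obtain i where i: "i < k" "t \<in> {\<tau> i<..<\<tau> (Suc i)}" using interior(2)[OF t] by blast
    then have "at t within {\<tau> i..\<tau> (Suc i)} = at t within {0..1}"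
      using at_within_Icc_at[of "\<tau> i" t "\<tau> (Suc i)"] interior(1)[OF t] by simp
    then show ?thesis
      using par[OF i(1), of t] i(2) by (simp add: parallel_at_def has_velocity_def)
  qed
  moreover have "continuous (at t within {0..1}) \<gamma>" if "t \<in> {0..1}" for t
    using tendsto_within_partition[where \<tau> = \<tau> and k = k and f = \<gamma> and t = t, OF less] par \<tau>
    by (auto simp: continuous_within parallel_at_def has_velocity_def)
  moreover have "((\<lambda>s. dchart A (pchart A (\<gamma> t)) (\<gamma> s) (V s)) \<longlongrightarrow> V t) (at t within {0..1})" for t
  proof -
    have "((\<lambda>s. dchart A (pchart A (\<gamma> t)) (\<gamma> s) (V s)) \<longlongrightarrow> V t) (at t within {\<tau> i..\<tau> (Suc i)})"
      if i: "i < k" "t \<in> {\<tau> i..\<tau> (Suc i)}" for i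
    proof -
      have "continuous (at t within {\<tau> i..\<tau> (Suc i)}) (\<lambda>s. dchart A (pchart A (\<gamma> t)) (\<gamma> s) (V s))"
        using par[OF i] unfolding parallel_at_def by (blast intro: has_vector_derivative_continuous)
      then show ?thesis by (simp add: continuous_within)
    qed
    from tendsto_within_partition[where \<tau> = \<tau> and k = k, OF less this] \<tau> show ?thesis by simp
  qed
  moreover have "finite K" by (simp add: K_def)
  ultimately show ?thesis using that interior(1) by blast
qed

context weyl_structure
begin

section \<open>Parallel transport\<close>

text \<open>In the chart at \<open>\<gamma> t\<close> the components of \<open>V\<close> and
  \<open>W\<close> contribute the negative covariant derivatives of coordinate fields. The same
  terms with the opposite sign come from the recurrence of \<open>b\<close> on those coordinate
  fields, and the \<eta> term survives.\<close>

lemma recurrent_symbols: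
  fixes t :: real
  assumes b: "recurrent b \<eta>" and V: "parallel_at A D \<gamma> V I t" and W: "parallel_at A D \<gamma> W I t"
      and I: "t \<in> I"
    and u: "has_velocity A \<gamma> u t I" and nb: "at t within I \<noteq> bot"
  shows "((\<lambda>s. b (\<gamma> s) (V s) (W s)) has_real_derivative \<eta> (\<gamma> t) u * b (\<gamma> t) (V t) (W t)) (at t within I)"
proof -
  define p k where "p = \<gamma> t" and "k = pchart A p"
  have k: "k \<in> A" "p \<in> fst k" by (simp_all add: k_def pchart)
  define x where "x = (\<lambda>s. snd k (\<gamma> s))"
  have xt: "x t = snd k p" by (simp add: x_def p_def)
  have vel: "continuous (at t within I) \<gamma>" "(x has_vector_derivative u) (at t within I)"
    using u by (simp_all add: has_velocity_def x_def k_def p_def)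
  \<comment> \<open>Each \<open>parallel_at\<close> brings a velocity of its own; on a nontrivial
    filter they all coincide with \<open>u\<close>.\<close>
  have uniq: "u' = u" if "has_velocity A \<gamma> u' t I" for u'
    using vector_derivative_unique_within[OF nb, of "\<lambda>s. snd (pchart A (\<gamma> t)) (\<gamma> s)" u' u] that u
    by (simp add: has_velocity_def)
  have par: "((\<lambda>s. dchart A k (\<gamma> s) (V s)) has_vector_derivative - D (coord_field A k (V t)) p u) (at t within I)"
    "((\<lambda>s. dchart A k (\<gamma> s) (W s)) has_vector_derivative - D (coord_field A k (W t)) p u) (at t within I)"
    using V W uniq unfolding parallel_at_def p_def k_def by blast+
  have bb: "bilinear_field b" using b by (simp add: recurrent_def)
  then have bil: "bilinear (b q)" for q by (simp add: bilinear_field_def)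
  let ?c = "coord_field A k"
  define f where "f i j q = b q (?c i q) (?c j q)" for i j q
  have f: "smooth_fun_on A (fst k) (f i j)" for i j
    using bb k(1) by (simp add: bilinear_field_def f_def[abs_def])
  have df: "((f i j \<circ> chart_inv k) has_derivative dfun A (f i j) p) (at (x t))" for i j
    unfolding xt k_def by (rule dfun_has_derivative[OF chart_open[OF pchart(1)] f[unfolded k_def]
        pchart(2)])
  have f_exp: "f v w q = double_sum v w (\<lambda>i j. f i j q)" if q: "q \<in> fst k" for v w q
    unfolding f_def by (rule bilinear_coord_expansion[where b = b and q = q, OF bil k(1) q])
  have "((\<lambda>y. double_sum (V t) (W t) (\<lambda>i j. (f i j \<circ> chart_inv k) y)) has_derivative
     (\<lambda>h. double_sum (V t) (W t) (\<lambda>i j. dfun A (f i j) p h))) (at (x t))"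
    by (intro has_derivative_sum has_derivative_mult_right df)
  then have "((f (V t) (W t) \<circ> chart_inv k) has_derivative
     (\<lambda>h. double_sum (V t) (W t) (\<lambda>i j. dfun A (f i j) p h))) (at (x t))"
    by (rule has_derivative_transform_within_open[OF _ chart_image_open[OF k(1) chart_open[OF k(1)]
        order.refl]])
      (use k chart_inv_in[OF k(1)] in \<open>auto simp: xt f_exp[symmetric]\<close>)
  then have df_exp: "dfun A (f (V t) (W t)) p h = double_sum (V t) (W t) (\<lambda>i j. dfun A (f i j) p h)" for h
    using has_derivative_unique[OF df] by (simp add: fun_eq_iff)
  have compat: "dfun A (f (V t) (W t)) p u = b p (D (?c (V t)) p u) (W t) + b p (V t) (D (?c (W t)) p u)
      + \<eta> p u * b p (V t) (W t)"
    using recurrent_local[OF b chart_open[OF k(1)] k(2) smooth_coord_field[OF k(1)]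
        smooth_coord_field[OF k(1)]]
    unfolding f_def[abs_def] by (simp add: k_def)
  have fp: "(f i j \<circ> chart_inv k) (x t) = b p i j" for i j
    unfolding xt o_apply chart_inv_left[OF k] f_def by (simp add: k_def)
  have fv: "f v w p = b p v w" for v w
    by (simp add: f_def k_def)
  have at: "dchart A k (\<gamma> t) w = w" for w
    by (simp add: k_def p_def)
  let ?h = "\<lambda>s. double_sum (dchart A k (\<gamma> s) (V s)) (dchart A k (\<gamma> s) (W s)) (\<lambda>i j. (f i j \<circ> chart_inv k) (x s))"
  have "(?h
      has_real_derivative
      double_sum (- D (?c (V t)) p u) (W t) (b p)
      + double_sum (V t) (- D (?c (W t)) p u) (b p)
      + double_sum (V t) (W t) (\<lambda>i j. dfun A (f i j) p u)) (at t within I)"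
    using has_real_derivative_trilinear[where \<beta> = "\<lambda>i j. f i j \<circ> chart_inv k" and x = x, OF df vel(2) par]
    unfolding at fp .
  moreover have "double_sum (- D (?c (V t)) p u) (W t) (b p)
      + double_sum (V t) (- D (?c (W t)) p u) (b p)
      + double_sum (V t) (W t) (\<lambda>i j. dfun A (f i j) p u) = \<eta> p u * b p (V t) (W t)"
    unfolding bilinear_expansion[OF bil, symmetric] df_exp[symmetric] compat
    by (simp add: bilinear_lneg[OF bil] bilinear_rneg[OF bil])
  ultimately have "(?h
      has_real_derivative \<eta> p u * b p (V t) (W t)) (at t within I)" by simp
  moreover have "\<forall>\<^sub>F s in at t within I. \<gamma> s \<in> fst k"
    using vel(1) topological_tendstoD[OF _ chart_open[OF k(1)]] k(2) by (auto simp: continuous_within p_def)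
  then have "\<forall>\<^sub>F s in at t within I. ?h s
      = b (\<gamma> s) (V s) (W s)"
  proof eventually_elim
    case (elim s)
    have "(f i j \<circ> chart_inv k) (x s) = f i j (\<gamma> s)" for i j
      by (simp add: x_def chart_inv_left[OF k(1) elim])
    then show ?case
      using f_exp[OF elim, of "dchart A k (\<gamma> s) (V s)" "dchart A k (\<gamma> s) (W s)", symmetric]
      by (simp add: f_def[of "dchart A k (\<gamma> s) (V s)"] coord_field_dchart[OF k(1) elim])
  qed
  ultimately show ?thesis
    unfolding p_def has_field_derivative_def
    by (rule has_derivative_transform_eventually)
        (use I in \<open>simp_all add: at x_def chart_inv_left[OF k, unfolded p_def]
        fv[unfolded p_def] bilinear_expansion[OF bil, symmetric]\<close>)
qed

end

section \<open>Line integrals of one-forms\<close>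

text \<open>The integrand \<eta>(\<gamma>'(t)). The derivative is two-sided, so the value is
  meaningful inside the smooth pieces and arbitrary at corners.\<close>

definition (in smooth_manifold) along :: "('m \<Rightarrow> 'e \<Rightarrow> real) \<Rightarrow> (real \<Rightarrow> 'm) \<Rightarrow> real \<Rightarrow> real" where
  "along \<eta> \<gamma> t = \<eta> (\<gamma> t) (vector_derivative (\<lambda>s. snd (pchart A (\<gamma> t)) (\<gamma> s)) (at t))"

text \<open>A smooth curve on a closed interval extends smoothly to an open set, where the integrand
  is continuous up to the end points of the interval. In the open interval it agrees with the
  integrand of the given curve.\<close>

lemma (in smooth_manifold) along_antiderivative:
  assumes \<eta>: "one_form A \<eta>" and \<gamma>: "smooth_curve_on A {a..b} \<gamma>" and ab: "a < b"
  shows "\<exists>Q. continuous_on {a..b} Q \<and> (\<forall>t\<in>{a<..<b}. (Q has_real_derivative along \<eta> \<gamma> t) (at t))"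
proof -
  obtain I \<sigma> where I: "open I" "{a..b} \<subseteq> I" and eq: "\<And>t. t \<in> {a..b} \<Longrightarrow> \<gamma> t = \<sigma> t"
      and cont: "continuous_on I \<sigma>"
    and sm: "\<And>k. k \<in> A \<Longrightarrow> smooth_on (I \<inter> \<sigma> -` fst k) (snd k \<circ> \<sigma>)"
    using \<gamma> unfolding smooth_curve_on_def by blast
  have O: "open (I \<inter> \<sigma> -` fst k)" if "k \<in> A" for k
    using continuous_open_preimage[OF cont I(1) chart_open[OF that]] .
  let ?v = "\<lambda>k t. frechet_derivative (snd k \<circ> \<sigma>) (at t) 1"
  \<comment> \<open>The left side uses a chart that changes with \<open>t\<close>. The coordinate
    field of a fixed chart \<open>k\<close> expresses the same velocity through components that vary
    continuously.\<close>
  have vel: "((\<lambda>s. snd (pchart A (\<sigma> t)) (\<sigma> s)) has_vector_derivative coord_field A k (?v k t) (\<sigma> t)) (at t)"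
    if k: "k \<in> A" and t: "t \<in> I" "\<sigma> t \<in> fst k" for k t
  proof -
    define \<mu> where "\<mu> = pchart A (\<sigma> t)"
    have \<mu>: "\<mu> \<in> A" "\<sigma> t \<in> fst \<mu>" by (simp_all add: \<mu>_def pchart)
    have d: "((snd k \<circ> \<sigma>) has_derivative frechet_derivative (snd k \<circ> \<sigma>) (at t)) (at t)"
      by (rule smooth_on_has_derivative[OF sm[OF k] O[OF k]]) (use t in auto)
    have "frechet_derivative (snd k \<circ> \<sigma>) (at t) h = h *\<^sub>R ?v k t" for h
      using linear_scale[OF has_derivative_linear[OF d], of h 1] by simp
    then have "((snd k \<circ> \<sigma>) has_vector_derivative ?v k t) (at t)"
      unfolding has_vector_derivative_def by (intro has_derivative_eq_rhs[OF d] ext)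
    then have "((\<lambda>s. (snd \<mu> \<circ> chart_inv k) ((snd k \<circ> \<sigma>) s))
        has_vector_derivative trd k \<mu> (\<sigma> t) (?v k t)) (at t)"
      by (rule has_vector_derivative_compose[rotated])
          (use trd_has_derivative[OF k \<mu>(1) t(2) \<mu>(2)] in \<open>simp add: o_def\<close>)
    then have "((\<lambda>s. snd \<mu> (\<sigma> s)) has_vector_derivative trd k \<mu> (\<sigma> t) (?v k t)) (at t)"
      by (rule has_vector_derivative_transform_within_open[OF _ O[OF k]])
        (use t chart_inv_left[OF k] in auto)
    then show ?thesis by (simp add: coord_field_trd \<mu>_def)
  qed
  have lin: "linear (\<eta> p)" for p using \<eta> by (simp add: one_form_def)
  have "isCont (along \<eta> \<sigma>) t" if t: "t \<in> I" for t
  proof -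
    define k where "k = pchart A (\<sigma> t)"
    have k: "k \<in> A" "\<sigma> t \<in> fst k" by (simp_all add: k_def pchart)
    let ?O = "I \<inter> \<sigma> -` fst k"
    have expansion: "along \<eta> \<sigma> s = (\<Sum>b\<in>Basis. (?v k s \<bullet> b) * \<eta> (\<sigma> s) (coord_field A k b (\<sigma> s)))"
        if s: "s \<in> ?O" for s
    proof -
      have "along \<eta> \<sigma> s = \<eta> (\<sigma> s) (coord_field A k (?v k s) (\<sigma> s))"
        using vector_derivative_at[OF vel[OF k(1), of s]] s by (simp add: along_def)
      also have "\<dots> = (\<Sum>b\<in>Basis. (?v k s \<bullet> b) * \<eta> (\<sigma> s) (coord_field A k b (\<sigma> s)))"
        using linear_basis_expansion[OF linear_compose[OF linear_coord_field[OF k(1), of "\<sigma> s"]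
            lin[of "\<sigma> s"]], where v = "?v k s"] s
        by (simp add: o_def)
      finally show ?thesis .
    qed
    have "continuous_on ?O (\<lambda>s. \<Sum>b\<in>Basis. (?v k s \<bullet> b) * \<eta> (\<sigma> s) (coord_field A k b (\<sigma> s)))"
    proof (intro continuous_intros)
      show "continuous_on ?O (?v k)"
        by (rule smooth_on_continuous[OF smooth_on_derivative[OF sm[OF k(1)]]])
      fix b
      have "continuous_on (fst k) (\<lambda>p. \<eta> p (coord_field A k b p))"
        using \<eta> k(1) by (intro smooth_fun_continuous chart_open) (auto simp: one_form_def)
      then show "continuous_on ?O (\<lambda>s. \<eta> (\<sigma> s) (coord_field A k b (\<sigma> s)))"
        by (rule continuous_on_compose2[OF _ continuous_on_subset[OF cont]]) auto
    qed
    then have "continuous_on ?O (along \<eta> \<sigma>)"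
      by (rule continuous_on_eq) (rule expansion[symmetric])
    then show ?thesis
      using O[OF k(1)] t k(2) by (simp add: continuous_on_eq_continuous_at)
  qed
  then have "continuous_on {a..b} (along \<eta> \<sigma>)"
    using I(2) by (intro continuous_at_imp_continuous_on) auto
  from continuous_antiderivative[OF ab this]
  obtain Q where Q: "continuous_on {a..b} Q" "\<And>t. t \<in> {a<..<b} \<Longrightarrow> (Q
      has_real_derivative along \<eta> \<sigma> t) (at t)" by blast
  have "along \<eta> \<sigma> t = along \<eta> \<gamma> t" if t: "t \<in> {a<..<b}" for t
  proof -
    have \<gamma>t: "\<gamma> t = \<sigma> t" using eq t by simp
    have "t \<in> I" using t I(2) by auto
    note v = vel[OF pchart(1) this pchart(2)]
    have "((\<lambda>s. snd (pchart A (\<sigma> t)) (\<gamma> s)) has_vector_derivative coord_field A (pchart A (\<sigma> t)) (?v (pchart A (\<sigma> t)) t) (\<sigma> t)) (at t)"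
      by (rule has_vector_derivative_transform_within_open[OF v, where S = "{a<..<b}"]) (use eq t I in auto)
    then show ?thesis
      unfolding along_def \<gamma>t by (simp only: vector_derivative_at vector_derivative_at[OF v])
  qed
  then show ?thesis using Q by auto
qed

lemma (in smooth_manifold) along_antiderivative_parallel:
  assumes \<eta>: "one_form A \<eta>" and V: "parallel_along A D \<gamma> V"
  obtains P K where "finite K" "continuous_on {0..1} P"
    "\<And>t. t \<in> {0..1} - K \<Longrightarrow> (P has_real_derivative along \<eta> \<gamma> t) (at t)"
proof -
  obtain k \<tau> where \<tau>: "\<tau> 0 = 0" "\<tau> k = 1" and less: "\<And>i. i < k \<Longrightarrow> \<tau> i < \<tau> (Suc i)"
    and sm: "\<And>i. i < k \<Longrightarrow> smooth_curve_on A {\<tau> i..\<tau> (Suc i)} \<gamma>"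
    using V unfolding parallel_along_def by blast
  obtain P where P: "continuous_on {\<tau> 0..\<tau> k} P"
    "\<And>i t. i < k \<Longrightarrow> t \<in> {\<tau> i<..<\<tau> (Suc i)} \<Longrightarrow> (P has_real_derivative along \<eta> \<gamma> t) (at t)"
    using piecewise_antiderivative[where \<tau> = \<tau> and k = k and \<phi> = "along \<eta> \<gamma>", OF less
        along_antiderivative[OF \<eta> sm less]] by blast
  have "(P has_real_derivative along \<eta> \<gamma> t) (at t)" if "t \<in> {0..1} - \<tau> ` {..k}" for t
    using partition_interior[of t \<tau> k] P(2) that \<tau> by auto
  then show ?thesis
    using that[of "\<tau> ` {..k}" P] P(1) \<tau> by simp
qed

context weyl_structure
begin

text \<open>The factor is the exponential of the integral of \<open>\<eta>\<close> along the loop, so it does not depend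
  on the recurrent form.\<close>

lemma holonomy_scaling:
  assumes \<eta>: "one_form A \<eta>" and T: "T \<in> restricted_holonomy A D p"
  shows "\<exists>l>0. \<forall>b v w. recurrent b \<eta> \<longrightarrow> b p (T v) (T w) = l * b p v w"
proof -
  obtain \<gamma> where h: "homotopic_paths UNIV \<gamma> (\<lambda>_. p)" and pt: "parallel_transport A D \<gamma> T"
    using T unfolding restricted_holonomy_def by blast
  have ends: "\<gamma> 0 = p" "\<gamma> 1 = p"
    using homotopic_paths_imp_pathstart[OF h] homotopic_paths_imp_pathfinish[OF h] by
        (simp_all add: pathstart_def pathfinish_def)
  obtain V where V: "\<And>v. parallel_along A D \<gamma> (V v)" "\<And>v. V v 0 = v" "\<And>v. V v 1 = T v"
    using pt unfolding parallel_transport_def by metis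
  \<comment> \<open>Only the partition into smooth pieces is read off from the parallel field, so
    the one starting at the zero vector serves; \<open>P\<close> is thereby fixed before
    \<open>b\<close>, \<open>v\<close> and \<open>w\<close>.\<close>
  obtain P K0 where P: "finite K0" "continuous_on {0..1} P"
    "\<And>t. t \<in> {0..1} - K0 \<Longrightarrow> (P has_real_derivative along \<eta> \<gamma> t) (at t)"
    using along_antiderivative_parallel[OF \<eta> V(1)[of 0]] by metis
  have "b p (T v) (T w) = exp (P 1 - P 0) * b p v w" if b: "recurrent b \<eta>" for b v w
  proof -
    have bb: "bilinear_field b" using b by (simp add: recurrent_def)
    obtain K1 where K1: "finite K1" "\<And>t. t \<in> {0..1} - K1 \<Longrightarrow> at t within {0..1} = at t"
      "\<And>t. t \<in> {0..1} - K1 \<Longrightarrow> parallel_at A D \<gamma> (V v) {0..1} t"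
      "\<And>t. t \<in> {0..1} \<Longrightarrow> continuous (at t within {0..1}) \<gamma>"
      "\<And>t. t \<in> {0..1} \<Longrightarrow> ((\<lambda>s. dchart A (pchart A (\<gamma> t)) (\<gamma> s) (V v s)) \<longlongrightarrow> V v t) (at t within {0..1})"
      using parallel_along_pieces[OF V(1)[of v]] by blast
    obtain K2 where K2: "finite K2" "\<And>t. t \<in> {0..1} - K2 \<Longrightarrow> at t within {0..1} = at t"
      "\<And>t. t \<in> {0..1} - K2 \<Longrightarrow> parallel_at A D \<gamma> (V w) {0..1} t"
      "\<And>t. t \<in> {0..1} \<Longrightarrow> continuous (at t within {0..1}) \<gamma>"
      "\<And>t. t \<in> {0..1} \<Longrightarrow> ((\<lambda>s. dchart A (pchart A (\<gamma> t)) (\<gamma> s) (V w s)) \<longlongrightarrow> V w t) (at t within {0..1})"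
      using parallel_along_pieces[OF V(1)[of w]] by blast
    define f where "f t = b (\<gamma> t) (V v t) (V w t)" for t
    have f: "continuous_on {0..1} f"
      unfolding continuous_on_def f_def using tendsto_bilinear_field[OF bb K1(4,5) K2(5)] by blast
    \<comment> \<open>The integrating factor for f' = \<eta>(\<gamma>') f: the product is continuous
      with zero derivative off a finite set, hence constant.\<close>
    define E where "E t = f t * exp (- P t)" for t
    have "E 1 = E 0"
    proof (rule has_derivative_zero_unique_strong_interval[where f = E and x = 1 and k = "K0 \<union> K1 \<union> K2"
        and a = 0 and b = 1])
      show "continuous_on {0..1} E"
        unfolding E_def by (intro continuous_intros f P(2))
      fix t assume t: "t \<in> {0..1} - (K0 \<union> K1 \<union> K2)"
      have at: "at t within {0..1} = at t" using K1(2) t by blast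
      have pv: "parallel_at A D \<gamma> (V v) {0..1} t" and pw: "parallel_at A D \<gamma> (V w) {0..1} t"
        using K1(3) K2(3) t by blast+
      obtain u where u: "has_velocity A \<gamma> u t {0..1}" using pv unfolding parallel_at_def by blast
      have "vector_derivative (\<lambda>s. snd (pchart A (\<gamma> t)) (\<gamma> s)) (at t) = u"
        by (rule vector_derivative_at) (use u in \<open>simp add: has_velocity_def at\<close>)
      then have along: "along \<eta> \<gamma> t = \<eta> (\<gamma> t) u" by (simp add: along_def)
      have f': "(f has_real_derivative \<eta> (\<gamma> t) u * f t) (at t)"
        using recurrent_symbols[OF b pv pw _ u] t by (simp add: at f_def[abs_def])
      have "(P has_real_derivative \<eta> (\<gamma> t) u) (at t)"
        using P(3)[of t] t along by simp
      then have "(E has_real_derivative 0) (at t)"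
        unfolding E_def using f' by (auto intro!: derivative_eq_intros)
      then show "(E has_derivative (\<lambda>h. 0)) (at t within {0..1})"
        unfolding at has_field_derivative_def by (rule has_derivative_eq_rhs) auto
    qed (use P(1) K1(1) K2(1) in auto)
    then have "f 1 = exp (P 1 - P 0) * f 0"
      by (simp add: E_def exp_minus exp_diff field_simps)
    then show ?thesis
      by (simp add: f_def V(2,3) ends)
  qed
  then show ?thesis by (intro exI[of _ "exp (P 1 - P 0)"]) simp
qed

end

context smooth_manifold
begin

section \<open>Pullback of tensor fields\<close>

definition pull2 :: "('m \<Rightarrow> 'm) \<Rightarrow> ('m \<Rightarrow> 'e \<Rightarrow> 'e \<Rightarrow> real) \<Rightarrow> 'm \<Rightarrow> 'e \<Rightarrow> 'e \<Rightarrow> real" where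
  "pull2 F b p u v = b (F p) (dmap A F p u) (dmap A F p v)"

definition pull1 :: "('m \<Rightarrow> 'm) \<Rightarrow> ('m \<Rightarrow> 'e \<Rightarrow> real) \<Rightarrow> 'm \<Rightarrow> 'e \<Rightarrow> real" where
  "pull1 F \<eta> p v = \<eta> (F p) (dmap A F p v)"

definition pull_endo :: "('m \<Rightarrow> 'm) \<Rightarrow> ('m \<Rightarrow> 'e \<Rightarrow> 'e) \<Rightarrow> 'm \<Rightarrow> 'e \<Rightarrow> 'e" where
  "pull_endo F I p v = dmap A (inv F) (F p) (I (F p) (dmap A F p v))"

lemma pull2_pushforward:
  "diffeo A F \<Longrightarrow> pull2 F b p (X p) (Y p) = b (F p) (pushforward A F X (F p)) (pushforward A F Y (F p))"
  by (simp add: pull2_def pushforward_app)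

lemma diffeo_image:
  assumes "diffeo A F" "open W"
  shows "open (F ` W)" "F -` F ` W = W"
proof -
  have "F ` W = inv F -` W"
    using assms by (simp add: diffeo_def bij_vimage_eq_inv_image bij_imp_bij_inv inv_inv_eq)
  then show "open (F ` W)"
    using assms smooth_map_vimage_open[of "inv F" W] by (simp add: diffeo_def)
  show "F -` F ` W = W"
    using assms by (simp add: diffeo_def bij_is_inj inj_vimage_image_eq)
qed

lemma bilinear_pull2:
  assumes "smooth_map A F" "bilinear (b (F p))"
  shows "bilinear (pull2 F b p)"
proof -
  have "linear (\<lambda>v. b (F p) u (dmap A F p v))" "linear (\<lambda>v. b (F p) (dmap A F p v) u)" for u
    using linear_compose[OF linear_dmap[OF assms(1), of p], of "b (F p) u"]
      linear_compose[OF linear_dmap[OF assms(1), of p], of "\<lambda>v. b (F p) v u"] assms(2)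
    by (simp_all add: bilinear_def o_def)
  then show ?thesis by (simp add: bilinear_def pull2_def[abs_def])
qed

lemma bilinear_field_pull2:
  assumes F: "diffeo A F" and b: "bilinear_field b"
  shows "bilinear_field (pull2 F b)"
proof (rule bilinear_fieldI)
  show "bilinear (pull2 F b p)" for p
    using F b by (intro bilinear_pull2) (simp_all add: diffeo_def bilinear_field_def)
  fix W X Y assume W: "open W" and X: "smooth_field_on A W X" and Y: "smooth_field_on A W Y"
  have "smooth_fun_on A (F ` W) (\<lambda>q. b q (pushforward A F X q) (pushforward A F Y q))"
    by (rule smooth_bilinear_field[OF b diffeo_image(1)[OF F W] smooth_pushforward[OF F W X]
        smooth_pushforward[OF F W Y]])
  from smooth_fun_comp_map[OF _ diffeo_image(1)[OF F W] this, of F]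
  show "smooth_fun_on A W (\<lambda>p. pull2 F b p (X p) (Y p))"
    using F unfolding diffeo_image(2)[OF F W] pull2_pushforward[OF F] by (simp add: diffeo_def)
qed

lemma one_form_pull1:
  assumes F: "diffeo A F" and \<eta>: "one_form A \<eta>"
  shows "one_form A (pull1 F \<eta>)"
proof (rule one_formI)
  have sF: "smooth_map A F" using F by (simp add: diffeo_def)
  show "linear (pull1 F \<eta> p)" for p
    using linear_compose[OF linear_dmap[OF sF, of p], of "\<eta> (F p)"] \<eta> by
        (simp add: one_form_def pull1_def[abs_def] o_def)
  fix W X assume W: "open W" and X: "smooth_field_on A W X"
  have "smooth_fun_on A (F ` W) (\<lambda>q. \<eta> q (pushforward A F X q))"
    by (rule smooth_one_form[OF \<eta> diffeo_image(1)[OF F W] smooth_pushforward[OF F W X]])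
  from smooth_fun_comp_map[OF sF diffeo_image(1)[OF F W] this]
  show "smooth_fun_on A W (\<lambda>p. pull1 F \<eta> p (X p))"
    unfolding diffeo_image(2)[OF F W] pull1_def pushforward_app[OF F] .
qed

text \<open>The pullback sends a field forward by \<open>F\<close>, applies \<open>I\<close> and
  sends it back by the inverse; each of the three operations preserves smoothness.\<close>

lemma endo_field_pull_endo:
  assumes F: "diffeo A F" and I: "endo_field A I"
  shows "endo_field A (pull_endo F I)"
proof (rule endo_fieldI)
  have sF: "smooth_map A F" and sG: "smooth_map A (inv F)" using F by (simp_all add: diffeo_def)
  show "linear (pull_endo F I p)" for p
    using linear_compose[OF linear_compose[OF linear_dmap[OF sF, of p], of "I (F p)"] linear_dmap[OF sG,
        of "F p"]] I
    by (simp add: endo_field_def pull_endo_def[abs_def] o_def)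
  fix W X assume W: "open W" and X: "smooth_field_on A W X"
  have "smooth_field_on A (F ` W) (\<lambda>q. I q (pushforward A F X q))"
    by (rule smooth_endo_field[OF I diffeo_image(1)[OF F W] smooth_pushforward[OF F W X]])
  note sm = smooth_pushforward[OF diffeo_inv[OF F] diffeo_image(1)[OF F W] this]
  have "(\<lambda>p. pull_endo F I p (X p)) = pushforward A (inv F) (\<lambda>q. I q (pushforward A F X q))"
    by (rule ext) (simp add: pushforward_def pull_endo_def diffeo_inv_simps[OF F])
  then show "smooth_field_on A W (\<lambda>p. pull_endo F I p (X p))"
    using sm by (simp add: diffeo_inv_simps[OF F] image_image)
qed

lemma dfun_pull2:
  assumes F: "diffeo A F" and b: "bilinear_field b" and X: "vector_field A X" and Y: "vector_field A Y"
  shows "dfun A (\<lambda>q. pull2 F b q (X q) (Y q)) p v =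
    dfun A (\<lambda>q. b q (pushforward A F X q) (pushforward A F Y q)) (F p) (dmap A F p v)"
  unfolding pull2_pushforward[OF F]
  by (rule dfun_comp_map[OF _ open_UNIV smooth_bilinear_field[OF b open_UNIV]])
    (use F vector_field_pushforward[OF F] X Y in \<open>auto simp: diffeo_def\<close>)

text \<open>The exterior derivative commutes with pullback because both ingredients of its formula,
  derivatives of functions and Lie brackets, are natural.\<close>

lemma ext_deriv2_pull2:
  assumes F: "diffeo A F" and b: "bilinear_field b"
    and v: "vector_field A X" "vector_field A Y" "vector_field A Z"
  shows "ext_deriv2 A (pull2 F b) X Y Z p =
    ext_deriv2 A b (pushforward A F X) (pushforward A F Y) (pushforward A F Z) (F p)"
  unfolding ext_deriv2_def dfun_pull2[OF F b v(1,2)] dfun_pull2[OF F b v(1,3)] dfun_pull2[OF F b v(2,3)]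
    lie_bracket_pushforward[OF F v(1,2)] lie_bracket_pushforward[OF F v(1,3)]
        lie_bracket_pushforward[OF F v(2,3)]
  by (simp add: pull2_def pushforward_app[OF F])

lemma dmap_inj:
  assumes "diffeo A F" "dmap A F p u = dmap A F p v"
  shows "u = v"
  using assms dmap_inv_left by metis

lemma pushforward_eqI:
  assumes "diffeo A F" "\<And>p. dmap A F p (X p) = Z (F p)"
  shows "pushforward A F X = Z"
proof
  fix q
  show "pushforward A F X q = Z q"
    using assms(2)[of "inv F q"] diffeo_inv_simps[OF assms(1)] by (simp add: pushforward_def)
qed

end

section \<open>Automorphisms are affine\<close>

context lck_structure
begin

lemma fundamental_field: "bilinear_field (fundamental_form J g)"
proof (rule bilinear_fieldI)
  show "bilinear (fundamental_form J g p)" for p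
    by (auto simp: bilinear_def fundamental_form_def g_simps J_simps intro!: linearI)
  show "smooth_fun_on A W (\<lambda>p. fundamental_form J g p (X p) (Y p))"
    if "open W" "smooth_field_on A W X" "smooth_field_on A W Y" for W X Y
    unfolding fundamental_form_def
    by (rule smooth_bilinear_field[OF g_field that(1) smooth_endo_field[OF J_field that(1,2)] that(3)])
qed

text \<open>Evaluating on \<open>v\<close>, \<open>Jv\<close> with \<open>v\<close> orthogonal to \<open>u\<close> and \<open>Ju\<close> isolates \<open>\<alpha> u\<close>.\<close>

lemma wedge_fundamental_injective:
  assumes dim: "DIM('e) > 2"
    and \<alpha>: "\<And>u v w. wedge12 \<alpha> (fundamental_form J g) p u v w = 0"
  shows "\<alpha> p u = 0"
proof -
  \<comment> \<open>Two linear conditions on a vector in more than two dimensions have a nonzero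
    common solution.\<close>
  define L where "L v = (g p u v, g p (J p u) v)" for v
  have lin: "linear L"
    by (rule linearI) (simp_all add: L_def g_simps)
  have "\<not> inj L"
  proof
    assume "inj L"
    then have "dim (range L) = dim (UNIV :: 'e set)"
      using dim_image_eq[OF lin, of UNIV] by simp
    moreover have "dim (range L) \<le> DIM(real \<times> real)"
      by (rule dim_subset_UNIV)
    ultimately show False using dim by simp
  qed
  then obtain v where v: "v \<noteq> 0" "L v = 0"
    using linear_injective_0[OF lin] by blast
  have o: "g p u v = 0" "g p (J p u) v = 0"
    using v(2) by (simp_all add: L_def zero_prod_def)
  have "\<alpha> p u * g p (J p v) (J p v) + \<alpha> p v * g p (J p (J p v)) u + \<alpha> p (J p v) * g p (J p u) v = 0"
    using \<alpha>[of u v "J p v"] by (simp add: wedge12_def fundamental_form_def)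
  then have "\<alpha> p u * g p v v = 0"
    using o g_sym[of p v u] by (simp add: JJ g_simps hermitian)
  then show ?thesis
    using g_pos[OF v(1), of p] by simp
qed

lemma dfun_exp_mult:
  assumes f: "smooth_fun_on A UNIV f" and b: "bilinear_field b" and Y: "vector_field A Y"
      and Z: "vector_field A Z"
  shows "dfun A (\<lambda>q. exp (f q) * b q (Y q) (Z q)) p v =
    exp (f p) * (dfun A f p v * b p (Y p) (Z p) + dfun A (\<lambda>q. b q (Y q) (Z q)) p v)"
proof -
  have "smooth_fun_on A UNIV (\<lambda>q. exp (f q))"
    by (rule smooth_fun_compose[OF open_UNIV open_UNIV smooth_on_exp f]) simp
  from dfun_mult[OF open_UNIV this smooth_bilinear_field[OF b open_UNIV Y Z] UNIV_I, of p]
  show ?thesis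
    by (simp add: dfun_exp[OF open_UNIV f UNIV_I] algebra_simps)
qed

text \<open>The exterior derivative of \<open>F\<^sup>*\<omega>\<close> is computed twice: by
  naturality from the Lee equation, and as that of exp(f) \<omega>. Dividing by exp(f) and
  cancelling the wedge product with \<omega> leaves the one-forms.\<close>

lemma lee_form_pullback:
  assumes dim: "DIM('e) > 2" and F: "diffeo A F" and f: "smooth_fun_on A UNIV f"
    and hol: "\<And>p v. dmap A F p (J p v) = J (F p) (dmap A F p v)"
    and conf: "\<And>p u v. pull2 F g p u v = exp (f p) * g p u v"
  shows "pull1 F \<theta> p u = \<theta> p u + dfun A f p u"
proof -
  let ?\<omega> = "fundamental_form J g"
  have \<omega>: "pull2 F ?\<omega> p u v = exp (f p) * ?\<omega> p u v" for p u v
    using conf[of p "J p u" v] by (simp add: pull2_def fundamental_form_def hol)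
  define \<alpha> where "\<alpha> p u = pull1 F \<theta> p u - \<theta> p u - dfun A f p u" for p u
  have "wedge12 \<alpha> ?\<omega> p u v w = 0" for u v w
  proof -
    obtain X where X: "vector_field A X" "X p = u" using field_through by blast
    obtain Y where Y: "vector_field A Y" "Y p = v" using field_through by blast
    obtain Z where Z: "vector_field A Z" "Z p = w" using field_through by blast
    note vf = X(1) Y(1) Z(1)
    have "ext_deriv2 A (pull2 F ?\<omega>) X Y Z p = wedge12 \<theta> ?\<omega> (F p) (dmap A F p u) (dmap A F p v) (dmap A F p w)"
      unfolding ext_deriv2_pull2[OF F fundamental_field vf]
      using lee_eq[OF vector_field_pushforward[OF F X(1)] vector_field_pushforward[OF F Y(1)]
          vector_field_pushforward[OF F Z(1)], of "F p"]
      by (simp add: pushforward_app[OF F] X(2) Y(2) Z(2))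
    also have "\<dots> = wedge12 (pull1 F \<theta>) (pull2 F ?\<omega>) p u v w"
      by (simp add: wedge12_def pull1_def pull2_def)
    also have "\<dots> = exp (f p) * wedge12 (pull1 F \<theta>) ?\<omega> p u v w"
      unfolding wedge12_def \<omega> by (simp add: algebra_simps)
    finally have e1: "ext_deriv2 A (pull2 F ?\<omega>) X Y Z p = exp (f p) * wedge12 (pull1 F \<theta>) ?\<omega> p u v w" .
    \<comment> \<open>\<open>ext_deriv2\<close> evaluates the form at the first and third argument,
      \<open>wedge12\<close> at the third and first; this accounts for the different signs of their
      middle terms.\<close>
    have cyc: "?\<omega> p u w = - ?\<omega> p w u"
      unfolding fundamental_form_def by (rule g_J_skew)
    have "ext_deriv2 A (pull2 F ?\<omega>) X Y Z p = exp (f p) * (wedge12 (dfun A f) ?\<omega> p u v w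
        + ext_deriv2 A ?\<omega> X Y Z p)"
      unfolding ext_deriv2_def wedge12_def \<omega> dfun_exp_mult[OF f fundamental_field vf(1,2)]
        dfun_exp_mult[OF f fundamental_field vf(1,3)] dfun_exp_mult[OF f fundamental_field vf(2,3)]
      using cyc by (simp add: X(2) Y(2) Z(2) algebra_simps)
    also have "ext_deriv2 A ?\<omega> X Y Z p = wedge12 \<theta> ?\<omega> p u v w"
      using lee_eq[OF vf, of p] by (simp add: X(2) Y(2) Z(2))
    finally have "exp (f p) * wedge12 (pull1 F \<theta>) ?\<omega> p u v w = exp (f p) * (wedge12 (dfun A f) ?\<omega> p u v w
        + wedge12 \<theta> ?\<omega> p u v w)"
      using e1 by simp
    then have "wedge12 (pull1 F \<theta>) ?\<omega> p u v w = wedge12 (dfun A f) ?\<omega> p u v w + wedge12 \<theta> ?\<omega> p u v w"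
      by simp
    then show ?thesis
      by (simp add: wedge12_def \<alpha>_def algebra_simps)
  qed
  from wedge_fundamental_injective[OF dim this, of u] show ?thesis
    by (simp add: \<alpha>_def)
qed

lemma automorphism_affine:
  assumes dim: "DIM('e) > 2" and F: "F \<in> aut_group A (conformal_class A g) J"
  shows "F \<in> aff_group A D"
proof -
  have dF: "diffeo A F" and hol: "\<And>p v. dmap A F p (J p v) = J (F p) (dmap A F p v)"
    and cm: "conformal_map A (conformal_class A g) F"
    using F by (auto simp: aut_group_def biholomorphic_def)
  have "g \<in> conformal_class A g"
    unfolding conformal_class_def using smooth_fun_const[of UNIV 0] by force
  then have "pull2 F g \<in> conformal_class A g"
    using cm unfolding conformal_map_def pull2_def[abs_def] by blast
  then obtain f where f: "smooth_fun_on A UNIV f" and conf: "\<And>p u v. pull2 F g p u v = exp (f p) * g p u v"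
    unfolding conformal_class_def by auto
  note \<theta>' = lee_form_pullback[OF dim dF f hol conf]
  have sF: "smooth_map A F" and sG: "smooth_map A (inv F)" using dF by (simp_all add: diffeo_def)
  \<comment> \<open>The pulled back connection; \<open>F\<close> is affine if and only if it agrees
    with \<open>D\<close> on global fields.\<close>
  define D' where "D' Y p v = dmap A (inv F) (F p) (D (pushforward A F Y) (F p) (dmap A F p v))" for Y p v
  have D': "dmap A F p (D' Y p v) = D (pushforward A F Y) (F p) (dmap A F p v)" for Y p v
    by (simp add: D'_def dmap_inv_right[OF dF])
  have zero: "D' Y p (X p) = D Y p (X p)" if X: "vector_field A X" and Y: "vector_field A Y" for X Y p
  proof -
    \<comment> \<open>The difference of the connections, lowered by \<open>g\<close>. Equal torsion
      makes it symmetric in \<open>X\<close>, \<open>Y\<close>; the common derivative of the form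
      exp(f) g makes it skew in \<open>Y\<close>, \<open>Z\<close>.\<close>
    define s where "s X Y Z = g p (D' Y p (X p) - D Y p (X p)) (Z p)" for X Y Z
    have "s X Y Z = 0" if Z: "vector_field A Z" for Z
    proof (rule symmetric_skew_zero[where V = "Collect (vector_field A)"])
      fix X Y Z assume "X \<in> Collect (vector_field A)" "Y \<in> Collect (vector_field A)"
          "Z \<in> Collect (vector_field A)"
      then have v: "vector_field A X" "vector_field A Y" "vector_field A Z" by auto
      have "dmap A F p (D' Y p (X p) - D' X p (Y p)) = dmap A F p (lie_bracket A X Y p)"
        using torsion_free[OF vector_field_pushforward[OF dF v(1)] vector_field_pushforward[OF dF v(2)],
            of "F p"]
        by (simp add: linear_diff[OF linear_dmap[OF sF]] D' pushforward_app[OF dF]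
            lie_bracket_pushforward[OF dF v(1,2)])
      then have "D' Y p (X p) - D' X p (Y p) = D Y p (X p) - D X p (Y p)"
        using dmap_inj[OF dF] torsion_free[OF v(1,2)] by metis
      then have "D' Y p (X p) - D Y p (X p) = D' X p (Y p) - D X p (Y p)"
        by (simp add: algebra_simps)
      then show "s X Y Z = s Y X Z"
        unfolding s_def by simp
      let ?v = "X p"
      have "dfun A (\<lambda>q. pull2 F g q (Y q) (Z q)) p ?v =
          pull2 F g p (D' Y p ?v) (Z p) + pull2 F g p (Y p) (D' Z p ?v) + pull1 F \<theta> p ?v * pull2 F g p (Y
              p) (Z p)"
        unfolding dfun_pull2[OF dF g_field v(2,3)]
          compatible[OF vector_field_pushforward[OF dF v(2)] vector_field_pushforward[OF dF v(3)]]
        by (simp add: pull2_def pull1_def D' pushforward_app[OF dF])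
      moreover have "dfun A (\<lambda>q. pull2 F g q (Y q) (Z q)) p ?v =
          exp (f p) * (dfun A f p ?v * g p (Y p) (Z p) + (g p (D Y p ?v) (Z p) + g p (Y p) (D Z p ?v) + \<theta>
              p ?v * g p (Y p) (Z p)))"
        unfolding conf dfun_exp_mult[OF f g_field v(2,3)] compatible[OF v(2,3)] ..
      ultimately have "exp (f p) * (g p (D' Y p ?v) (Z p) + g p (Y p) (D' Z p ?v)) =
          exp (f p) * (g p (D Y p ?v) (Z p) + g p (Y p) (D Z p ?v))"
        by (simp add: conf \<theta>' algebra_simps)
      then have "g p (D' Y p ?v) (Z p) + g p (Y p) (D' Z p ?v) = g p (D Y p ?v) (Z p)
          + g p (Y p) (D Z p ?v)"
        by simp
      then show "s X Y Z = - s X Z Y"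
        using g_sym[of p "Y p" "D' Z p ?v"] g_sym[of p "Y p" "D Z p ?v"] by (simp add: s_def g_simps)
    qed (use X Y Z in auto)
    moreover obtain Z where "vector_field A Z" "Z p = D' Y p (X p) - D Y p (X p)"
      using field_through by blast
    ultimately have "g p (D' Y p (X p) - D Y p (X p)) (D' Y p (X p) - D Y p (X p)) = 0"
      unfolding s_def by metis
    then show ?thesis
      using g_zero by fastforce
  qed
  have "dmap A F p (D Y p v) = D (pushforward A F Y) (F p) (dmap A F p v)" if Y: "vector_field A Y"
      for Y p v
  proof -
    obtain X where X: "vector_field A X" "X p = v" using field_through by blast
    then show ?thesis using zero[OF X(1) Y, of p] D'[of p Y v] by simp
  qed
  then show ?thesis
    using dF by (simp add: aff_group_def)
qed

end

context weyl_structure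
begin

section \<open>Affine maps are conformal\<close>

text \<open>The recurrence one-form is pulled back too. Hence \<open>F\<^sup>*g\<close> and
  \<open>g\<close> start out with possibly different one-forms, and a loop may scale them by
  different factors.\<close>

lemma recurrent_pull2:
  assumes F: "F \<in> aff_group A D" and b: "recurrent b \<eta>"
  shows "recurrent (pull2 F b) (pull1 F \<eta>)"
proof -
  have dF: "diffeo A F" and aff: "\<And>Y p v. vector_field A Y \<Longrightarrow>
      dmap A F p (D Y p v) = D (pushforward A F Y) (F p) (dmap A F p v)"
    using F by (auto simp: aff_group_def)
  have bb: "bilinear_field b" and \<eta>: "one_form A \<eta>"
      and rec: "\<And>Y Z p v. vector_field A Y \<Longrightarrow> vector_field A Z \<Longrightarrow>
    dfun A (\<lambda>q. b q (Y q) (Z q)) p v = b p (D Y p v) (Z p) + b p (Y p) (D Z p v) + \<eta> p v * b p (Y p) (Z p)"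
    using b by (auto simp: recurrent_def)
  have "dfun A (\<lambda>q. pull2 F b q (Y q) (Z q)) p v =
      pull2 F b p (D Y p v) (Z p) + pull2 F b p (Y p) (D Z p v) + pull1 F \<eta> p v * pull2 F b p (Y p) (Z p)"
    if "vector_field A Y" "vector_field A Z" for Y Z p v
    unfolding dfun_pull2[OF dF bb that] rec[OF vector_field_pushforward[OF dF that(1)]
        vector_field_pushforward[OF dF that(2)]]
    by (simp add: pull2_def pull1_def aff that pushforward_app[OF dF])
  then show ?thesis
    using bilinear_field_pull2[OF dF bb] one_form_pull1[OF dF \<eta>] by (simp add: recurrent_def)
qed

text \<open>On a chart \<open>\<mu>\<close> is the quotient of \<open>b\<close> and \<open>g\<close>
  evaluated on a coordinate field without zeros.\<close>

lemma smooth_factor: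
  assumes b: "bilinear_field b" and \<mu>: "\<And>p v w. b p v w = \<mu> p * g p v w"
  shows "smooth_fun_on A UNIV \<mu>"
proof (rule smooth_fun_on_charts[OF open_UNIV])
  fix k assume k: "k \<in> A"
  obtain i :: 'e where i: "i \<in> Basis" using nonempty_Basis by blast
  let ?X = "coord_field A k i"
  have X: "smooth_field_on A (fst k) ?X" by (rule smooth_coord_field[OF k])
  have pos: "g p (?X p) (?X p) > 0" if p: "p \<in> fst k" for p
  proof (rule g_pos)
    show "?X p \<noteq> 0"
      using dchart_coord_field[OF k p, of i] linear_0[OF linear_dchart[OF k p]] i by (metis nonzero_Basis)
  qed
  have "smooth_fun_on A (fst k) (\<lambda>p. inverse (g p (?X p) (?X p)))"
    by (rule smooth_fun_compose[OF chart_open[OF k] _ smooth_on_inverse smooth_bilinear_field[OF g_field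
        chart_open[OF k] X X]])
      (use pos in \<open>force simp: open_Collect_neq\<close>)+
  then have "smooth_fun_on A (fst k) (\<lambda>p. b p (?X p) (?X p) * inverse (g p (?X p) (?X p)))"
    by (intro smooth_fun_mult[OF chart_open[OF k]] smooth_bilinear_field[OF b chart_open[OF k] X X])
  then have "smooth_fun_on A (fst k) \<mu>"
    by (rule smooth_fun_on_eq[OF chart_open[OF k], rotated]) (use pos \<mu> in force)
  then show "smooth_fun_on A (UNIV \<inter> fst k) \<mu>" by simp
qed

end

locale irreducible_weyl = weyl_structure A g \<theta> D
  for A :: "('m::{t2_space,second_countable_topology}, 'e::euclidean_space) chart set" and g \<theta> D +
  assumes irreducible: "acts_irreducibly (restricted_holonomy A D p)"
begin

text \<open>Here \<open>b\<close> shares the one-form of \<open>g\<close>, so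
  \<open>holonomy_scaling\<close> gives both forms the same factor at once and \<open>b\<close> may
  be indefinite.\<close>

lemma recurrent_proportional:
  assumes b: "recurrent b \<theta>" and sym: "\<And>p u v. b p u v = b p v u"
  obtains \<mu> where "\<And>v w. b p v w = \<mu> * g p v w"
proof -
  have bil: "bilinear (b p)" using b by (simp add: recurrent_def bilinear_field_def)
  have H: "\<exists>l. \<forall>v w. g p (T v) (T w) = l * g p v w \<and> b p (T v) (T w) = l * b p v w"
    if T: "T \<in> restricted_holonomy A D p" for T
  proof -
    obtain l where l: "\<forall>b v w. recurrent b \<theta> \<longrightarrow> b p (T v) (T w) = l * b p v w"
      using holonomy_scaling[OF lee T] by blast
    show ?thesis
      by (intro exI[of _ l] allI conjI; rule l[rule_format]) (fact recurrent_metric b)+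
  qed
  show ?thesis
    by (rule irreducible_similarities_scalar[where g = "g p" and b = "b p", OF bilinear_g g_sym _ bil sym
        irreducible H])
      (use g_pos that in blast)+
qed

text \<open>Here the one-forms may differ and positivity of \<open>b\<close> takes over:
  \<open>similarity_factor_le\<close>, used in both directions, equates the factors.\<close>

lemma recurrent_metric_proportional:
  assumes b: "recurrent b \<eta>" and sym: "\<And>p u v. b p u v = b p v u" and pos: "\<And>p u. u \<noteq> 0 \<Longrightarrow> b p u u > 0"
  obtains \<mu> where "\<And>v w. b p v w = \<mu> * g p v w"
proof -
  have bil: "bilinear (b p)" and \<eta>: "one_form A \<eta>" using b by (auto simp: recurrent_def bilinear_field_def)
  have H: "\<exists>l. \<forall>v w. g p (T v) (T w) = l * g p v w \<and> b p (T v) (T w) = l * b p v w"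
    if T: "T \<in> restricted_holonomy A D p" for T
  proof -
    obtain l where l: "l > 0" "\<And>v w. g p (T v) (T w) = l * g p v w"
      using holonomy_scaling[OF lee T] recurrent_metric by auto
    obtain m where m: "m > 0" "\<And>v w. b p (T v) (T w) = m * b p v w"
      using holonomy_scaling[OF \<eta> T] b by auto
    have "m \<le> l" by (rule similarity_factor_le[where g = "g p" and b = "b p", OF bilinear_g g_pos bil pos
        l(2) m(2) l(1)])
    moreover have "l \<le> m" by (rule similarity_factor_le[where g = "b p" and b = "g p", OF bil pos
        bilinear_g g_pos m(2) l(2) m(1)])
    ultimately show ?thesis
      using l(2) m(2) by auto
  qed
  show ?thesis
    by (rule irreducible_similarities_scalar[where g = "g p" and b = "b p", OF bilinear_g g_sym _ bil sym
        irreducible H])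
      (use g_pos that in blast)+
qed

lemma affine_conformal:
  assumes F: "F \<in> aff_group A D"
  obtains f where "smooth_fun_on A UNIV f" "\<And>p u v. pull2 F g p u v = exp (f p) * g p u v"
proof -
  have dF: "diffeo A F" using F by (simp add: aff_group_def)
  then have sF: "smooth_map A F" by (simp add: diffeo_def)
  note rec = recurrent_pull2[OF F recurrent_metric]
  have pos: "pull2 F g p u u > 0" if "u \<noteq> 0" for p u
  proof -
    have "dmap A F p u \<noteq> 0"
      using dmap_inj[OF dF, of p u 0] linear_0[OF linear_dmap[OF sF]] that by metis
    then show ?thesis unfolding pull2_def by (rule g_pos)
  qed
  have "\<exists>\<mu>. \<forall>v w. pull2 F g p v w = \<mu> * g p v w" for p
    using recurrent_metric_proportional[OF rec _ pos, of p] g_sym unfolding pull2_def by metis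
  then obtain \<mu> where \<mu>: "\<And>p v w. pull2 F g p v w = \<mu> p * g p v w" by metis
  have \<mu>0: "\<mu> p > 0" for p
  proof -
    obtain i :: 'e where "i \<in> Basis" using nonempty_Basis by blast
    then have "i \<noteq> 0" by auto
    then show ?thesis using pos[of i p] g_pos[of i p] \<mu>[of p i i] by (simp add: zero_less_mult_iff)
  qed
  have sm: "smooth_fun_on A UNIV \<mu>"
    by (rule smooth_factor[OF _ \<mu>]) (use rec in \<open>simp add: recurrent_def\<close>)
  have "smooth_fun_on A UNIV (\<lambda>p. ln (\<mu> p))"
    by (rule smooth_fun_compose[OF open_UNIV open_greaterThan smooth_on_ln sm]) (simp add: \<mu>0)
  then show ?thesis
    using that[of "\<lambda>p. ln (\<mu> p)"] \<mu> \<mu>0 by simp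
qed

lemma affine_conformal_map:
  assumes F: "F \<in> aff_group A D"
  shows "conformal_map A (conformal_class A g) F"
  unfolding conformal_map_def
proof
  have sF: "smooth_map A F" using F by (simp add: aff_group_def diffeo_def)
  obtain f where f: "smooth_fun_on A UNIV f" "\<And>p u v. pull2 F g p u v = exp (f p) * g p u v"
    using affine_conformal[OF F] by metis
  fix h assume "h \<in> conformal_class A g"
  then obtain k where k: "smooth_fun_on A UNIV k" "h = (\<lambda>p u v. exp (k p) * g p u v)"
    unfolding conformal_class_def by blast
  have "smooth_fun_on A UNIV (\<lambda>p. k (F p) + f p)"
    using smooth_fun_comp_map[OF sF open_UNIV k(1)] f(1) by (intro smooth_fun_add) auto
  moreover have "(\<lambda>p u v. h (F p) (dmap A F p u) (dmap A F p v)) = (\<lambda>p u v. exp (k (F p) + f p) * g p u v)"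
    using f(2) unfolding k(2) pull2_def by (simp add: exp_add mult.assoc)
  ultimately show "(\<lambda>p u v. h (F p) (dmap A F p u) (dmap A F p v)) \<in> conformal_class A g"
    unfolding conformal_class_def by (intro CollectI exI[of _ "\<lambda>p. k (F p) + f p"] conjI)
qed

end

section \<open>Parallel complex structures\<close>

context weyl_structure
begin

definition parallel_hermitian :: "('m \<Rightarrow> 'e \<Rightarrow> 'e) \<Rightarrow> bool" where
  "parallel_hermitian I \<longleftrightarrow> endo_field A I \<and> (\<forall>p u. I p (I p u) = - u) \<and> (\<forall>p u v. g p (I p u) (I p v)
      = g p u v) \<and>
     (\<forall>Y p v. vector_field A Y \<longrightarrow> D (\<lambda>q. I q (Y q)) p v = I p (D Y p v))"

text \<open>Integrability follows from parallelism: torsion-freeness expresses the brackets in the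
  Nijenhuis tensor through \<open>D\<close>, and as \<open>I\<close> passes through \<open>D\<close>
  the terms cancel in pairs.\<close>

lemma parallel_hermitian_structure:
  assumes I: "parallel_hermitian I"
  shows "complex_structure A I" "\<forall>h\<in>conformal_class A g. hermitian_metric A I h" "parallel_endo A D I"
proof -
  have If: "endo_field A I" and II: "\<And>p u. I p (I p u) = - u"
      and gI: "\<And>p u v. g p (I p u) (I p v) = g p u v"
    and DI: "\<And>Y p v. vector_field A Y \<Longrightarrow> D (\<lambda>q. I q (Y q)) p v = I p (D Y p v)"
    using I by (auto simp: parallel_hermitian_def)
  have lin: "linear (I p)" for p using If by (simp add: endo_field_def)
  have "nijenhuis A I X Y p = 0" if v: "vector_field A X" "vector_field A Y" for X Y p
  proof -
    note iv = smooth_endo_field[OF If open_UNIV v(1)] smooth_endo_field[OF If open_UNIV v(2)]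
    show ?thesis
      unfolding nijenhuis_def torsion_free[OF iv, symmetric] torsion_free[OF iv(1) v(2), symmetric]
        torsion_free[OF v(1) iv(2), symmetric] torsion_free[OF v, symmetric] DI[OF v(1)] DI[OF v(2)]
      by (simp add: linear_diff[OF lin] II)
  qed
  then show "complex_structure A I"
    using If II by (simp add: complex_structure_def)
  show "parallel_endo A D I"
    using DI by (simp add: parallel_endo_def)
  show "\<forall>h\<in>conformal_class A g. hermitian_metric A I h"
  proof
    fix h assume "h \<in> conformal_class A g"
    then obtain f where f: "smooth_fun_on A UNIV f" "h = (\<lambda>p u v. exp (f p) * g p u v)"
      unfolding conformal_class_def by blast
    have ef: "smooth_fun_on A UNIV (\<lambda>q. exp (f q))"
      by (rule smooth_fun_compose[OF open_UNIV open_UNIV smooth_on_exp f(1)]) simp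
    have "smooth_fun_on A (fst k) (\<lambda>p. h p (coord_field A k u p) (coord_field A k v p))" if "k \<in> A"
        for k u v
      unfolding f(2) using metric that
      by (intro smooth_fun_mult chart_open smooth_fun_on_subset[OF ef]) (auto simp: riemannian_metric_def)
    moreover have "bilinear (h p)" for p
      by (auto simp: bilinear_def f(2) g_simps algebra_simps intro!: linearI)
    ultimately have "riemannian_metric A h"
      using g_sym g_pos by (simp add: riemannian_metric_def f(2))
    then show "hermitian_metric A I h"
      using gI by (simp add: hermitian_metric_def f(2))
  qed
qed

lemma endo_field_combination:
  assumes "endo_field A I" "endo_field A J"
  shows "endo_field A (\<lambda>p u. c *\<^sub>R I p u + d *\<^sub>R J p u)"
proof (rule endo_fieldI)
  show "linear (\<lambda>u. c *\<^sub>R I p u + d *\<^sub>R J p u)" for p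
    using assms by (intro linear_compose_add linear_compose_scale_right) (auto simp: endo_field_def)
  show "smooth_field_on A W (\<lambda>p. c *\<^sub>R I p (X p) + d *\<^sub>R J p (X p))" if "open W" "smooth_field_on A W X"
      for W X
    using smooth_field_add[OF that(1) smooth_field_scaleR[OF that(1) smooth_fun_const
        smooth_endo_field[OF assms(1) that]]
        smooth_field_scaleR[OF that(1) smooth_fun_const smooth_endo_field[OF assms(2) that]]] .
qed

lemma endo_field_compose:
  assumes "endo_field A I" "endo_field A J"
  shows "endo_field A (\<lambda>p u. I p (J p u))"
proof (rule endo_fieldI)
  show "linear (\<lambda>u. I p (J p u))" for p
    using assms linear_compose[of "J p" "I p"] by (simp add: endo_field_def o_def)
  show "smooth_field_on A W (\<lambda>p. I p (J p (X p)))" if "open W" "smooth_field_on A W X" for W X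
    by (rule smooth_endo_field[OF assms(1) that(1) smooth_endo_field[OF assms(2) that]])
qed

lemma parallel_hermitian_skew:
  assumes "parallel_hermitian I"
  shows "g p (I p u) v = - g p u (I p v)"
proof -
  have "g p (I p (I p u)) (I p v) = g p (I p u) v" "I p (I p u) = - u"
    using assms unfolding parallel_hermitian_def by blast+
  then show ?thesis by (simp add: g_simps)
qed

lemma anticommuting_lchk:
  assumes I: "parallel_hermitian I" and J: "parallel_hermitian J"
      and anti: "\<And>p u. I p (J p u) = - J p (I p u)"
  shows "lchk_manifold A (conformal_class A g) D"
proof -
  define K where "K p u = I p (J p u)" for p u
  have eI: "endo_field A I" and eJ: "endo_field A J" using I J by (auto simp: parallel_hermitian_def)
  have lin: "linear (I p)" for p using eI by (simp add: endo_field_def)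
  have sq: "I p (I p u) = - u" "J p (J p u) = - u" for p u
    using I J by (auto simp: parallel_hermitian_def)
  have "parallel_hermitian K"
    unfolding parallel_hermitian_def
  proof (intro conjI allI impI)
    show "endo_field A K"
      unfolding K_def[abs_def] by (rule endo_field_compose[OF eI eJ])
    show "K p (K p u) = - u" for p u
    proof -
      have "J p (I p (J p u)) = I p u"
        using anti[of p "J p u"] by (simp add: sq linear_neg[OF lin])
      then show ?thesis by (simp add: K_def sq)
    qed
    show "g p (K p u) (K p v) = g p u v" for p u v
      using I J by (simp add: parallel_hermitian_def K_def)
    show "D (\<lambda>q. K q (Y q)) p v = K p (D Y p v)" if Y: "vector_field A Y" for Y p v
    proof -
      have "D (\<lambda>q. I q (J q (Y q))) p v = I p (D (\<lambda>q. J q (Y q)) p v)"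
        using I smooth_endo_field[OF eJ open_UNIV Y] unfolding parallel_hermitian_def by blast
      also have "\<dots> = I p (J p (D Y p v))"
        using J Y by (simp add: parallel_hermitian_def)
      finally show ?thesis by (simp add: K_def)
    qed
  qed
  note s = parallel_hermitian_structure[OF I] parallel_hermitian_structure[OF J]
      parallel_hermitian_structure[OF this]
  show ?thesis
    unfolding lchk_manifold_def
    by (intro exI[of _ I] exI[of _ J] exI[of _ K]) (use s anti in \<open>auto simp: K_def\<close>)
qed

end

text \<open>Vanishing derivative on a convex ball in a chart gives local constancy, which
  connectedness spreads to the whole manifold.\<close>

lemma (in smooth_manifold) dfun_zero_const:
  assumes conn: "connected (UNIV :: 'm set)" and f: "smooth_fun_on A UNIV f"
      and df: "\<And>p v. dfun A f p v = 0"
  shows "f p = f q"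
proof (rule connected_local_const[OF conn UNIV_I UNIV_I], rule ballI)
  fix p
  define k where "k = pchart A p"
  have k: "k \<in> A" "p \<in> fst k" by (simp_all add: k_def pchart)
  have "open (snd k ` fst k)" "snd k p \<in> snd k ` fst k"
    using chart_image_open[OF k(1) chart_open[OF k(1)]] k(2) by auto
  then obtain r where r: "r > 0" "ball (snd k p) r \<subseteq> snd k ` fst k"
    using open_contains_ball by blast
  have d: "((f \<circ> chart_inv k) has_derivative (\<lambda>h. 0)) (at x)" if x: "x \<in> ball (snd k p) r" for x
  proof -
    obtain q where q: "q \<in> fst k" "x = snd k q" using x r(2) by blast
    show ?thesis
      using dfun_chart[OF open_UNIV f UNIV_I k(1) q(1)] unfolding q(2) df .
  qed
  define U where "U = fst k \<inter> snd k -` ball (snd k p) r"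
  have U: "open U" "p \<in> U"
    unfolding U_def using continuous_open_preimage[OF chart_continuous[OF k(1)] chart_open[OF k(1)]
        open_ball] k(2) r(1)
    by auto
  have "f q = f p" if q: "q \<in> U" for q
  proof -
    have m: "snd k q \<in> ball (snd k p) r" "snd k p \<in> ball (snd k p) r"
      using q r(1) by (auto simp: U_def)
    have "(f \<circ> chart_inv k) (snd k q) = (f \<circ> chart_inv k) (snd k p)"
      using has_derivative_zero_unique[OF convex_ball _ m, of "f \<circ> chart_inv k"]
          has_derivative_at_withinI[OF d] by blast
    then show ?thesis using q k by (simp add: U_def chart_inv_left)
  qed
  then show "\<forall>\<^sub>F q in at p within UNIV. f p = f q"
    using U unfolding eventually_at_topological by metis
qed

text \<open>For parallel complex structures \<open>I\<close>, \<open>J\<close> the symmetric part \<open>IJ + JI\<close> is a constant \<open>- 2 a\<close> by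
  irreducibility; unless \<open>\<bar>a\<bar> = 1\<close>, normalizing \<open>I - a J\<close> gives a complex structure anticommuting with \<open>J\<close>.\<close>

lemma (in irreducible_weyl) parallel_hermitian_unique:
  assumes conn: "connected (UNIV :: 'm set)" and I: "parallel_hermitian I" and J: "parallel_hermitian J"
    and nlchk: "\<not> lchk_manifold A (conformal_class A g) D"
  obtains \<epsilon> :: real where "\<epsilon> * \<epsilon> = 1" "\<And>p u. I p u = \<epsilon> *\<^sub>R J p u"
proof -
  have eI: "endo_field A I" and eJ: "endo_field A J" using I J by (auto simp: parallel_hermitian_def)
  have linI: "linear (I p)" and linJ: "linear (J p)" for p using eI eJ by (simp_all add: endo_field_def)
  have sq: "I p (I p u) = - u" "J p (J p u) = - u" for p u
    using I J by (auto simp: parallel_hermitian_def)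
  have DI: "D (\<lambda>q. I q (Y q)) p v = I p (D Y p v)" and DJ: "D (\<lambda>q. J q (Y q)) p v = J p (D Y p v)"
    if "vector_field A Y" for Y p v
    using I J that by (auto simp: parallel_hermitian_def)
  note skI = parallel_hermitian_skew[OF I] and skJ = parallel_hermitian_skew[OF J]
  note simps = linear_add[OF linI] linear_add[OF linJ] linear_diff[OF linI] linear_diff[OF linJ]
    linear_scale[OF linI] linear_scale[OF linJ] linear_neg[OF linI] linear_neg[OF linJ]
  have vI: "vector_field A (\<lambda>q. I q (Y q))" and vJ: "vector_field A (\<lambda>q. J q (Y q))" if "vector_field A Y"
      for Y
    using smooth_endo_field[OF eI open_UNIV that] smooth_endo_field[OF eJ open_UNIV that] by auto
  define S where "S p u = I p (J p u) + J p (I p u)" for p u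
  have vS: "vector_field A (\<lambda>q. S q (Y q))" if "vector_field A Y" for Y
    unfolding S_def by (rule smooth_field_add[OF open_UNIV vI[OF vJ[OF that]] vJ[OF vI[OF that]]])
  have linS: "linear (S p)" for p
    by (rule linearI) (simp_all add: S_def simps scaleR_add_right)
  have DS: "D (\<lambda>q. S q (Y q)) p v = S p (D Y p v)" if "vector_field A Y" for Y p v
    unfolding S_def using D_add[OF open_UNIV vI[OF vJ[OF that]] vJ[OF vI[OF that]] UNIV_I, of p v]
    by (simp add: DI DJ vI vJ that)
  define b where "b p u v = g p (S p u) v" for p u v
  have bf: "bilinear_field b"
  proof (rule bilinear_fieldI)
    show "bilinear (b p)" for p
      by (auto simp: bilinear_def b_def g_simps linear_add[OF linS] linear_scale[OF linS] intro!: linearI)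
    show "smooth_fun_on A W (\<lambda>p. b p (X p) (Y p))"
      if W: "open W" "smooth_field_on A W X" "smooth_field_on A W Y" for W X Y
    proof -
      have "smooth_field_on A W (\<lambda>p. S p (X p))"
        unfolding S_def
        by (rule smooth_field_add[OF W(1) smooth_endo_field[OF eI W(1) smooth_endo_field[OF eJ W(1,2)]]
              smooth_endo_field[OF eJ W(1) smooth_endo_field[OF eI W(1,2)]]])
      then show ?thesis
        unfolding b_def by (rule smooth_bilinear_field[OF g_field W(1) _ W(3)])
    qed
  qed
  \<comment> \<open>\<open>S\<close> commutes with \<open>D\<close>, so lowering it by
    \<open>g\<close> gives a form with the one-form of \<open>g\<close> itself.\<close>
  have rec: "recurrent b \<theta>"
    unfolding recurrent_def using bf lee compatible[OF vS] by (simp add: b_def DS)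
  have sym: "b p u v = b p v u" for p u v
    using skI[of p "J p u" v] skJ[of p u "I p v"] skJ[of p "I p u" v] skI[of p u "J p v"]
      g_sym[of p u "J p (I p v)"] g_sym[of p u "I p (J p v)"]
    by (simp add: b_def S_def g_simps)
  have "\<exists>\<mu>. \<forall>v w. b p v w = \<mu> * g p v w" for p
    using recurrent_proportional[OF rec sym, of p] by metis
  then obtain \<mu> where \<mu>: "\<And>p v w. b p v w = \<mu> p * g p v w" by metis
  have S: "S p u = \<mu> p *\<^sub>R u" for p u
  proof -
    have "g p (S p u - \<mu> p *\<^sub>R u) w = 0" for w
      using \<mu>[of p u w] by (simp add: b_def g_simps)
    from g_zero[OF this] show ?thesis by simp
  qed
  have sm: "smooth_fun_on A UNIV \<mu>" by (rule smooth_factor[OF bf \<mu>])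
  \<comment> \<open>\<open>S\<close> is parallel and equals \<mu> times the identity, while the
    Leibniz rule produces the extra term d\<mu> \<otimes> \<open>Y\<close>, which must
    vanish.\<close>
  have d\<mu>: "dfun A \<mu> p v = 0" for p v
  proof -
    obtain i :: 'e where i: "i \<in> Basis" using nonempty_Basis by blast
    obtain Y where Y: "vector_field A Y" "Y p = i" using field_through by blast
    have "dfun A \<mu> p v *\<^sub>R Y p + \<mu> p *\<^sub>R D Y p v = D (\<lambda>q. S q (Y q)) p v"
      unfolding S by (rule D_leibniz[OF open_UNIV sm Y(1) UNIV_I, symmetric])
    also have "\<dots> = \<mu> p *\<^sub>R D Y p v"
      using DS[OF Y(1), of p v] by (simp add: S[of p])
    finally show ?thesis using i Y(2) by auto
  qed
  obtain p0 :: 'm where True by blast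
  \<comment> \<open>Chosen so that \<open>I J + J I\<close> is -2a; any base point gives the same
    value because \<mu> is constant.\<close>
  define a where "a = - \<mu> p0 / 2"
  have Sa: "I p (J p u) + J p (I p u) = (- 2 * a) *\<^sub>R u" for p u
    using S[of p u] dfun_zero_const[OF conn sm d\<mu>, of p p0] by (simp add: S_def a_def)
  have IJ: "I p (J p u) = - J p (I p u) - (2 * a) *\<^sub>R u" for p u
    using Sa[of p u] by (simp add: eq_neg_iff_add_eq_0 algebra_simps)
  \<comment> \<open>The anticommutator of \<open>I\<close> with \<open>J\<close> is -2a, and that of
    \<open>a J\<close> with \<open>J\<close> is -2a as well, so \<open>K\<close> anticommutes with
    \<open>J\<close>. Its square is a^2 - 1.\<close>
  define K where "K p u = I p u - a *\<^sub>R J p u" for p u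
  have KK: "K p (K p u) = (a * a - 1) *\<^sub>R u" for p u
    unfolding K_def by (simp add: simps sq IJ algebra_simps) (simp flip: scaleR_add_left)
  have KJ: "K p (J p u) = - J p (K p u)" for p u
    unfolding K_def by (simp add: simps sq IJ algebra_simps) (simp flip: scaleR_add_left)
  have skK: "g p (K p u) w = - g p u (K p w)" for p u w
    using skI[of p u w] skJ[of p u w] by (simp add: K_def g_simps)
  have gK: "g p (K p u) (K p v) = (1 - a * a) * g p u v" for p u v
    using skK[of p u "K p v"] by (simp add: KK g_simps algebra_simps)
  show ?thesis
  proof (cases "a * a = 1")
    case True
    have "I p u = a *\<^sub>R J p u" for p u
      using g_zero[of p "K p u"] gK[of p u u] True by (simp add: K_def)
    then show ?thesis using that True by blast
  next
    case False
    \<comment> \<open>By \<open>gK\<close> this is the squared length of \<open>K p0 i\<close>; it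
      excludes a^2 > 1.\<close>
    have "(1 - a * a) * g p0 i i \<ge> 0" for i
      using gK[of p0 i i] g_pos[of "K p0 i" p0] by (cases "K p0 i = 0") (auto simp: g_simps less_imp_le)
    moreover obtain i :: 'e where "i \<in> Basis" using nonempty_Basis by blast
    then have "g p0 i i > 0" by (intro g_pos) auto
    ultimately have lt: "1 - a * a > 0"
      using False by (metis diff_gt_0_iff_gt eq_iff_diff_eq_0 linorder_neqE_linordered_idom mult_neg_pos
          not_less)
    \<comment> \<open>The factor that turns \<open>K\<close>, with square a^2 - 1, into a complex
      structure, and by \<open>gK\<close> also into an isometry.\<close>
    define c where "c = inverse (sqrt (1 - a * a))"
    have c: "c * c * (1 - a * a) = 1"
      using lt by (simp add: c_def field_simps power2_eq_square[symmetric])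
    \<comment> \<open>This is \<open>c *\<^sub>R K p u\<close>, spelled out as a combination of
      \<open>I\<close> and \<open>J\<close> with constant coefficients to fit
      \<open>endo_field_combination\<close> and the linearity of \<open>D\<close>.\<close>
    have "parallel_hermitian (\<lambda>p u. c *\<^sub>R I p u + (- c * a) *\<^sub>R J p u)"
      unfolding parallel_hermitian_def
    proof (intro conjI allI impI)
      have L: "c *\<^sub>R I p u + (- c * a) *\<^sub>R J p u = c *\<^sub>R K p u" for p u
        by (simp add: K_def scaleR_diff_right)
      have linK: "K p (c *\<^sub>R u) = c *\<^sub>R K p u" for p u
        by (simp add: K_def simps algebra_simps)
      show "endo_field A (\<lambda>p u. c *\<^sub>R I p u + (- c * a) *\<^sub>R J p u)"
        by (rule endo_field_combination[OF eI eJ])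
      have "(c * c * (a * a - 1)) *\<^sub>R u = - u" for u :: 'e
      proof -
        have "c * c * (a * a - 1) = -1" using c by (simp add: algebra_simps)
        then show ?thesis by simp
      qed
      then show "c *\<^sub>R I p (c *\<^sub>R I p u + (- c * a) *\<^sub>R J p u) + (- c * a) *\<^sub>R J p (c *\<^sub>R I p u
          + (- c * a) *\<^sub>R J p u) = - u" for p u
        unfolding L linK KK by (simp add: mult.assoc)
      show "g p (c *\<^sub>R I p u + (- c * a) *\<^sub>R J p u) (c *\<^sub>R I p v + (- c * a) *\<^sub>R J p v) = g p u v" for p u v
        unfolding L by (simp add: g_simps gK) (metis c mult.assoc mult_1)
      show "D (\<lambda>q. c *\<^sub>R I q (Y q) + (- c * a) *\<^sub>R J q (Y q)) p v = c *\<^sub>R I p (D Y p v)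
          + (- c * a) *\<^sub>R J p (D Y p v)"
        if Y: "vector_field A Y" for Y p v
      proof -
        have cI: "vector_field A (\<lambda>q. c *\<^sub>R I q (Y q))"
            and cJ: "vector_field A (\<lambda>q. (- c * a) *\<^sub>R J q (Y q))"
          using smooth_field_scaleR[OF open_UNIV smooth_fun_const vI[OF Y], of c]
            smooth_field_scaleR[OF open_UNIV smooth_fun_const vJ[OF Y], of "- c * a"] by auto
        show ?thesis
          unfolding D_add[OF open_UNIV cI cJ UNIV_I] D_cmult[OF vI[OF Y]] D_cmult[OF vJ[OF Y]] DI[OF Y]
              DJ[OF Y] ..
      qed
    qed
    then have "lchk_manifold A (conformal_class A g) D"
    proof (rule anticommuting_lchk[OF _ J])
      show "c *\<^sub>R I p (J p u) + (- c * a) *\<^sub>R J p (J p u) = - J p (c *\<^sub>R I p u + (- c * a) *\<^sub>R J p u)"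
          for p u
        using arg_cong[OF KJ[of p u], of "scaleR c"] by (simp add: K_def simps algebra_simps)
    qed
    then show ?thesis using nlchk by blast
  qed
qed

context weyl_structure
begin

text \<open>An isometry of the pulled back metric is one of \<open>g\<close>, as the conformal
  factor occurs on both sides. Parallelism is checked after applying the differential of
  \<open>F\<close>, which is injective and intertwines \<open>D\<close> with itself.\<close>

lemma pull_parallel_hermitian:
  assumes F: "F \<in> aff_group A D" and I: "parallel_hermitian I"
    and conf: "\<And>p u v. pull2 F g p u v = exp (f p) * g p u v"
  shows "parallel_hermitian (pull_endo F I)"
proof -
  have dF: "diffeo A F" and aff: "\<And>Y p v. vector_field A Y \<Longrightarrow>
      dmap A F p (D Y p v) = D (pushforward A F Y) (F p) (dmap A F p v)"
    using F by (auto simp: aff_group_def)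
  have sG: "smooth_map A (inv F)" using dF by (simp add: diffeo_def)
  have eI: "endo_field A I" and sq: "\<And>p u. I p (I p u) = - u"
      and gI: "\<And>p u v. g p (I p u) (I p v) = g p u v"
    and DI: "\<And>Y p v. vector_field A Y \<Longrightarrow> D (\<lambda>q. I q (Y q)) p v = I p (D Y p v)"
    using I by (auto simp: parallel_hermitian_def)
  have dI: "dmap A F p (pull_endo F I p u) = I (F p) (dmap A F p u)" for p u
    by (simp add: pull_endo_def dmap_inv_right[OF dF])
  show ?thesis
    unfolding parallel_hermitian_def
  proof (intro conjI allI impI)
    show "endo_field A (pull_endo F I)" by (rule endo_field_pull_endo[OF dF eI])
    show "pull_endo F I p (pull_endo F I p u) = - u" for p u
    proof -
      have "pull_endo F I p (pull_endo F I p u) = dmap A (inv F) (F p) (- dmap A F p u)"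
        unfolding pull_endo_def[of F I p "pull_endo F I p u"] dI sq ..
      then show ?thesis
        by (simp add: linear_neg[OF linear_dmap[OF sG]] dmap_inv_left[OF dF])
    qed
    show "g p (pull_endo F I p u) (pull_endo F I p v) = g p u v" for p u v
    proof -
      have "pull2 F g p (pull_endo F I p u) (pull_endo F I p v) = pull2 F g p u v"
        by (simp add: pull2_def dI gI)
      then show ?thesis by (simp add: conf)
    qed
    show "D (\<lambda>q. pull_endo F I q (Y q)) p v = pull_endo F I p (D Y p v)" if Y: "vector_field A Y" for Y p v
    proof (rule dmap_inj[OF dF])
      have "vector_field A (\<lambda>q. pull_endo F I q (Y q))"
        by (rule smooth_endo_field[OF endo_field_pull_endo[OF dF eI] open_UNIV Y])
      moreover have "pushforward A F (\<lambda>q. pull_endo F I q (Y q)) = (\<lambda>q. I q (pushforward A F Y q))"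
        by (rule pushforward_eqI[OF dF]) (simp add: dI pushforward_app[OF dF])
      ultimately show "dmap A F p (D (\<lambda>q. pull_endo F I q (Y q)) p v)
          = dmap A F p (pull_endo F I p (D Y p v))"
        using aff[of "\<lambda>q. pull_endo F I q (Y q)" p v]
        by (simp add: dI aff[OF Y] DI[OF vector_field_pushforward[OF dF Y]])
    qed
  qed
qed

end

section \<open>Comparison of the two Lie algebras through their flows\<close>

theorem corollary2p3:
  fixes A :: "('m::{t2_space,second_countable_topology}, 'e::euclidean_space) chart set"
    and c :: "('m \<Rightarrow> 'e \<Rightarrow> 'e \<Rightarrow> real) set"
    and J :: "'m \<Rightarrow> 'e \<Rightarrow> 'e"
    and D :: "('m \<Rightarrow> 'e) \<Rightarrow> 'm \<Rightarrow> 'e \<Rightarrow> 'e"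
    and n :: nat
  assumes "smooth_atlas A"
    and "connected (UNIV :: 'm set)"
    and "DIM('e) = 2 * n" and "n \<ge> 2"
    and "lck_manifold A c J D"
    and "\<not> globally_conformally_kaehler A c J"
    and "\<not> lchk_manifold A c D"
    and "\<forall>p. acts_irreducibly (restricted_holonomy A D p)"
  shows "aff_algebra A D = aut_algebra A c J"
proof -
  obtain g \<theta> where c: "c = conformal_class A g" and lck: "lck_structure A g \<theta> D J"
    using lck_manifold_structure[OF assms(1,5)] by blast
  interpret lck_structure A g \<theta> D J by (rule lck)
  interpret irreducible_weyl A g \<theta> D
    by unfold_locales (use assms(8) in blast)
  have J: "parallel_hermitian J"
    using J_field JJ hermitian D_J by (simp add: parallel_hermitian_def)
  have aut: "F \<in> aff_group A D" if "F \<in> aut_group A c J" for F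
    using automorphism_affine that assms(3,4) unfolding c by simp
  text \<open>An affine map \<open>F\<close> satisfies \<open>F\<^sup>*J = \<epsilon> J\<close> with a sign \<open>\<epsilon>\<close>, and \<open>\<epsilon>\<^sup>2 = 1\<close> makes the time-\<open>t\<close> map of a
    flow, being the square of the time-\<open>t/2\<close> map, biholomorphic.\<close>
  have aff: "F \<circ> F \<in> aut_group A c J" if F: "F \<in> aff_group A D" and FF: "F \<circ> F \<in> aff_group A D" for F
  proof -
    have dF: "diffeo A F" and dFF: "diffeo A (F \<circ> F)" using F FF by (simp_all add: aff_group_def)
    have sF: "smooth_map A F" using dF by (simp add: diffeo_def)
    obtain f where conf: "\<And>p u v. pull2 F g p u v = exp (f p) * g p u v"
      using affine_conformal[OF F] by metis
    obtain \<epsilon> where \<epsilon>: "\<epsilon> * \<epsilon> = 1" "\<And>p u. pull_endo F J p u = \<epsilon> *\<^sub>R J p u"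
      using parallel_hermitian_unique[OF assms(2) pull_parallel_hermitian[OF F J conf] J] assms(7)
          unfolding c by metis
    have hol: "J (F p) (dmap A F p u) = \<epsilon> *\<^sub>R dmap A F p (J p u)" for p u
    proof -
      have "J (F p) (dmap A F p u) = dmap A F p (pull_endo F J p u)"
        by (simp add: pull_endo_def dmap_inv_right[OF dF])
      then show ?thesis
        by (simp add: \<epsilon>(2) linear_scale[OF linear_dmap[OF sF]])
    qed
    have "dmap A (F \<circ> F) p (J p v) = J ((F \<circ> F) p) (dmap A (F \<circ> F) p v)" for p v
      unfolding dmap_comp[OF sF sF] o_apply hol
      by (simp add: hol linear_scale[OF linear_dmap[OF sF]] \<epsilon>(1))
    then show ?thesis
      using dFF affine_conformal_map[OF FF] by (simp add: aut_group_def biholomorphic_def c)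
  qed
  have "X \<in> aut_algebra A c J" if X: "X \<in> aff_algebra A D" for X
  proof -
    obtain \<Phi> where \<Phi>: "vector_field A X" "is_flow A X \<Phi>" "\<And>t. \<Phi> t \<in> aff_group A D"
      using X unfolding aff_algebra_def lie_algebra_def by blast
    have "\<Phi> t \<in> aut_group A c J" for t
    proof -
      have "\<Phi> t = \<Phi> (t / 2) \<circ> \<Phi> (t / 2)"
        using \<Phi>(2) unfolding is_flow_def by (metis field_sum_of_halves)
      then show ?thesis
        using aff[OF \<Phi>(3)[of "t / 2"]] \<Phi>(3)[of t] by simp
    qed
    then show ?thesis
      using \<Phi> unfolding aut_algebra_def lie_algebra_def by blast
  qed
  moreover have "X \<in> aff_algebra A D" if "X \<in> aut_algebra A c J" for X
    using that aut unfolding aff_algebra_def aut_algebra_def lie_algebra_def by blast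
  ultimately show ?thesis by blast
qed

end
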